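(* Let $T$ be an arbitrary first-order theory, $\mathcal{U}$ a monster model of $T$, and $x,y$ finite tuples of variables. (1) Let $\mu \in \mathfrak{M}_{x}(\mathcal{U})$ and $\nu \in \mathfrak{M}_{y}(\mathcal{U})$. Assume that $\mu$ is Borel-definable. Then $\mu \otimes \nu = \mu \tilde{\otimes} \nu$. (2) If $\mu \in \mathfrak{M}_x(\mathcal{U})$ is invariant and $q\in S_y(\mathcal{U})$ is arbitrary, then $(\mu,\delta_q)$ is Borel and $\mu \tilde{\otimes} \delta_q$ is well-defined. (3) Let $p \in S_{x}(\mathcal{U})$ and $q \in S_{y}(\mathcal{U})$, with $p$ invariant. Then $\delta_{p \otimes q} = \delta_p \tilde{\otimes} \delta_q$.
   Context: "Small" means small relative to the saturation of $\mathcal{U}$. For $A\subseteq\mathcal{U}$, $\mathfrak{M}_x(A)$ is the set of Keisler measures over $A$ (finitely additive probability measures on the Boolean algebra $\mathcal{L}_x(A)$ of formulas in $x$ over $A$), each identified with a regular Borel probability measure on $S_x(A)$; $\mu|_A$ denotes restriction, $\delta_p$ is the Dirac measure at the type $p$, and $S(\mu)=\{p\in S_x(A):\mu(\varphi)>0\text{ for all }\varphi\in p\}$ is the support of $\mu\in\mathfrak{M}_x(A)$. $\mu\in\mathfrak{M}_x(\mathcal{U})$ is invariant if there is a small $M\prec\mathcal{U}$ such that $\mu(\varphi(x;b))$ depends only on $\mathrm{tp}(b/M)$ for every $\mathcal{L}(M)$-formula $\varphi(x;y)$ ($y$ any finite tuple of variables; likewise for types); it is Borel-definable over $M$ if moreover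 the map $F^\varphi_{\mu,M}:S_y(M)\to[0,1]$, $\mathrm{tp}(b/M)\mapsto\mu(\varphi(x;b))$, is Borel for each such $\varphi$. Standard product: if $\mu$ is Borel-definable, $(\mu\otimes\nu)(\varphi(x,y)):=\int_{S_y(N)}F^\varphi_{\mu,N}\,d(\nu|_N)$, where $N\prec\mathcal{U}$ is any small model containing the parameters of $\varphi$ and such that $\mu$ is Borel-definable over $N$. Extended product: for $\varphi(x,y,\bar c)\in\mathcal{L}_{xy}(\mathcal{U})$, the triple $(\mu,\nu,\varphi)$ is Borel if there is a small $N\prec\mathcal{U}$ such that $\bar c\subseteq N$; for every $q\in S(\nu|_N)$ and $d,d'\models q$ in $\mathcal{U}^y$, $\mu(\varphi(x,d,\bar c))=\mu(\varphi(x,d',\bar c))$; and the map $F^\varphi_{\mu,N}:S(\nu|_N)\to[0,1]$, $F^{\varphi}_{\mu,N}(q)=\mu(\varphi(x,d,\bar c))$ for $d\models q$, is Borel. The pair $(\mu,\nu)$ is Borel if $(\mu,\nu,\varphi)$ is Borel for all $\varphi$; in that case $(\mu\tilde\otimes\nu)(\varphi(x,y,\bar c)):=\int_{S(\nu|_N)}F^\varphi_{\mu,N}\,d\nu_N$, where $N$ witnesses that $(\mu,\nu,\varphi)$ is Borel and $\nu_N$ is the restriction of the Borel measure $\nu|_N$ to $S(\nu|_N)$ (the value does not depend on $N$). Product of types: for $p\in S_x(\mathcal{U})$ invariant over a small $M$ and $q\in S_y(\mathcal{U})$, $p\otimes q:=\mathrm{tp}(a,b/\mathcal{U})$ where (in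 a larger monster model) $b\models q$ and $a$ realizes the restriction to $\mathcal{U}b$ of the unique $M$-invariant extension of $p$. *)

theory Defs
  imports "HOL-Probability.Probability"
begin

unbundle cardinal_syntax

section \<open>First-order logic with parameters\<close>

datatype ('f, tm_pars: 'a) tm =
    Var nat
  | Par 'a
  | Fn 'f "('f, 'a) tm list"

datatype ('f, 'r, fm_pars: 'a) fm =
    Eq "('f, 'a) tm" "('f, 'a) tm"
  | Rel 'r "('f, 'a) tm list"
  | Neg "('f, 'r, 'a) fm"
  | Conj "('f, 'r, 'a) fm" "('f, 'r, 'a) fm"
  | Exi nat "('f, 'r, 'a) fm"

definition Disj :: "('f, 'r, 'a) fm \<Rightarrow> ('f, 'r, 'a) fm \<Rightarrow> ('f, 'r, 'a) fm" where
  "Disj \<phi> \<psi> = Neg (Conj (Neg \<phi>) (Neg \<psi>))"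

text \<open>A structure carries its own language: the symbols are those of defined arity. So languages
  without function symbols or without relation symbols are included, although types are nonempty.\<close>

record ('f, 'r, 'a) struct =
  fun_ar :: "'f \<rightharpoonup> nat"
  rel_ar :: "'r \<rightharpoonup> nat"
  univ :: "'a set"
  fun_int :: "'f \<Rightarrow> 'a list \<Rightarrow> 'a"
  rel_int :: "'r \<Rightarrow> 'a list \<Rightarrow> bool"

definition is_structure :: "('f, 'r, 'a) struct \<Rightarrow> bool" where
  "is_structure M \<longleftrightarrow> univ M \<noteq> {} \<and>
     (\<forall>f as. fun_ar M f = Some (length as) \<and> set as \<subseteq> univ M \<longrightarrow> fun_int M f as \<in> univ M)"

fun tm_wf :: "('f, 'r, 'a) struct \<Rightarrow> ('f, 'a) tm \<Rightarrow> bool" where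
  "tm_wf M (Var n) \<longleftrightarrow> True"
| "tm_wf M (Par a) \<longleftrightarrow> True"
| "tm_wf M (Fn f ts) \<longleftrightarrow> fun_ar M f = Some (length ts) \<and> (\<forall>t\<in>set ts. tm_wf M t)"

primrec fm_wf :: "('f, 'r, 'a) struct \<Rightarrow> ('f, 'r, 'a) fm \<Rightarrow> bool" where
  "fm_wf M (Eq s t) \<longleftrightarrow> tm_wf M s \<and> tm_wf M t"
| "fm_wf M (Rel r ts) \<longleftrightarrow> rel_ar M r = Some (length ts) \<and> (\<forall>t\<in>set ts. tm_wf M t)"
| "fm_wf M (Neg \<phi>) \<longleftrightarrow> fm_wf M \<phi>"
| "fm_wf M (Conj \<phi> \<psi>) \<longleftrightarrow> fm_wf M \<phi> \<and> fm_wf M \<psi>"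
| "fm_wf M (Exi n \<phi>) \<longleftrightarrow> fm_wf M \<phi>"

fun tm_fv :: "('f, 'a) tm \<Rightarrow> nat set" where
  "tm_fv (Var n) = {n}"
| "tm_fv (Par a) = {}"
| "tm_fv (Fn f ts) = (\<Union>t\<in>set ts. tm_fv t)"

primrec fv :: "('f, 'r, 'a) fm \<Rightarrow> nat set" where
  "fv (Eq s t) = tm_fv s \<union> tm_fv t"
| "fv (Rel r ts) = (\<Union>t\<in>set ts. tm_fv t)"
| "fv (Neg \<phi>) = fv \<phi>"
| "fv (Conj \<phi> \<psi>) = fv \<phi> \<union> fv \<psi>"
| "fv (Exi n \<phi>) = fv \<phi> - {n}"

primrec tm_val :: "('f, 'r, 'a) struct \<Rightarrow> (nat \<Rightarrow> 'a) \<Rightarrow> ('f, 'a) tm \<Rightarrow> 'a" where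
  "tm_val M v (Var n) = v n"
| "tm_val M v (Par a) = a"
| "tm_val M v (Fn f ts) = fun_int M f (map (tm_val M v) ts)"

primrec sat :: "('f, 'r, 'a) struct \<Rightarrow> (nat \<Rightarrow> 'a) \<Rightarrow> ('f, 'r, 'a) fm \<Rightarrow> bool" where
  "sat M v (Eq s t) \<longleftrightarrow> tm_val M v s = tm_val M v t"
| "sat M v (Rel r ts) \<longleftrightarrow> rel_int M r (map (tm_val M v) ts)"
| "sat M v (Neg \<phi>) \<longleftrightarrow> \<not> sat M v \<phi>"
| "sat M v (Conj \<phi> \<psi>) \<longleftrightarrow> sat M v \<phi> \<and> sat M v \<psi>"
| "sat M v (Exi n \<phi>) \<longleftrightarrow> (\<exists>a\<in>univ M. sat M (v(n := a)) \<phi>)"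

text \<open>\<open>inst z b \<phi>\<close> replaces the free variables in \<open>z\<close> by the parameters \<open>b\<close>:
  it turns \<open>\<phi>(x; z)\<close> into \<open>\<phi>(x; b)\<close>.\<close>

primrec inst_tm :: "nat set \<Rightarrow> (nat \<Rightarrow> 'a) \<Rightarrow> ('f, 'a) tm \<Rightarrow> ('f, 'a) tm" where
  "inst_tm z b (Var n) = (if n \<in> z then Par (b n) else Var n)"
| "inst_tm z b (Par a) = Par a"
| "inst_tm z b (Fn f ts) = Fn f (map (inst_tm z b) ts)"

primrec inst :: "nat set \<Rightarrow> (nat \<Rightarrow> 'a) \<Rightarrow> ('f, 'r, 'a) fm \<Rightarrow> ('f, 'r, 'a) fm" where
  "inst z b (Eq s t) = Eq (inst_tm z b s) (inst_tm z b t)"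
| "inst z b (Rel r ts) = Rel r (map (inst_tm z b) ts)"
| "inst z b (Neg \<phi>) = Neg (inst z b \<phi>)"
| "inst z b (Conj \<phi> \<psi>) = Conj (inst z b \<phi>) (inst z b \<psi>)"
| "inst z b (Exi n \<phi>) = Exi n (inst (z - {n}) b \<phi>)"

text \<open>A finite tuple of variables is represented by the finite set \<open>x\<close> of its members, and
  \<open>M\<^sup>x\<close> by the functions from \<open>x\<close> to the universe. \<open>Lfm M x A\<close> is the set of formulas in the
  variables \<open>x\<close> with parameters in \<open>A\<close>.\<close>

definition tuples :: "('f, 'r, 'a) struct \<Rightarrow> nat set \<Rightarrow> (nat \<Rightarrow> 'a) set" where
  "tuples M x = x \<rightarrow>\<^sub>E univ M"

definition Lfm :: "('f, 'r, 'a) struct \<Rightarrow> nat set \<Rightarrow> 'a set \<Rightarrow> ('f, 'r, 'a) fm set" where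
  "Lfm M x A = {\<phi>. fm_wf M \<phi> \<and> fv \<phi> \<subseteq> x \<and> fm_pars \<phi> \<subseteq> A}"

definition defset :: "('f, 'r, 'a) struct \<Rightarrow> nat set \<Rightarrow> ('f, 'r, 'a) fm \<Rightarrow> (nat \<Rightarrow> 'a) set" where
  "defset M x \<phi> = {a \<in> tuples M x. sat M a \<phi>}"

definition elem_sub :: "('f, 'r, 'a) struct \<Rightarrow> ('f, 'r, 'a) struct \<Rightarrow> bool" where
  "elem_sub N M \<longleftrightarrow> is_structure N \<and> is_structure M \<and>
     fun_ar N = fun_ar M \<and> rel_ar N = rel_ar M \<and> univ N \<subseteq> univ M \<and>
     (\<forall>\<phi> \<in> Lfm M UNIV {}. \<forall>v \<in> UNIV \<rightarrow> univ N. sat N v \<phi> = sat M v \<phi>)"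

section \<open>Types and monster models\<close>

definition tp :: "('f, 'r, 'a) struct \<Rightarrow> nat set \<Rightarrow> 'a set \<Rightarrow> (nat \<Rightarrow> 'a) \<Rightarrow> ('f, 'r, 'a) fm set" where
  "tp M x A a = {\<phi> \<in> Lfm M x A. sat M a \<phi>}"

text \<open>\<open>S\<^sub>x(A)\<close>: complete types over \<open>A\<close>. Consistency with the elementary diagram of \<open>A\<close> in \<open>M\<close>
  is finite satisfiability in \<open>M\<close>.\<close>

definition ctypes :: "('f, 'r, 'a) struct \<Rightarrow> nat set \<Rightarrow> 'a set \<Rightarrow> ('f, 'r, 'a) fm set set" where
  "ctypes M x A = {p. p \<subseteq> Lfm M x A \<and>
     (\<forall>\<Phi>. finite \<Phi> \<and> \<Phi> \<subseteq> p \<longrightarrow> (\<exists>a\<in>tuples M x. \<forall>\<phi>\<in>\<Phi>. sat M a \<phi>)) \<and>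
     (\<forall>\<phi>\<in>Lfm M x A. \<phi> \<in> p \<or> Neg \<phi> \<in> p)}"

definition small :: "'k rel \<Rightarrow> 'a set \<Rightarrow> bool" where
  "small \<kappa> A \<longleftrightarrow> |A| <o \<kappa>"

definition saturated :: "'k rel \<Rightarrow> ('f, 'r, 'a) struct \<Rightarrow> bool" where
  "saturated \<kappa> M \<longleftrightarrow> (\<forall>A x. A \<subseteq> univ M \<and> small \<kappa> A \<and> finite x \<longrightarrow>
     (\<forall>p\<in>ctypes M x A. \<exists>a\<in>tuples M x. tp M x A a = p))"

definition automorphism :: "('f, 'r, 'a) struct \<Rightarrow> ('a \<Rightarrow> 'a) \<Rightarrow> bool" where
  "automorphism M \<sigma> \<longleftrightarrow> bij_betw \<sigma> (univ M) (univ M) \<and>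
     (\<forall>f as. fun_ar M f = Some (length as) \<and> set as \<subseteq> univ M \<longrightarrow>
        \<sigma> (fun_int M f as) = fun_int M f (map \<sigma> as)) \<and>
     (\<forall>r as. rel_ar M r = Some (length as) \<and> set as \<subseteq> univ M \<longrightarrow>
        rel_int M r as = rel_int M r (map \<sigma> as))"

definition strongly_homogeneous :: "'k rel \<Rightarrow> ('f, 'r, 'a) struct \<Rightarrow> bool" where
  "strongly_homogeneous \<kappa> M \<longleftrightarrow> (\<forall>A g. A \<subseteq> univ M \<and> small \<kappa> A \<and> g \<in> A \<rightarrow> univ M \<and>
     (\<forall>\<phi>\<in>Lfm M UNIV {}. \<forall>v\<in>UNIV \<rightarrow> A. sat M v \<phi> = sat M (g \<circ> v) \<phi>) \<longrightarrow>
     (\<exists>\<sigma>. automorphism M \<sigma> \<and> (\<forall>a\<in>A. \<sigma> a = g a)))"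

text \<open>\<open>\<kappa>\<close> is an uncountable cardinal larger than the language, and small means of cardinality
  less than \<open>\<kappa>\<close>.\<close>

definition monster_model ::
  "'k rel \<Rightarrow> ('f, 'r, 'a) fm set \<Rightarrow> ('f, 'r, 'a) struct \<Rightarrow> bool" where
  "monster_model \<kappa> T M \<longleftrightarrow> is_structure M \<and>
     T \<subseteq> Lfm M {} {} \<and> (\<forall>\<phi>\<in>T. \<forall>v\<in>UNIV \<rightarrow> univ M. sat M v \<phi>) \<and>
     Card_order \<kappa> \<and> natLeq <o \<kappa> \<and> small \<kappa> (dom (fun_ar M)) \<and> small \<kappa> (dom (rel_ar M)) \<and>
     saturated \<kappa> M \<and> strongly_homogeneous \<kappa> M"

definition small_model :: "'k rel \<Rightarrow> ('f, 'r, 'a) struct \<Rightarrow> 'a set \<Rightarrow> bool" where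
  "small_model \<kappa> U N \<longleftrightarrow> small \<kappa> N \<and> elem_sub (U\<lparr>univ := N\<rparr>) U"

text \<open>A larger monster model is an elementary extension in which the universe of \<open>U\<close> is small.\<close>

definition larger_monster ::
  "'l rel \<Rightarrow> ('f, 'r, 'a) fm set \<Rightarrow> ('f, 'r, 'a) struct \<Rightarrow> ('f, 'r, 'a) struct \<Rightarrow> bool" where
  "larger_monster \<kappa>' T U U' \<longleftrightarrow> monster_model \<kappa>' T U' \<and> elem_sub U U' \<and> small \<kappa>' (univ U)"

section \<open>Keisler measures\<close>

text \<open>The elements of the Boolean algebra are formulas up to equivalence in \<open>U\<close>. As functions on
  formulas, measures are made extensional so that they are determined by their values on
  \<open>Lfm U x A\<close>.\<close>

definition keisler ::
  "('f, 'r, 'a) struct \<Rightarrow> nat set \<Rightarrow> 'a set \<Rightarrow> (('f, 'r, 'a) fm \<Rightarrow> real) set" where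
  "keisler U x A = {\<mu> \<in> extensional (Lfm U x A).
     (\<forall>\<phi>\<in>Lfm U x A. 0 \<le> \<mu> \<phi>) \<and>
     (\<forall>\<phi>\<in>Lfm U x A. \<forall>\<psi>\<in>Lfm U x A. defset U x \<phi> = defset U x \<psi> \<longrightarrow> \<mu> \<phi> = \<mu> \<psi>) \<and>
     (\<forall>\<phi>\<in>Lfm U x A. defset U x \<phi> = tuples U x \<longrightarrow> \<mu> \<phi> = 1) \<and>
     (\<forall>\<phi>\<in>Lfm U x A. \<forall>\<psi>\<in>Lfm U x A. defset U x \<phi> \<inter> defset U x \<psi> = {} \<longrightarrow>
        \<mu> (Disj \<phi> \<psi>) = \<mu> \<phi> + \<mu> \<psi>)}"

definition restr :: "('f, 'r, 'a) struct \<Rightarrow> nat set \<Rightarrow> (('f, 'r, 'a) fm \<Rightarrow> real) \<Rightarrow> 'a set \<Rightarrow>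
    ('f, 'r, 'a) fm \<Rightarrow> real" where
  "restr U x \<mu> A = restrict \<mu> (Lfm U x A)"

definition dirac ::
  "('f, 'r, 'a) struct \<Rightarrow> nat set \<Rightarrow> ('f, 'r, 'a) fm set \<Rightarrow> ('f, 'r, 'a) fm \<Rightarrow> real" where
  "dirac U x p = (\<lambda>\<phi>\<in>Lfm U x (univ U). if \<phi> \<in> p then 1 else 0)"

definition supp :: "('f, 'r, 'a) struct \<Rightarrow> nat set \<Rightarrow> 'a set \<Rightarrow> (('f, 'r, 'a) fm \<Rightarrow> real) \<Rightarrow>
    ('f, 'r, 'a) fm set set" where
  "supp U x A \<mu> = {p \<in> ctypes U x A. \<forall>\<phi>\<in>p. \<mu> \<phi> > 0}"

definition clopen :: "('f, 'r, 'a) struct \<Rightarrow> nat set \<Rightarrow> 'a set \<Rightarrow> ('f, 'r, 'a) fm \<Rightarrow>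
    ('f, 'r, 'a) fm set set" where
  "clopen U x A \<phi> = {p \<in> ctypes U x A. \<phi> \<in> p}"

definition type_space ::
  "('f, 'r, 'a) struct \<Rightarrow> nat set \<Rightarrow> 'a set \<Rightarrow> ('f, 'r, 'a) fm set topology" where
  "type_space U x A = topology_generated_by (clopen U x A ` Lfm U x A)"

definition borel_algebra :: "'t topology \<Rightarrow> 't measure" where
  "borel_algebra X = sigma (topspace X) {V. openin X V}"

definition regular_borel_prob :: "'t topology \<Rightarrow> 't measure \<Rightarrow> bool" where
  "regular_borel_prob X m \<longleftrightarrow> prob_space m \<and> sets m = sets (borel_algebra X) \<and>
     (\<forall>B\<in>sets m.
        emeasure m B = (INF V\<in>{V. openin X V \<and> B \<subseteq> V}. emeasure m V) \<and>
        emeasure m B = (SUP K\<in>{K. compactin X K \<and> K \<subseteq> B}. emeasure m K))"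

text \<open>The regular Borel probability measure on \<open>S\<^sub>x(A)\<close> identified with \<open>\<mu>\<close>, a Keisler measure
  over \<open>A\<close>.\<close>

definition borel_measure_of :: "('f, 'r, 'a) struct \<Rightarrow> nat set \<Rightarrow> 'a set \<Rightarrow>
    (('f, 'r, 'a) fm \<Rightarrow> real) \<Rightarrow> ('f, 'r, 'a) fm set measure" where
  "borel_measure_of U x A \<mu> = (THE m. regular_borel_prob (type_space U x A) m \<and>
     (\<forall>\<phi>\<in>Lfm U x A. measure m (clopen U x A \<phi>) = \<mu> \<phi>))"

section \<open>Invariance and Borel definability\<close>

definition invariant_over :: "('f, 'r, 'a) struct \<Rightarrow> nat set \<Rightarrow> 'a set \<Rightarrow>
    (('f, 'r, 'a) fm \<Rightarrow> real) \<Rightarrow> bool" where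
  "invariant_over U x M \<mu> \<longleftrightarrow> (\<forall>z. finite z \<and> x \<inter> z = {} \<longrightarrow>
     (\<forall>\<phi>\<in>Lfm U (x \<union> z) M. \<forall>b\<in>tuples U z. \<forall>b'\<in>tuples U z.
        tp U z M b = tp U z M b' \<longrightarrow> \<mu> (inst z b \<phi>) = \<mu> (inst z b' \<phi>)))"

definition invariant :: "'k rel \<Rightarrow> ('f, 'r, 'a) struct \<Rightarrow> nat set \<Rightarrow>
    (('f, 'r, 'a) fm \<Rightarrow> real) \<Rightarrow> bool" where
  "invariant \<kappa> U x \<mu> \<longleftrightarrow> (\<exists>M. small_model \<kappa> U M \<and> invariant_over U x M \<mu>)"

definition invariant_type_over :: "('f, 'r, 'a) struct \<Rightarrow> nat set \<Rightarrow> 'a set \<Rightarrow>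
    ('f, 'r, 'a) fm set \<Rightarrow> bool" where
  "invariant_type_over U x M p \<longleftrightarrow> (\<forall>z. finite z \<and> x \<inter> z = {} \<longrightarrow>
     (\<forall>\<phi>\<in>Lfm U (x \<union> z) M. \<forall>b\<in>tuples U z. \<forall>b'\<in>tuples U z.
        tp U z M b = tp U z M b' \<longrightarrow> (inst z b \<phi> \<in> p \<longleftrightarrow> inst z b' \<phi> \<in> p)))"

definition invariant_type :: "'k rel \<Rightarrow> ('f, 'r, 'a) struct \<Rightarrow> nat set \<Rightarrow>
    ('f, 'r, 'a) fm set \<Rightarrow> bool" where
  "invariant_type \<kappa> U x p \<longleftrightarrow> (\<exists>M. small_model \<kappa> U M \<and> invariant_type_over U x M p)"

text \<open>\<open>F\<^sup>\<phi>\<close> at a type \<open>q\<close> over \<open>N\<close> in the variables \<open>z\<close>: the choice of the realization of \<open>q\<close>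
  is immaterial wherever this is used.\<close>

definition Fmap :: "('f, 'r, 'a) struct \<Rightarrow> nat set \<Rightarrow> 'a set \<Rightarrow> (('f, 'r, 'a) fm \<Rightarrow> real) \<Rightarrow>
    ('f, 'r, 'a) fm \<Rightarrow> ('f, 'r, 'a) fm set \<Rightarrow> real" where
  "Fmap U z N \<mu> \<phi> q = \<mu> (inst z (SOME b. b \<in> tuples U z \<and> tp U z N b = q) \<phi>)"

definition borel_definable_over :: "'k rel \<Rightarrow> ('f, 'r, 'a) struct \<Rightarrow> nat set \<Rightarrow> 'a set \<Rightarrow>
    (('f, 'r, 'a) fm \<Rightarrow> real) \<Rightarrow> bool" where
  "borel_definable_over \<kappa> U x M \<mu> \<longleftrightarrow> small_model \<kappa> U M \<and> invariant_over U x M \<mu> \<and>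
     (\<forall>z. finite z \<and> x \<inter> z = {} \<longrightarrow> (\<forall>\<phi>\<in>Lfm U (x \<union> z) M.
        Fmap U z M \<mu> \<phi> \<in> borel_measurable (borel_algebra (type_space U z M))))"

definition borel_definable :: "'k rel \<Rightarrow> ('f, 'r, 'a) struct \<Rightarrow> nat set \<Rightarrow>
    (('f, 'r, 'a) fm \<Rightarrow> real) \<Rightarrow> bool" where
  "borel_definable \<kappa> U x \<mu> \<longleftrightarrow> (\<exists>M. borel_definable_over \<kappa> U x M \<mu>)"

section \<open>Products\<close>

definition std_product :: "'k rel \<Rightarrow> ('f, 'r, 'a) struct \<Rightarrow> nat set \<Rightarrow> nat set \<Rightarrow>
    (('f, 'r, 'a) fm \<Rightarrow> real) \<Rightarrow> (('f, 'r, 'a) fm \<Rightarrow> real) \<Rightarrow> ('f, 'r, 'a) fm \<Rightarrow> real" where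
  "std_product \<kappa> U x y \<mu> \<nu> = (\<lambda>\<phi>\<in>Lfm U (x \<union> y) (univ U).
     let N = (SOME N. borel_definable_over \<kappa> U x N \<mu> \<and> fm_pars \<phi> \<subseteq> N)
     in integral\<^sup>L (borel_measure_of U y N (restr U y \<nu> N)) (Fmap U y N \<mu> \<phi>))"

text \<open>\<open>borel_witness \<kappa> U x y \<mu> \<nu> \<phi> N\<close>: the model \<open>N\<close> witnesses that \<open>(\<mu>, \<nu>, \<phi>)\<close> is Borel.\<close>

definition borel_witness :: "'k rel \<Rightarrow> ('f, 'r, 'a) struct \<Rightarrow> nat set \<Rightarrow> nat set \<Rightarrow>
    (('f, 'r, 'a) fm \<Rightarrow> real) \<Rightarrow> (('f, 'r, 'a) fm \<Rightarrow> real) \<Rightarrow> ('f, 'r, 'a) fm \<Rightarrow> 'a set \<Rightarrow> bool" where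
  "borel_witness \<kappa> U x y \<mu> \<nu> \<phi> N \<longleftrightarrow> small_model \<kappa> U N \<and> fm_pars \<phi> \<subseteq> N \<and>
     (\<forall>q\<in>supp U y N (restr U y \<nu> N). \<forall>d\<in>tuples U y. \<forall>d'\<in>tuples U y.
        tp U y N d = q \<and> tp U y N d' = q \<longrightarrow> \<mu> (inst y d \<phi>) = \<mu> (inst y d' \<phi>)) \<and>
     Fmap U y N \<mu> \<phi> \<in> borel_measurable
       (borel_algebra (subtopology (type_space U y N) (supp U y N (restr U y \<nu> N))))"

definition borel_triple :: "'k rel \<Rightarrow> ('f, 'r, 'a) struct \<Rightarrow> nat set \<Rightarrow> nat set \<Rightarrow>
    (('f, 'r, 'a) fm \<Rightarrow> real) \<Rightarrow> (('f, 'r, 'a) fm \<Rightarrow> real) \<Rightarrow> ('f, 'r, 'a) fm \<Rightarrow> bool" where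
  "borel_triple \<kappa> U x y \<mu> \<nu> \<phi> \<longleftrightarrow> (\<exists>N. borel_witness \<kappa> U x y \<mu> \<nu> \<phi> N)"

definition borel_pair :: "'k rel \<Rightarrow> ('f, 'r, 'a) struct \<Rightarrow> nat set \<Rightarrow> nat set \<Rightarrow>
    (('f, 'r, 'a) fm \<Rightarrow> real) \<Rightarrow> (('f, 'r, 'a) fm \<Rightarrow> real) \<Rightarrow> bool" where
  "borel_pair \<kappa> U x y \<mu> \<nu> \<longleftrightarrow> (\<forall>\<phi>\<in>Lfm U (x \<union> y) (univ U). borel_triple \<kappa> U x y \<mu> \<nu> \<phi>)"

definition ext_integral :: "('f, 'r, 'a) struct \<Rightarrow> nat set \<Rightarrow>
    (('f, 'r, 'a) fm \<Rightarrow> real) \<Rightarrow> (('f, 'r, 'a) fm \<Rightarrow> real) \<Rightarrow> ('f, 'r, 'a) fm \<Rightarrow> 'a set \<Rightarrow> real" where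
  "ext_integral U y \<mu> \<nu> \<phi> N = integral\<^sup>L
     (restrict_space (borel_measure_of U y N (restr U y \<nu> N)) (supp U y N (restr U y \<nu> N)))
     (Fmap U y N \<mu> \<phi>)"

definition ext_product :: "'k rel \<Rightarrow> ('f, 'r, 'a) struct \<Rightarrow> nat set \<Rightarrow> nat set \<Rightarrow>
    (('f, 'r, 'a) fm \<Rightarrow> real) \<Rightarrow> (('f, 'r, 'a) fm \<Rightarrow> real) \<Rightarrow> ('f, 'r, 'a) fm \<Rightarrow> real" where
  "ext_product \<kappa> U x y \<mu> \<nu> = (\<lambda>\<phi>\<in>Lfm U (x \<union> y) (univ U).
     ext_integral U y \<mu> \<nu> \<phi> (SOME N. borel_witness \<kappa> U x y \<mu> \<nu> \<phi> N))"

text \<open>\<open>p \<otimes> q\<close>, computed in a larger monster model \<open>U'\<close>: here \<open>p'\<close> is the \<open>M\<close>-invariant extension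
  of \<open>p\<close> to \<open>U'\<close>, and the concatenation of \<open>a\<close> and \<open>b\<close> is their union as functions.\<close>

definition join :: "nat set \<Rightarrow> nat set \<Rightarrow> (nat \<Rightarrow> 'a) \<Rightarrow> (nat \<Rightarrow> 'a) \<Rightarrow> nat \<Rightarrow> 'a" where
  "join x y a b = (\<lambda>n\<in>x \<union> y. if n \<in> x then a n else b n)"

definition type_product :: "'k rel \<Rightarrow> ('f, 'r, 'a) struct \<Rightarrow> ('f, 'r, 'a) struct \<Rightarrow>
    nat set \<Rightarrow> nat set \<Rightarrow> ('f, 'r, 'a) fm set \<Rightarrow> ('f, 'r, 'a) fm set \<Rightarrow> ('f, 'r, 'a) fm set" where
  "type_product \<kappa> U U' x y p q = (THE r. \<exists>M p' a b.
     small_model \<kappa> U M \<and> invariant_type_over U x M p \<and>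
     p' \<in> ctypes U' x (univ U') \<and> p \<subseteq> p' \<and> invariant_type_over U' x M p' \<and>
     b \<in> tuples U' y \<and> tp U' y (univ U) b = q \<and>
     a \<in> tuples U' x \<and> tp U' x (univ U \<union> b ` y) a = p' \<inter> Lfm U' x (univ U \<union> b ` y) \<and>
     r = tp U' (x \<union> y) (univ U) (join x y a b))"

end

theory Submission
  imports Defs
begin

text \<open>All three parts compare integrals of the fibre function \<open>q \<mapsto> \<mu>(\<phi>(x, d))\<close>, \<open>d\<close> a
  realization of \<open>q\<close>, over spaces of types \<open>S\<^sub>y(N)\<close> with \<open>N\<close> small. The support of \<open>\<nu>|\<^sub>N\<close> has
  full measure: its complement is a union of null clopen sets, each compact subset of it is
  covered by finitely many of these, and the measure is inner regular (\<open>AE_supp\<close>). So for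
  Borel-definable \<open>\<mu>\<close> and a common model \<open>N\<close> the two integrals agree. The two products may pick
  different models, however, and the point is that the extended integral does not see the choice
  (\<open>ext_integral_unique\<close>): for \<open>N \<subseteq> A\<close> the restriction of types \<open>S\<^sub>y(A) \<rightarrow> S\<^sub>y(N)\<close> pushes the
  measure of \<open>\<nu>|\<^sub>A\<close> to that of \<open>\<nu>|\<^sub>N\<close>, maps support into support and is compatible with the
  fibre functions, so both models can be compared with their union, a small set, over which all
  types are realized by saturation.

  The identification of a Keisler measure with a regular Borel measure has to be constructed.
  The space of types is in general not second countable, so Caratheodory's theorem, applied to
  the algebra of clopen sets, does not reach all Borel sets. The outer measure is built from the
  open sets instead, and compactness makes it countably subadditive and every open set
  measurable (\<open>regular_extension\<close>).

  If \<open>\<nu> = \<delta>\<^sub>q\<close>, the support is one point, any function on it is Borel, and the integral is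
  \<open>\<mu>(\<phi>(x, d))\<close> for a realization \<open>d\<close> of \<open>q\<close> over any set that contains the parameters of \<open>\<phi>\<close> and
  a model over which \<open>\<mu>\<close> is invariant (\<open>ext_product_dirac\<close>). One \<open>d\<close> serves finitely many
  formulas at once, so the product inherits the axioms of a Keisler measure from \<open>\<mu>\<close>.

  For types, \<open>\<phi>(x, y) \<in> p \<otimes> q\<close> means \<open>\<phi>(x, b) \<in> p'\<close>, where \<open>b\<close> realizes \<open>q\<close> in \<open>U'\<close> and \<open>p'\<close> is
  an invariant extension of \<open>p\<close>. As \<open>b\<close> and \<open>d\<close> have the same type over a set over which \<open>p'\<close> is
  invariant, this amounts to \<open>\<phi>(x, d) \<in> p\<close> (\<open>realizes_product_iff\<close>), which is the value found
  for \<open>\<delta>\<^sub>p\<close> and \<open>\<delta>\<^sub>q\<close>. The criterion involves only \<open>p\<close> and \<open>d\<close>, and one \<open>d\<close> over a set that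
  contains two models serves both, so it also shows that \<open>p \<otimes> q\<close> is unique. Existence needs
  \<open>p'\<close>: by saturation of \<open>U\<close>, finitely many parameters from \<open>U'\<close> can be moved into \<open>U\<close> by a map
  that is elementary over the model, and \<open>p\<close> decides the image of the formula
  (\<open>invariant_extension\<close>).

  Syntactically, everything rests on the fact that a formula with parameters is an instance of
  a formula without parameters in additional variables (\<open>obtain_instance\<close>). It lets invariance
  pass to larger sets of parameters and Borel-definability to larger models.\<close>

section \<open>Regular Borel probability measures on compact spaces\<close>

lemma space_borel_algebra [simp]: "space (borel_algebra X) = topspace X"
  unfolding borel_algebra_def by (rule space_measure_of) (auto dest: openin_subset)

lemma sets_borel_algebra: "sets (borel_algebra X) = sigma_sets (topspace X) {V. openin X V}"
  unfolding borel_algebra_def by (rule sets_measure_of) (auto dest: openin_subset)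

lemma openin_borel_algebra: "openin X V \<Longrightarrow> V \<in> sets (borel_algebra X)"
  by (auto simp: sets_borel_algebra)

lemma closedin_borel_algebra: "closedin X K \<Longrightarrow> K \<in> sets (borel_algebra X)"
proof -
  assume K: "closedin X K"
  then have "topspace X - K \<in> sets (borel_algebra X)"
    by (intro openin_borel_algebra) (auto simp: closedin_def)
  then have "space (borel_algebra X) - (topspace X - K) \<in> sets (borel_algebra X)"
    by (rule sets.compl_sets)
  moreover have "space (borel_algebra X) - (topspace X - K) = K"
    using closedin_subset[OF K] by auto
  ultimately show ?thesis by simp
qed

lemma continuous_map_borel_measurable:
  assumes "continuous_map X Y g"
  shows "g \<in> measurable (borel_algebra X) (borel_algebra Y)"
proof (rule measurable_sigma_sets[OF sets_borel_algebra])
  show "{V. openin Y V} \<subseteq> Pow (topspace Y)" by (auto dest: openin_subset)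
  show "g \<in> space (borel_algebra X) \<rightarrow> topspace Y"
    using assms by (auto simp: continuous_map_def)
  fix V assume "V \<in> {V. openin Y V}"
  then have "openin X {x \<in> topspace X. g x \<in> V}"
    using assms by (auto simp: continuous_map_def)
  moreover have "{x \<in> topspace X. g x \<in> V} = g -` V \<inter> space (borel_algebra X)" by auto
  ultimately show "g -` V \<inter> space (borel_algebra X) \<in> sets (borel_algebra X)"
    by (metis openin_borel_algebra)
qed

lemma sets_borel_algebra_subtopology:
  assumes "S \<in> sets (borel_algebra X)"
  shows "sets (borel_algebra (subtopology X S)) = sets (restrict_space (borel_algebra X) S)"
proof -
  have S: "S \<subseteq> topspace X" using sets.sets_into_space[OF assms] by simp
  have "{V. openin (subtopology X S) V} = (\<inter>) S ` {V. openin X V}"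
    by (auto simp: openin_subtopology Int_commute)
  moreover have "topspace (subtopology X S) = S" using S by auto
  ultimately show ?thesis
    using sigma_sets_Int[OF assms[unfolded sets_borel_algebra] S]
    by (simp add: sets_borel_algebra sets_restrict_space)
qed

lemma space_eq_topspace: "sets m = sets (borel_algebra X) \<Longrightarrow> space m = topspace X"
  by (metis sets_eq_imp_space_eq space_borel_algebra)

lemma regular_borel_probD:
  assumes "regular_borel_prob X m"
  shows "prob_space m" "sets m = sets (borel_algebra X)" "space m = topspace X"
    and "B \<in> sets (borel_algebra X) \<Longrightarrow>
      emeasure m B = (INF V\<in>{V. openin X V \<and> B \<subseteq> V}. emeasure m V)"
    and "B \<in> sets (borel_algebra X) \<Longrightarrow>
      emeasure m B = (SUP K\<in>{K. compactin X K \<and> K \<subseteq> B}. emeasure m K)"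
  using assms space_eq_topspace unfolding regular_borel_prob_def by blast+

text \<open>Inner approximation by compact sets is enough: applied to the complement of a set, it
  gives outer approximation by open sets, because compact sets are closed and the measure is
  finite.\<close>

lemma regular_borel_probI:
  assumes X: "compact_space X" "Hausdorff_space X"
    and m: "prob_space m" "sets m = sets (borel_algebra X)"
    and inner: "\<And>B e. B \<in> sets m \<Longrightarrow> 0 < e \<Longrightarrow>
      \<exists>K. compactin X K \<and> K \<subseteq> B \<and> measure m B < measure m K + e"
  shows "regular_borel_prob X m"
proof -
  interpret prob_space m by fact
  have sp: "space m = topspace X" using m(2) by (rule space_eq_topspace)
  have Km: "K \<in> sets m" if "compactin X K" for K
    using that X m(2) by (simp add: closedin_borel_algebra compactin_imp_closedin)
  have "emeasure m B = (INF V\<in>{V. openin X V \<and> B \<subseteq> V}. emeasure m V)" if B: "B \<in> sets m" for B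
  proof (rule antisym)
    show "emeasure m B \<le> (INF V\<in>{V. openin X V \<and> B \<subseteq> V}. emeasure m V)"
      using m(2) by (intro INF_greatest emeasure_mono) (auto simp: openin_borel_algebra)
    show "(INF V\<in>{V. openin X V \<and> B \<subseteq> V}. emeasure m V) \<le> emeasure m B"
    proof (rule ennreal_le_epsilon)
      fix e :: real assume e: "0 < e"
      obtain K where K: "compactin X K" "K \<subseteq> space m - B" "measure m (space m - B) < measure m K + e"
        using inner[of "space m - B" e] B e by auto
      have cl: "closedin X K" using K X by (simp add: compactin_imp_closedin)
      have op: "openin X (space m - K)" using cl by (simp add: sp closedin_def)
      have "measure m (space m - K) = 1 - measure m K" using prob_compl[OF Km[OF K(1)]] .
      also have "\<dots> \<le> measure m B + e" using K(3) prob_compl[OF B] by linarith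
      finally have "emeasure m (space m - K) \<le> emeasure m B + ennreal e"
        using e by (simp add: emeasure_eq_measure flip: ennreal_plus)
      moreover have "B \<subseteq> space m - K" using K(2) sets.sets_into_space[OF B] by auto
      ultimately show "(INF V\<in>{V. openin X V \<and> B \<subseteq> V}. emeasure m V) \<le> emeasure m B + ennreal e"
        using op by (intro INF_lower2[of "space m - K"]) auto
    qed
  qed
  moreover have "emeasure m B = (SUP K\<in>{K. compactin X K \<and> K \<subseteq> B}. emeasure m K)"
    if B: "B \<in> sets m" for B
  proof (rule antisym)
    show "(SUP K\<in>{K. compactin X K \<and> K \<subseteq> B}. emeasure m K) \<le> emeasure m B"
      using B by (intro SUP_least emeasure_mono) auto
    show "emeasure m B \<le> (SUP K\<in>{K. compactin X K \<and> K \<subseteq> B}. emeasure m K)"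
    proof (rule ennreal_le_epsilon)
      fix e :: real assume e: "0 < e"
      obtain K where K: "compactin X K" "K \<subseteq> B" "measure m B < measure m K + e"
        using inner[OF B e] by auto
      have "emeasure m B \<le> emeasure m K + ennreal e"
        using K(3) e by (simp add: emeasure_eq_measure flip: ennreal_plus)
      also have "\<dots> \<le> (SUP K\<in>{K. compactin X K \<and> K \<subseteq> B}. emeasure m K) + ennreal e"
        using K by (intro add_right_mono SUP_upper) auto
      finally show "emeasure m B \<le> (SUP K\<in>{K. compactin X K \<and> K \<subseteq> B}. emeasure m K) + ennreal e" .
    qed
  qed
  ultimately show ?thesis using m by (simp add: regular_borel_prob_def)
qed

lemma regular_borel_prob_inner:
  assumes "regular_borel_prob X m" "B \<in> sets m" "0 < e"
  shows "\<exists>K. compactin X K \<and> K \<subseteq> B \<and> measure m B < measure m K + e"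
proof -
  interpret prob_space m using assms by (simp add: regular_borel_prob_def)
  have eq: "emeasure m B = (SUP K\<in>{K. compactin X K \<and> K \<subseteq> B}. emeasure m K)"
    using assms(2) regular_borel_probD(2,5)[OF assms(1)] by simp
  show ?thesis
  proof (cases "measure m B < e")
    case True
    then show ?thesis by (intro exI[of _ "{}"]) auto
  next
    case False
    then have "ennreal (measure m B - e) < emeasure m B"
      using assms(3) by (simp add: emeasure_eq_measure ennreal_lessI)
    then obtain K where "compactin X K" "K \<subseteq> B" "ennreal (measure m B - e) < emeasure m K"
      unfolding eq by (auto simp: less_SUP_iff)
    then have "measure m B < measure m K + e"
      using False by (simp add: emeasure_eq_measure ennreal_less_iff)
    with \<open>compactin X K\<close> \<open>K \<subseteq> B\<close> show ?thesis by auto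
  qed
qed

text \<open>The image of a compact set is compact, so inner regularity is inherited by image measures;
  outer regularity follows by \<open>regular_borel_probI\<close>.\<close>

lemma regular_borel_prob_distr:
  assumes X: "compact_space X" and Y: "compact_space Y" "Hausdorff_space Y"
    and g: "continuous_map X Y g" and m: "regular_borel_prob X m"
  shows "regular_borel_prob Y (distr m (borel_algebra Y) g)"
proof -
  have sm: "sets m = sets (borel_algebra X)" using m by (simp add: regular_borel_prob_def)
  have sp: "space m = topspace X" using sm by (rule space_eq_topspace)
  interpret prob_space m using m by (simp add: regular_borel_prob_def)
  have gm: "g \<in> measurable m (borel_algebra Y)"
    using continuous_map_borel_measurable[OF g] sm measurable_cong_sets by blast
  show ?thesis
  proof (rule regular_borel_probI[OF Y])
    show "prob_space (distr m (borel_algebra Y) g)" by (rule prob_space_distr[OF gm])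
    show "sets (distr m (borel_algebra Y) g) = sets (borel_algebra Y)" by simp
    fix B and e :: real
    assume B: "B \<in> sets (distr m (borel_algebra Y) g)" and e: "0 < e"
    then have B': "B \<in> sets (borel_algebra Y)" by simp
    have "g -` B \<inter> space m \<in> sets m" using gm B' by (rule measurable_sets)
    then obtain K where K: "compactin X K" "K \<subseteq> g -` B \<inter> space m"
      "measure m (g -` B \<inter> space m) < measure m K + e"
      using regular_borel_prob_inner[OF m _ e] by blast
    have cK: "compactin Y (g ` K)" using K(1) g by (rule image_compactin)
    then have gK: "g ` K \<in> sets (borel_algebra Y)"
      using Y by (simp add: closedin_borel_algebra compactin_imp_closedin)
    have "measure m K \<le> measure m (g -` (g ` K) \<inter> space m)"
      using K(2) gm gK by (intro finite_measure_mono measurable_sets) auto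
    then have "measure (distr m (borel_algebra Y) g) B
        < measure (distr m (borel_algebra Y) g) (g ` K) + e"
      using K(3) by (simp add: measure_distr[OF gm B'] measure_distr[OF gm gK])
    then show "\<exists>K. compactin Y K \<and> K \<subseteq> B \<and> measure (distr m (borel_algebra Y) g) B
        < measure (distr m (borel_algebra Y) g) K + e"
      using cK K(2) by (intro exI[of _ "g ` K"]) auto
  qed
qed

section \<open>Extending a content from a base of clopen sets\<close>

text \<open>Stone spaces, presented by an algebra of clopen sets that is a base. The algebra is kept
  abstract so that the clopen sets given by formulas can be used directly.\<close>

locale clopen_base =
  fixes X :: "'t topology" and \<C> :: "'t set set"
  assumes compact: "compact_space X" and Hausdorff: "Hausdorff_space X"
    and algebra: "algebra (topspace X) \<C>"
    and openin: "c \<in> \<C> \<Longrightarrow> openin X c"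
    and base: "openin X V \<Longrightarrow> t \<in> V \<Longrightarrow> \<exists>c\<in>\<C>. t \<in> c \<and> c \<subseteq> V"
begin

sublocale algebra "topspace X" \<C> by (rule algebra)

lemma closedin: "c \<in> \<C> \<Longrightarrow> closedin X c"
  using openin[of "topspace X - c"] compl_sets sets_into_space by (auto simp: closedin_def)

text \<open>This is what links compact and open sets to the algebra: both parts of the extension
  theorem, uniqueness and existence, go through it.\<close>

lemma separation:
  assumes K: "compactin X K" "K \<subseteq> V" and V: "openin X V"
  shows "\<exists>c\<in>\<C>. K \<subseteq> c \<and> c \<subseteq> V"
proof -
  have "\<exists>F. finite F \<and> F \<subseteq> {c \<in> \<C>. c \<subseteq> V} \<and> K \<subseteq> \<Union>F"
    using K(2) base[OF V] openin by (intro compactinD[OF K(1)]) fastforce+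
  then obtain F where F: "finite F" "F \<subseteq> {c \<in> \<C>. c \<subseteq> V}" "K \<subseteq> \<Union>F" by auto
  moreover have "\<Union>F \<in> \<C>" using F by (intro finite_Union) auto
  ultimately show ?thesis by (intro bexI[of _ "\<Union>F"]) auto
qed

text \<open>Inner regularity and \<open>separation\<close> express the measure of an open set by the measures of
  the clopen sets inside it; outer regularity then gives all Borel sets.\<close>

lemma regular_borel_prob_unique:
  assumes m: "regular_borel_prob X m" and n: "regular_borel_prob X n"
    and eq: "\<And>c. c \<in> \<C> \<Longrightarrow> emeasure m c = emeasure n c"
  shows "m = n"
proof -
  have le: "emeasure m V \<le> emeasure n V"
    if m: "regular_borel_prob X m" and n: "regular_borel_prob X n"
      and eq: "\<And>c. c \<in> \<C> \<Longrightarrow> emeasure m c = emeasure n c" and V: "openin X V" for m n V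
  proof -
    have s: "sets m = sets (borel_algebra X)" "sets n = sets (borel_algebra X)"
      using m n by (auto simp: regular_borel_prob_def)
    have "emeasure m V = (SUP K\<in>{K. compactin X K \<and> K \<subseteq> V}. emeasure m K)"
      using V by (intro regular_borel_probD(5)[OF m] openin_borel_algebra)
    also have "\<dots> \<le> emeasure n V"
    proof (rule SUP_least)
      fix K assume "K \<in> {K. compactin X K \<and> K \<subseteq> V}"
      then obtain c where c: "c \<in> \<C>" "K \<subseteq> c" "c \<subseteq> V" by (metis (mono_tags, lifting) V mem_Collect_eq separation)
      have "emeasure m K \<le> emeasure m c"
        using c openin by (intro emeasure_mono) (auto simp: s openin_borel_algebra)
      also have "\<dots> = emeasure n c" by (rule eq[OF c(1)])
      also have "\<dots> \<le> emeasure n V"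
        using c V by (intro emeasure_mono) (auto simp: s openin_borel_algebra)
      finally show "emeasure m K \<le> emeasure n V" .
    qed
    finally show ?thesis .
  qed
  have op: "emeasure m V = emeasure n V" if "openin X V" for V
    using le[OF m n eq that] le[OF n m eq[symmetric] that] by simp
  show ?thesis
  proof (rule measure_eqI)
    show "sets m = sets n" using m n by (simp add: regular_borel_probD)
    fix B assume "B \<in> sets m"
    then have "B \<in> sets (borel_algebra X)" using m by (simp add: regular_borel_probD)
    moreover have "(INF V\<in>{V. openin X V \<and> B \<subseteq> V}. emeasure m V)
        = (INF V\<in>{V. openin X V \<and> B \<subseteq> V}. emeasure n V)"
      by (intro INF_cong) (auto simp: op)
    ultimately show "emeasure m B = emeasure n B"
      using regular_borel_probD(4)[OF m] regular_borel_probD(4)[OF n] by presburger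
  qed
qed

end

locale clopen_content = clopen_base X \<C>
  for X :: "'t topology" and \<C> :: "'t set set" +
  fixes m0 :: "'t set \<Rightarrow> ennreal"
  assumes positive: "positive \<C> m0" and additive: "additive \<C> m0"
    and top: "m0 (topspace X) = 1"
begin

lemma m0_mono: "c \<in> \<C> \<Longrightarrow> d \<in> \<C> \<Longrightarrow> c \<subseteq> d \<Longrightarrow> m0 c \<le> m0 d"
  using additive_increasing[OF positive additive] by (auto simp: increasing_def)

text \<open>The value that inner regularity forces on an open set, and the value that outer regularity
  then forces on an arbitrary set. The algebra of clopen sets generates only the Baire sets,
  which is why the outer measure is defined through open sets and not through countable covers
  by clopen sets.\<close>

definition content :: "'t set \<Rightarrow> ennreal" where "content V = (SUP c\<in>{c\<in>\<C>. c \<subseteq> V}. m0 c)"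

definition outer :: "'t set \<Rightarrow> ennreal" where "outer E = (INF V\<in>{V. openin X V \<and> E \<subseteq> V}. content V)"

lemma m0_le_content: "c \<in> \<C> \<Longrightarrow> c \<subseteq> V \<Longrightarrow> m0 c \<le> content V"
  unfolding content_def by (intro SUP_upper) auto

lemma content_mono: "V \<subseteq> W \<Longrightarrow> content V \<le> content W"
  unfolding content_def by (intro SUP_subset_mono) auto

lemma outer_le: "openin X V \<Longrightarrow> E \<subseteq> V \<Longrightarrow> outer E \<le> content V"
  unfolding outer_def by (intro INF_lower) auto

lemma outer_mono: "E \<subseteq> F \<Longrightarrow> outer E \<le> outer F"
  unfolding outer_def by (intro INF_superset_mono) auto

lemma outer_open: "openin X V \<Longrightarrow> outer V = content V"
  by (intro antisym outer_le) (auto simp: outer_def intro!: INF_greatest content_mono)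

lemma content_clopen: "c \<in> \<C> \<Longrightarrow> content c = m0 c"
  by (intro antisym m0_le_content) (auto simp: content_def intro!: SUP_least m0_mono)

text \<open>The part of \<open>c\<close> outside the last open set is compact and lies in the union of the others,
  so a clopen set splits \<open>c\<close> into a piece for the last set and a piece for the induction
  hypothesis.\<close>

lemma content_finite_cover:
  fixes V :: "nat \<Rightarrow> 't set"
  assumes V: "\<And>i. openin X (V i)"
  shows "c \<in> \<C> \<Longrightarrow> c \<subseteq> (\<Union>i<n. V i) \<Longrightarrow> m0 c \<le> (\<Sum>i<n. content (V i))"
proof (induction n arbitrary: c)
  case 0
  then show ?case using positive by (simp add: positive_def)
next
  case (Suc n)
  have cl: "closedin X (c - V n)" using Suc.prems closedin V by (intro closedin_diff) auto
  have "compactin X (c - V n)" using compact cl by (rule closedin_compact_space)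
  moreover have "c - V n \<subseteq> (\<Union>i<n. V i)" using Suc.prems by (auto simp: lessThan_Suc)
  moreover have "openin X (\<Union>i<n. V i)" using V by auto
  ultimately obtain d where d: "d \<in> \<C>" "c - V n \<subseteq> d" "d \<subseteq> (\<Union>i<n. V i)"
    by (metis separation)
  have i: "c \<inter> d \<in> \<C>" "c - d \<in> \<C>" using Suc.prems d by auto
  have "m0 c = m0 ((c \<inter> d) \<union> (c - d))" by (simp add: Int_Diff_Un)
  also have "\<dots> = m0 (c \<inter> d) + m0 (c - d)" using i additive by (intro additiveD) auto
  also have "\<dots> \<le> (\<Sum>i<n. content (V i)) + content (V n)"
    using d i by (intro add_mono Suc.IH m0_le_content) auto
  finally show ?case by simp
qed

lemma content_countable_cover:
  fixes V :: "nat \<Rightarrow> 't set"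
  assumes V: "\<And>i. openin X (V i)"
  shows "content (\<Union>i. V i) \<le> (\<Sum>i. content (V i))"
  unfolding content_def[of "\<Union>i. V i"]
proof (rule SUP_least)
  fix c assume "c \<in> {c \<in> \<C>. c \<subseteq> (\<Union>i. V i)}"
  then have c: "c \<in> \<C>" "c \<subseteq> (\<Union>i. V i)" by auto
  have comp: "compactin X c" using compact closedin[OF c(1)] by (rule closedin_compact_space)
  obtain F where F: "finite F" "F \<subseteq> range V" "c \<subseteq> \<Union>F"
    using compactinD[OF comp, of "range V"] V c by auto
  then obtain I where I: "finite I" "F = V ` I" by (metis finite_subset_image)
  obtain n where "I \<subseteq> {..<n}" using I(1) finite_nat_iff_bounded by auto
  then have "c \<subseteq> (\<Union>i<n. V i)" using F(3) I(2) by blast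
  then have "m0 c \<le> (\<Sum>i<n. content (V i))" by (intro content_finite_cover[OF V c(1)])
  also have "\<dots> \<le> (\<Sum>i. content (V i))" by (intro sum_le_suminf) auto
  finally show "m0 c \<le> (\<Sum>i. content (V i))" .
qed

lemma outer_empty: "outer {} = 0"
  using outer_open[of "{}"] content_clopen[OF empty_sets] positive by (simp add: positive_def)

lemma outer_countably_subadditive: "countably_subadditive (Pow (topspace X)) outer"
  unfolding countably_subadditive_def
proof (safe, rule ennreal_le_epsilon)
  fix A :: "nat \<Rightarrow> 't set" and e :: real
  assume A: "range A \<subseteq> Pow (topspace X)" and e: "0 < e"
    and fin: "(\<Sum>i. outer (A i)) < \<top>"
  \<comment> \<open>Finiteness makes room for the error terms \<open>e / 2 ^ Suc i\<close>, which sum to \<open>e\<close>.\<close>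
  have fini: "outer (A i) < \<top>" for i
    using A by (intro le_less_trans[OF outer_le[of "topspace X"]])
      (auto simp: content_clopen top)
  have "\<exists>V. openin X V \<and> A i \<subseteq> V \<and> content V \<le> outer (A i) + ennreal (e * (1/2)^Suc i)" for i
  proof -
    have "outer (A i) < outer (A i) + ennreal (e * (1/2)^Suc i)"
      using fini[of i] e by (simp add: ennreal_add_left_cancel_less ennreal_zero_less_mult_iff less_top)
    then show ?thesis by (subst (asm) (1) outer_def) (auto simp: INF_less_iff less_imp_le)
  qed
  then obtain V where V: "\<And>i. openin X (V i)" "\<And>i. A i \<subseteq> V i"
    "\<And>i. content (V i) \<le> outer (A i) + ennreal (e * (1/2)^Suc i)" by metis
  have "outer (\<Union>i. A i) \<le> content (\<Union>i. V i)" using V by (intro outer_le) blast+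
  also have "\<dots> \<le> (\<Sum>i. content (V i))" by (rule content_countable_cover[OF V(1)])
  also have "\<dots> \<le> (\<Sum>i. outer (A i) + ennreal (e * (1/2)^Suc i))"
    using V by (intro suminf_le) auto
  also have "\<dots> = (\<Sum>i. outer (A i)) + (\<Sum>i. ennreal (e * (1/2)^Suc i))"
    by (rule suminf_add[symmetric]) auto
  also have "(\<Sum>i. ennreal (e * (1/2)^Suc i)) = ennreal e"
  proof (rule suminf_ennreal_eq)
    show "0 \<le> e * (1/2)^Suc i" for i using e by simp
    show "(\<lambda>i. e * (1/2)^Suc i) sums e" using sums_mult[OF power_half_series, of e] by simp
  qed
  finally show "outer (\<Union>i. A i) \<le> (\<Sum>i. outer (A i)) + ennreal e" .
qed

lemma outer_measure_space_outer: "outer_measure_space (Pow (topspace X)) outer"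
  using outer_countably_subadditive
  by (auto simp: outer_measure_space_def positive_def increasing_def outer_empty outer_mono)

text \<open>A clopen \<open>c\<close> inside \<open>W \<inter> V\<close> is removed from \<open>W\<close>. What remains is open, covers \<open>W - V\<close>, and
  its content adds to that of \<open>c\<close>. Taking the supremum over \<open>c\<close> yields the inequality without an
  error term.\<close>

lemma outer_split_open:
  assumes V: "openin X V" and W: "openin X W"
  shows "outer (W \<inter> V) + outer (W - V) \<le> content W"
proof -
  have "outer (W \<inter> V) + outer (W - V) = (SUP c\<in>{c\<in>\<C>. c \<subseteq> W \<inter> V}. m0 c + outer (W - V))"
    unfolding outer_open[OF openin_Int[OF W V]] content_def
    by (rule ennreal_SUP_add_left[symmetric]) (use empty_sets in auto)
  also have "\<dots> \<le> content W"
  proof (rule SUP_least)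
    fix c assume "c \<in> {c\<in>\<C>. c \<subseteq> W \<inter> V}"
    then have c: "c \<in> \<C>" "c \<subseteq> W" "c \<subseteq> V" by auto
    have "outer (W - V) \<le> content (W - c)"
      using c W closedin by (intro outer_le openin_diff) auto
    then have "m0 c + outer (W - V) \<le> m0 c + content (W - c)" by (rule add_left_mono)
    also have "\<dots> = (SUP d\<in>{d\<in>\<C>. d \<subseteq> W - c}. m0 c + m0 d)"
      unfolding content_def by (rule ennreal_SUP_add_right) (use empty_sets in auto)
    also have "\<dots> \<le> content W"
    proof (rule SUP_least)
      fix d assume "d \<in> {d\<in>\<C>. d \<subseteq> W - c}"
      then have d: "d \<in> \<C>" "d \<subseteq> W" "c \<inter> d = {}" by auto
      have "m0 c + m0 d = m0 (c \<union> d)" using additiveD[OF additive d(3) c(1) d(1)] by simp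
      also have "\<dots> \<le> content W" using c d by (intro m0_le_content) auto
      finally show "m0 c + m0 d \<le> content W" .
    qed
    finally show "m0 c + outer (W - V) \<le> content W" .
  qed
  finally show ?thesis .
qed

text \<open>Measurability of an open set has to be tested on arbitrary sets, but the outer measure of
  a set is an infimum over open sets \<open>W\<close>, for which \<open>outer_split_open\<close> applies.\<close>

lemma open_lambda_system:
  assumes V: "openin X V"
  shows "V \<in> lambda_system (topspace X) (Pow (topspace X)) outer"
proof -
  interpret P: algebra "topspace X" "Pow (topspace X)" by (rule algebra_Pow)
  have sub: "subadditive (Pow (topspace X)) outer"
    using outer_countably_subadditive outer_empty
    by (intro P.countably_subadditive_subadditive) (auto simp: positive_def)
  have "outer (E \<inter> V) + outer (E - V) = outer E" if E: "E \<subseteq> topspace X" for E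
  proof (rule antisym)
    show "outer (E \<inter> V) + outer (E - V) \<le> outer E"
      unfolding outer_def[of E]
    proof (rule INF_greatest)
      fix W assume "W \<in> {W. openin X W \<and> E \<subseteq> W}"
      then have W: "openin X W" "E \<subseteq> W" by auto
      have "outer (E \<inter> V) + outer (E - V) \<le> outer (W \<inter> V) + outer (W - V)"
        using W by (intro add_mono outer_mono) auto
      also have "\<dots> \<le> content W" by (rule outer_split_open[OF V W(1)])
      finally show "outer (E \<inter> V) + outer (E - V) \<le> content W" .
    qed
    have "outer ((E \<inter> V) \<union> (E - V)) \<le> outer (E \<inter> V) + outer (E - V)"
      using E by (intro subadditiveD[OF sub]) auto
    then show "outer E \<le> outer (E \<inter> V) + outer (E - V)" by (simp add: Int_Diff_Un)
  qed
  then show ?thesis using openin_subset[OF V] by (auto simp: P.lambda_system_eq)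
qed

text \<open>Outer regularity holds by construction, and since closed sets are compact it yields inner
  regularity on complements.\<close>

theorem regular_extension:
  "\<exists>m. regular_borel_prob X m \<and> (\<forall>c\<in>\<C>. emeasure m c = m0 c)"
proof -
  let ?L = "lambda_system (topspace X) (Pow (topspace X)) outer"
  have ms: "measure_space (topspace X) ?L outer"
    using sigma_algebra.caratheodory_lemma[OF sigma_algebra_Pow outer_measure_space_outer] .
  then have sa: "sigma_algebra (topspace X) ?L" by (simp add: measure_space_def)
  have sub: "sets (borel_algebra X) \<subseteq> ?L"
    unfolding sets_borel_algebra using open_lambda_system
    by (intro sigma_algebra.sigma_sets_subset[OF sa]) auto
  define m where "m = measure_of (topspace X) (sets (borel_algebra X)) outer"
  have sets_m: "sets m = sets (borel_algebra X)"
    unfolding m_def using sets.space_closed[of "borel_algebra X"]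
    by (metis sets.sets_measure_of_eq space_borel_algebra)
  have em: "emeasure m B = outer B" if "B \<in> sets (borel_algebra X)" for B
  proof (rule emeasure_measure_of[OF m_def])
    show "sets (borel_algebra X) \<subseteq> Pow (topspace X)"
      using sets.space_closed[of "borel_algebra X"] by simp
    show "positive (sets m) outer" by (simp add: positive_def outer_empty)
    show "countably_additive (sets m) outer"
      using ms sub by (auto simp: measure_space_def countably_additive_def sets_m)
    show "B \<in> sets m" using that by (simp add: sets_m)
  qed
  have sp: "space m = topspace X" using sets_m by (rule space_eq_topspace)
  have emc: "emeasure m c = m0 c" if "c \<in> \<C>" for c
    using that openin em by (simp add: openin_borel_algebra outer_open content_clopen)
  have P: "prob_space m"
    by (rule prob_spaceI) (simp add: sp emc top)
  then interpret prob_space m .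
  have "regular_borel_prob X m"
  proof (rule regular_borel_probI[OF compact Hausdorff P sets_m])
    fix B and e :: real assume B: "B \<in> sets m" and e: "0 < e"
    have cB: "space m - B \<in> sets m" using B by auto
    have "outer (space m - B) = ennreal (measure m (space m - B))"
      using em[of "space m - B"] cB by (simp add: sets_m emeasure_eq_measure)
    then have "outer (space m - B) < outer (space m - B) + ennreal e"
      using e by (simp add: ennreal_less_iff flip: ennreal_plus)
    then obtain V where V: "openin X V" "space m - B \<subseteq> V" "content V < outer (space m - B) + ennreal e"
      by (subst (asm) (1) outer_def) (auto simp: INF_less_iff)
    have Vm: "V \<in> sets m" using V(1) by (simp add: sets_m openin_borel_algebra)
    have "emeasure m V < emeasure m (space m - B) + ennreal e"
      using V(3) em[of V] em[of "space m - B"] cB Vm V(1) by (simp add: sets_m outer_open)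
    then have lt: "measure m V < measure m (space m - B) + e"
      using e by (simp add: emeasure_eq_measure ennreal_less_iff flip: ennreal_plus)
    have "closedin X (topspace X - V)" using V(1) by auto
    then have "compactin X (topspace X - V)" by (rule closedin_compact_space[OF compact])
    moreover have "topspace X - V \<subseteq> B" using V(2) by (auto simp: sp)
    moreover have "measure m B < measure m (topspace X - V) + e"
      using lt prob_compl[OF B] prob_compl[OF Vm] by (simp add: sp)
    ultimately show "\<exists>K. compactin X K \<and> K \<subseteq> B \<and> measure m B < measure m K + e" by blast
  qed
  then show ?thesis using emc by blast
qed

end

section \<open>Substitution for variables and parameters\<close>

primrec translate_tm :: "(nat \<Rightarrow> nat) \<Rightarrow> ('a \<Rightarrow> ('f, 'a) tm) \<Rightarrow> ('f, 'a) tm \<Rightarrow> ('f, 'a) tm" where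
  "translate_tm \<pi> s (Var n) = Var (\<pi> n)"
| "translate_tm \<pi> s (Par a) = s a"
| "translate_tm \<pi> s (Fn f ts) = Fn f (map (translate_tm \<pi> s) ts)"

text \<open>Renames all variables, bound ones included, by \<open>\<pi>\<close> and replaces parameters by terms.
  Special cases are the abstraction of parameters into fresh variables and the action of a map
  on parameters.\<close>

primrec translate :: "(nat \<Rightarrow> nat) \<Rightarrow> ('a \<Rightarrow> ('f, 'a) tm) \<Rightarrow> ('f, 'r, 'a) fm \<Rightarrow> ('f, 'r, 'a) fm" where
  "translate \<pi> s (Eq t u) = Eq (translate_tm \<pi> s t) (translate_tm \<pi> s u)"
| "translate \<pi> s (Rel r ts) = Rel r (map (translate_tm \<pi> s) ts)"
| "translate \<pi> s (Neg \<phi>) = Neg (translate \<pi> s \<phi>)"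
| "translate \<pi> s (Conj \<phi> \<psi>) = Conj (translate \<pi> s \<phi>) (translate \<pi> s \<psi>)"
| "translate \<pi> s (Exi n \<phi>) = Exi (\<pi> n) (translate \<pi> s \<phi>)"

abbreviation map_par :: "('a \<Rightarrow> 'a) \<Rightarrow> ('f, 'r, 'a) fm \<Rightarrow> ('f, 'r, 'a) fm" where
  "map_par h \<equiv> translate (\<lambda>n. n) (\<lambda>a. Par (h a))"

primrec bound_vars :: "('f, 'r, 'a) fm \<Rightarrow> nat set" where
  "bound_vars (Eq s t) = {}"
| "bound_vars (Rel r ts) = {}"
| "bound_vars (Neg \<phi>) = bound_vars \<phi>"
| "bound_vars (Conj \<phi> \<psi>) = bound_vars \<phi> \<union> bound_vars \<psi>"
| "bound_vars (Exi n \<phi>) = insert n (bound_vars \<phi>)"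

lemma finite_bound_vars: "finite (bound_vars \<phi>)" by (induction \<phi>) auto

lemma finite_tm_fv: "finite (tm_fv t)" by (induction t) auto

lemma finite_fv: "finite (fv \<phi>)" by (induction \<phi>) (auto simp: finite_tm_fv)

lemma finite_tm_pars: "finite (tm_pars t)" by (induction t) auto

lemma finite_fm_pars: "finite (fm_pars \<phi>)" by (induction \<phi>) (auto simp: finite_tm_pars)

lemma tm_val_cong: "(\<And>n. n \<in> tm_fv t \<Longrightarrow> v n = w n) \<Longrightarrow> tm_val M v t = tm_val M w t"
proof (induction t)
  case (Fn f ts)
  then have "map (tm_val M v) ts = map (tm_val M w) ts" by auto
  then show ?case by (simp del: map_eq_conv)
qed auto

lemma sat_cong: "(\<And>n. n \<in> fv \<phi> \<Longrightarrow> v n = w n) \<Longrightarrow> sat M v \<phi> = sat M w \<phi>"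
proof (induction \<phi> arbitrary: v w)
  case (Eq s t) then show ?case using tm_val_cong[of s v w M] tm_val_cong[of t v w M] by auto
next
  case (Rel r ts)
  then have "map (tm_val M v) ts = map (tm_val M w) ts" by (auto intro!: tm_val_cong)
  then show ?case by (simp del: map_eq_conv)
next
  case (Neg \<phi>)
  have "sat M v \<phi> = sat M w \<phi>" by (rule Neg.IH) (use Neg.prems in auto)
  then show ?case by simp
next
  case (Conj \<phi> \<psi>)
  have "sat M v \<phi> = sat M w \<phi>" "sat M v \<psi> = sat M w \<psi>"
    using Conj.prems by (intro Conj.IH; auto)+
  then show ?case by simp
next
  case (Exi n \<phi>)
  have "sat M (v(n := a)) \<phi> = sat M (w(n := a)) \<phi>" for a by (rule Exi.IH) (use Exi.prems in auto)
  then show ?case by simp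
qed

lemma tm_val_struct_cong:
  assumes "fun_int N = fun_int M" shows "tm_val N v t = tm_val M v t"
  by (induction t) (auto simp: assms cong: map_cong)

lemma sat_Disj [simp]: "sat M v (Disj \<phi> \<psi>) \<longleftrightarrow> sat M v \<phi> \<or> sat M v \<psi>"
  by (simp add: Disj_def)

lemma tm_wf_translate: "tm_wf M t \<Longrightarrow> (\<And>a. tm_wf M (s a)) \<Longrightarrow> tm_wf M (translate_tm \<pi> s t)"
  by (induction t) auto

lemma fm_wf_translate: "fm_wf M \<phi> \<Longrightarrow> (\<And>a. tm_wf M (s a)) \<Longrightarrow> fm_wf M (translate \<pi> s \<phi>)"
  by (induction \<phi>) (auto simp: tm_wf_translate)

lemma tm_fv_translate: "tm_fv (translate_tm \<pi> s t) = \<pi> ` tm_fv t \<union> (\<Union>a\<in>tm_pars t. tm_fv (s a))"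
  by (induction t) auto

lemma fv_translate: "fv (translate \<pi> s \<phi>) \<subseteq> \<pi> ` fv \<phi> \<union> (\<Union>a\<in>fm_pars \<phi>. tm_fv (s a))"
proof (induction \<phi>)
  case (Exi n \<phi>) then show ?case by auto
qed (auto simp: tm_fv_translate)

lemma tm_pars_translate: "tm_pars (translate_tm \<pi> s t) = (\<Union>a\<in>tm_pars t. tm_pars (s a))"
  by (induction t) auto

lemma fm_pars_translate: "fm_pars (translate \<pi> s \<phi>) = (\<Union>a\<in>fm_pars \<phi>. tm_pars (s a))"
  by (induction \<phi>) (auto simp: tm_pars_translate)

lemma tm_val_translate:
  assumes "\<And>a. a \<in> tm_pars t \<Longrightarrow> tm_val M v (s a) = h a"
  shows "tm_val M v (translate_tm \<pi> s t) = tm_val M (\<lambda>m. v (\<pi> m)) (translate_tm (\<lambda>n. n) (\<lambda>a. Par (h a)) t)"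
  using assms
proof (induction t)
  case (Fn f ts)
  then have "map (tm_val M v \<circ> translate_tm \<pi> s) ts =
      map (tm_val M (\<lambda>m. v (\<pi> m)) \<circ> translate_tm (\<lambda>n. n) (\<lambda>a. Par (h a))) ts"
    by auto
  then show ?case by (simp del: map_eq_conv)
qed auto

text \<open>The renaming commutes with updates of the assignment because it is injective, and the
  terms put in place of parameters are not captured because their variables avoid the renamed
  bound variables. The assignment turns each inserted term into the parameter \<open>h a\<close>.\<close>

lemma sat_translate:
  assumes "inj \<pi>"
  shows "(\<And>a. a \<in> fm_pars \<phi> \<Longrightarrow> tm_val M v (s a) = h a \<and> tm_fv (s a) \<inter> \<pi> ` bound_vars \<phi> = {}) \<Longrightarrow>
    sat M v (translate \<pi> s \<phi>) = sat M (\<lambda>m. v (\<pi> m)) (map_par h \<phi>)"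
proof (induction \<phi> arbitrary: v)
  case (Eq t u)
  then show ?case
    by (simp add: tm_val_translate[of t M v s h \<pi>] tm_val_translate[of u M v s h \<pi>])
next
  case (Rel r ts)
  then have "map (tm_val M v \<circ> translate_tm \<pi> s) ts =
      map (tm_val M (\<lambda>m. v (\<pi> m)) \<circ> translate_tm (\<lambda>n. n) (\<lambda>a. Par (h a))) ts"
    by (auto intro!: tm_val_translate)
  then show ?case by (simp del: map_eq_conv)
next
  case (Neg \<phi>) then show ?case by auto
next
  case (Conj \<phi> \<psi>)
  have "sat M v (translate \<pi> s \<phi>) = sat M (\<lambda>m. v (\<pi> m)) (map_par h \<phi>)"
    "sat M v (translate \<pi> s \<psi>) = sat M (\<lambda>m. v (\<pi> m)) (map_par h \<psi>)"
    using Conj.prems by (intro Conj.IH; fastforce)+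
  then show ?case by simp
next
  case (Exi n \<phi>)
  have "sat M (v(\<pi> n := b)) (translate \<pi> s \<phi>) = sat M ((\<lambda>m. v (\<pi> m))(n := b)) (map_par h \<phi>)" for b
  proof -
    have "sat M (v(\<pi> n := b)) (translate \<pi> s \<phi>) = sat M (\<lambda>m. (v(\<pi> n := b)) (\<pi> m)) (map_par h \<phi>)"
    proof (rule Exi.IH)
      fix a assume "a \<in> fm_pars \<phi>"
      then have a: "tm_val M v (s a) = h a" "tm_fv (s a) \<inter> \<pi> ` bound_vars (Exi n \<phi>) = {}"
        using Exi.prems[of a] by auto
      have "tm_val M (v(\<pi> n := b)) (s a) = tm_val M v (s a)"
        by (rule tm_val_cong) (use a(2) in auto)
      then show "tm_val M (v(\<pi> n := b)) (s a) = h a \<and> tm_fv (s a) \<inter> \<pi> ` bound_vars \<phi> = {}"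
        using a by auto
    qed
    also have "(\<lambda>m. (v(\<pi> n := b)) (\<pi> m)) = (\<lambda>m. v (\<pi> m))(n := b)"
      using assms by (auto simp: fun_eq_iff inj_eq)
    finally show ?thesis .
  qed
  then show ?case by simp
qed

lemma translate_tm_cong: "(\<And>a. a \<in> tm_pars t \<Longrightarrow> s a = s' a) \<Longrightarrow> translate_tm \<pi> s t = translate_tm \<pi> s' t"
  by (induction t) auto

lemma translate_cong: "(\<And>a. a \<in> fm_pars \<phi> \<Longrightarrow> s a = s' a) \<Longrightarrow> translate \<pi> s \<phi> = translate \<pi> s' \<phi>"
  by (induction \<phi>) (auto intro!: translate_tm_cong)

lemma translate_tm_id: "translate_tm (\<lambda>n. n) Par t = t"
  by (induction t) (auto intro!: map_idI)

lemma translate_id: "translate (\<lambda>n. n) Par \<phi> = \<phi>"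
  by (induction \<phi>) (auto simp: translate_tm_id intro!: map_idI)

lemma map_par_id: "(\<And>a. a \<in> fm_pars \<phi> \<Longrightarrow> h a = a) \<Longrightarrow> map_par h \<phi> = \<phi>"
  using translate_cong[of \<phi> "\<lambda>a. Par (h a)" Par "\<lambda>n. n"] translate_id[of \<phi>] by auto

lemma tm_wf_inst: "tm_wf M (inst_tm z b t) = tm_wf M t"
  by (induction t) auto

lemma fm_wf_inst: "fm_wf M (inst z b \<phi>) = fm_wf M \<phi>"
  by (induction \<phi> arbitrary: z) (auto simp: tm_wf_inst)

lemma tm_fv_inst: "tm_fv (inst_tm z b t) = tm_fv t - z"
  by (induction t) auto

lemma fv_inst: "fv (inst z b \<phi>) = fv \<phi> - z"
  by (induction \<phi> arbitrary: z) (auto simp: tm_fv_inst)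

lemma tm_pars_inst: "tm_pars (inst_tm z b t) \<subseteq> tm_pars t \<union> b ` (z \<inter> tm_fv t)"
proof (induction t)
  case (Fn f ts)
  then show ?case by fastforce
qed auto

lemma fm_pars_inst: "fm_pars (inst z b \<phi>) \<subseteq> fm_pars \<phi> \<union> b ` (z \<inter> fv \<phi>)"
proof (induction \<phi> arbitrary: z)
  case (Eq s t) then show ?case using tm_pars_inst[of z b s] tm_pars_inst[of z b t] by auto
next
  case (Rel r ts) then show ?case using tm_pars_inst[of z b] by fastforce
next
  case (Conj \<phi> \<psi>)
  show ?case using Conj[of z] by auto
next
  case (Exi n \<phi>)
  have "b ` ((z - {n}) \<inter> fv \<phi>) \<subseteq> b ` (z \<inter> fv (Exi n \<phi>))" by auto
  then show ?case using Exi[of "z - {n}"] by auto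
qed auto

lemma tm_val_inst: "tm_val M v (inst_tm z b t) = tm_val M (override_on v b z) t"
  by (induction t) (auto simp: override_on_def comp_def cong: map_cong)

lemma sat_inst: "sat M v (inst z b \<phi>) = sat M (override_on v b z) \<phi>"
proof (induction \<phi> arbitrary: v z)
  case (Exi n \<phi>)
  have "override_on (v(n := a)) b (z - {n}) = (override_on v b z)(n := a)" for a
    by (auto simp: override_on_def fun_eq_iff)
  then show ?case by (simp only: inst.simps sat.simps Exi.IH)
qed (simp_all add: tm_val_inst comp_def)

lemma inst_tm_cong: "(\<And>n. n \<in> z \<Longrightarrow> b n = b' n) \<Longrightarrow> inst_tm z b t = inst_tm z b' t"
  by (induction t) auto

lemma inst_cong: "(\<And>n. n \<in> z \<Longrightarrow> b n = b' n) \<Longrightarrow> inst z b \<phi> = inst z b' \<phi>"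
proof (induction \<phi> arbitrary: z)
  case (Exi n \<phi>)
  have "inst (z - {n}) b \<phi> = inst (z - {n}) b' \<phi>" by (rule Exi.IH) (use Exi.prems in auto)
  then show ?case by simp
qed (auto intro!: inst_tm_cong)

lemma inst_tm_inst_tm:
  "inst_tm z b (inst_tm w c t) = inst_tm (z \<union> w) (override_on b c w) t"
  by (induction t) (auto simp: override_on_def)

lemma inst_inst:
  "inst z b (inst w c \<phi>) = inst (z \<union> w) (override_on b c w) \<phi>"
proof (induction \<phi> arbitrary: z w)
  case (Exi n \<phi>)
  have "inst (z - {n} \<union> (w - {n})) (override_on b c (w - {n})) \<phi>
      = inst (z \<union> w - {n}) (override_on b c w) \<phi>"
    unfolding Un_Diff[symmetric] by (rule inst_cong) (auto simp: override_on_def)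
  then show ?case using Exi[of "z - {n}" "w - {n}"] by simp
qed (auto simp: inst_tm_inst_tm comp_def)

lemma map_par_inst_tm:
  "translate_tm (\<lambda>n. n) (\<lambda>a. Par (h a)) (inst_tm z b t) =
    inst_tm z (h \<circ> b) (translate_tm (\<lambda>n. n) (\<lambda>a. Par (h a)) t)"
  by (induction t) auto

lemma map_par_inst:
  "map_par h (inst z b \<phi>) = inst z (h \<circ> b) (map_par h \<phi>)"
  by (induction \<phi> arbitrary: z) (auto simp: map_par_inst_tm)

lemma inst_tm_abstract:
  "(\<And>a. a \<in> tm_pars t \<Longrightarrow> e a \<in> w) \<Longrightarrow> w \<inter> tm_fv t = {} \<Longrightarrow>
   inst_tm w c (translate_tm (\<lambda>n. n) (\<lambda>a. Var (e a)) t) = translate_tm (\<lambda>n. n) (\<lambda>a. Par (c (e a))) t"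
proof (induction t)
  case (Fn f ts)
  have "inst_tm w c (translate_tm (\<lambda>n. n) (\<lambda>a. Var (e a)) t)
      = translate_tm (\<lambda>n. n) (\<lambda>a. Par (c (e a))) t" if "t \<in> set ts" for t
    by (rule Fn.IH[OF that]) (use Fn.prems that in auto)
  then show ?case by simp
qed auto

lemma inst_abstract:
  "(\<And>a. a \<in> fm_pars \<phi> \<Longrightarrow> e a \<in> w) \<Longrightarrow> w \<inter> fv \<phi> = {} \<Longrightarrow> w \<inter> bound_vars \<phi> = {} \<Longrightarrow>
   inst w c (translate (\<lambda>n. n) (\<lambda>a. Var (e a)) \<phi>) = translate (\<lambda>n. n) (\<lambda>a. Par (c (e a))) \<phi>"
proof (induction \<phi>)
  case (Eq t u)
  then show ?case
    using inst_tm_abstract[of t e w c] inst_tm_abstract[of u e w c] by auto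
next
  case (Rel r ts)
  then have "inst_tm w c (translate_tm (\<lambda>n. n) (\<lambda>a. Var (e a)) t) = translate_tm (\<lambda>n. n) (\<lambda>a. Par (c (e a))) t"
    if "t \<in> set ts" for t using that by (intro inst_tm_abstract) auto
  then show ?case by simp
next
  case (Conj \<phi> \<psi>)
  then show ?case by (simp add: Int_Un_distrib)
next
  case (Exi n \<phi>)
  moreover from Exi.prems have "w - {n} = w" by auto
  moreover from Exi.prems have "w \<inter> fv \<phi> = {}" by auto
  ultimately show ?case by auto
qed auto

text \<open>Distinct fresh variables are chosen for the finitely many parameters. They also avoid a
  given finite set of variables, so that they can be added to the tuples already in use.\<close>

lemma obtain_abstraction:
  fixes \<phi> :: "('f, 'r, 'a) fm"
  assumes "finite (x :: nat set)"
  obtains w e where "finite w" "w \<inter> x = {}" "bij_betw e (fm_pars \<phi>) w"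
    "\<And>c. inst w c (translate (\<lambda>n. n) (\<lambda>a. Var (e a)) \<phi>) = map_par (c \<circ> e) \<phi>"
    "\<And>M. fm_wf M \<phi> \<Longrightarrow> translate (\<lambda>n. n) (\<lambda>a. Var (e a)) \<phi> \<in> Lfm M (fv \<phi> \<union> w) {}"
proof -
  let ?X = "x \<union> fv \<phi> \<union> bound_vars \<phi>"
  have "infinite (UNIV - ?X)" using assms finite_fv finite_bound_vars by (intro Diff_infinite_finite) auto
  then obtain w where w: "w \<subseteq> UNIV - ?X" "finite w" "card w = card (fm_pars \<phi>)"
    using infinite_arbitrarily_large by metis
  then obtain e where e: "bij_betw e (fm_pars \<phi>) w"
    using finite_same_card_bij[of "fm_pars \<phi>" w] finite_fm_pars by metis
  have ew: "e a \<in> w" if "a \<in> fm_pars \<phi>" for a using e that by (auto simp: bij_betw_def)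
  show thesis
  proof (rule that[of w e])
    show "inst w c (translate (\<lambda>n. n) (\<lambda>a. Var (e a)) \<phi>) = map_par (c \<circ> e) \<phi>" for c
      using inst_abstract[of \<phi> e w c] ew w by auto
    show "translate (\<lambda>n. n) (\<lambda>a. Var (e a)) \<phi> \<in> Lfm M (fv \<phi> \<union> w) {}" if "fm_wf M \<phi>" for M
      using fv_translate[of "\<lambda>n. n" "\<lambda>a. Var (e a)" \<phi>] ew that
      by (auto simp: Lfm_def fm_pars_translate intro!: fm_wf_translate)
  qed (use w e in auto)
qed

section \<open>Formulas over a set of parameters\<close>

lemma Lfm_mono: "x \<subseteq> y \<Longrightarrow> A \<subseteq> B \<Longrightarrow> Lfm M x A \<subseteq> Lfm M y B"
  by (auto simp: Lfm_def)

lemma Lfm_Neg [simp]: "Neg \<phi> \<in> Lfm M x A \<longleftrightarrow> \<phi> \<in> Lfm M x A"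
  and Lfm_Conj [simp]: "Conj \<phi> \<psi> \<in> Lfm M x A \<longleftrightarrow> \<phi> \<in> Lfm M x A \<and> \<psi> \<in> Lfm M x A"
  and Lfm_Disj [simp]: "Disj \<phi> \<psi> \<in> Lfm M x A \<longleftrightarrow> \<phi> \<in> Lfm M x A \<and> \<psi> \<in> Lfm M x A"
  by (auto simp: Lfm_def Disj_def)

lemma tm_wf_arities: "fun_ar M = fun_ar N \<Longrightarrow> tm_wf M t = tm_wf N t"
  by (induction t) auto

lemma fm_wf_arities: "fun_ar M = fun_ar N \<Longrightarrow> rel_ar M = rel_ar N \<Longrightarrow> fm_wf M \<phi> = fm_wf N \<phi>"
  by (induction \<phi>) (auto simp: tm_wf_arities[of M N])

lemma Lfm_arities: "fun_ar M = fun_ar N \<Longrightarrow> rel_ar M = rel_ar N \<Longrightarrow> Lfm M x A = Lfm N x A"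
  by (auto simp: Lfm_def fm_wf_arities[of M N])

text \<open>A valid formula that needs no symbol of the language and no parameter, hence is available
  over every set.\<close>

definition true_fm :: "('f, 'r, 'a) fm" where "true_fm = Exi 0 (Eq (Var 0) (Var 0))"

lemma true_fm_Lfm [simp]: "true_fm \<in> Lfm M x A"
  by (simp add: true_fm_def Lfm_def)

lemma sat_true_fm: "sat M v true_fm \<longleftrightarrow> univ M \<noteq> {}"
  by (auto simp: true_fm_def)

lemma Lfm_inst:
  assumes "\<phi> \<in> Lfm M y B" "y \<subseteq> x \<union> w" "B \<subseteq> A" "c \<in> w \<rightarrow> A"
  shows "inst w c \<phi> \<in> Lfm M x A"
proof -
  have "c ` (w \<inter> fv \<phi>) \<subseteq> A" using assms(4) by auto
  moreover have "fm_pars \<phi> \<subseteq> A" using assms(1,3) by (auto simp: Lfm_def)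
  ultimately have "fm_pars (inst w c \<phi>) \<subseteq> A" using fm_pars_inst[of w c \<phi>] by blast
  then show ?thesis using assms(1,2) by (auto simp: Lfm_def fm_wf_inst fv_inst)
qed

lemma join_tuples: "a \<in> tuples M x \<Longrightarrow> b \<in> tuples M y \<Longrightarrow> join x y a b \<in> tuples M (x \<union> y)"
  by (auto simp: tuples_def join_def PiE_iff)

text \<open>This is how types over parameters \<open>c\<close> become types of longer tuples over a smaller set.\<close>

lemma sat_inst_join:
  assumes "fv \<phi> \<subseteq> x \<union> w" "x \<inter> w = {}"
  shows "sat M a (inst w c \<phi>) = sat M (join x w a c) \<phi>"
  unfolding sat_inst
  by (rule sat_cong) (use assms in \<open>auto simp: override_on_def join_def\<close>)

lemma inst_inst_join:
  assumes "z \<inter> w = {}"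
  shows "inst z b (inst w c \<phi>) = inst (z \<union> w) (join z w b c) \<phi>"
  unfolding inst_inst
  by (rule inst_cong) (use assms in \<open>auto simp: override_on_def join_def\<close>)

text \<open>The form of \<open>obtain_abstraction\<close> that is used from here on: the parameters are presented
  as a tuple indexed by the new variables.\<close>

lemma obtain_instance:
  assumes \<phi>: "\<phi> \<in> Lfm M x A" and y: "finite (y :: nat set)"
  obtains w c \<phi>0 where "finite w" "w \<inter> y = {}" "c \<in> w \<rightarrow>\<^sub>E A" "\<phi>0 \<in> Lfm M (x \<union> w) {}" "\<phi> = inst w c \<phi>0"
proof -
  obtain w e where w: "finite w" "w \<inter> y = {}" "bij_betw e (fm_pars \<phi>) w"
    "\<And>c. inst w c (translate (\<lambda>n. n) (\<lambda>a. Var (e a)) \<phi>) = map_par (c \<circ> e) \<phi>"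
    "\<And>M. fm_wf M \<phi> \<Longrightarrow> translate (\<lambda>n. n) (\<lambda>a. Var (e a)) \<phi> \<in> Lfm M (fv \<phi> \<union> w) {}"
    using obtain_abstraction[OF y, of \<phi>] by blast
  let ?c = "restrict (inv_into (fm_pars \<phi>) e) w"
  show thesis
  proof (rule that[OF w(1,2)])
    show "?c \<in> w \<rightarrow>\<^sub>E A"
      using \<phi> bij_betw_inv_into[OF w(3)] by (auto simp: Lfm_def bij_betw_def)
    show "translate (\<lambda>n. n) (\<lambda>a. Var (e a)) \<phi> \<in> Lfm M (x \<union> w) {}"
      using w(5)[of M] \<phi> Lfm_mono[of "fv \<phi> \<union> w" "x \<union> w" "{}" "{}" M] by (auto simp: Lfm_def)
    have "map_par (?c \<circ> e) \<phi> = \<phi>"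
      using w(3) by (intro map_par_id) (auto simp: bij_betw_def inv_into_f_f)
    then show "\<phi> = inst w ?c (translate (\<lambda>n. n) (\<lambda>a. Var (e a)) \<phi>)" by (simp add: w(4))
  qed
qed

lemma map_par_inst_pure:
  assumes "\<phi> \<in> Lfm M x {}"
  shows "map_par h (inst w c \<phi>) = inst w (h \<circ> c) \<phi>"
proof -
  have "map_par h \<phi> = \<phi>" by (rule map_par_id) (use assms in \<open>auto simp: Lfm_def\<close>)
  then show ?thesis by (simp add: map_par_inst)
qed

section \<open>Partial elementary maps\<close>

text \<open>The condition speaks of parameter-free formulas only, as in the definition of an
  elementary substructure; \<open>partial_elem_sat\<close> extends it to formulas with parameters.\<close>

definition partial_elem :: "('f, 'r, 'a) struct \<Rightarrow> ('f, 'r, 'a) struct \<Rightarrow> 'a set \<Rightarrow> ('a \<Rightarrow> 'a) \<Rightarrow> bool" where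
  "partial_elem M N A h \<longleftrightarrow> fun_ar M = fun_ar N \<and> rel_ar M = rel_ar N \<and>
     (\<forall>\<phi>\<in>Lfm M UNIV {}. \<forall>v\<in>UNIV \<rightarrow> A. sat M v \<phi> = sat N (\<lambda>n. h (v n)) \<phi>)"

lemma partial_elem_subset: "partial_elem M N A h \<Longrightarrow> B \<subseteq> A \<Longrightarrow> partial_elem M N B h"
  unfolding partial_elem_def by (meson Pi_mono subsetD order_refl)

lemma elem_sub_partial_elem: "elem_sub M N \<Longrightarrow> partial_elem M N (univ M) (\<lambda>a. a)"
  unfolding elem_sub_def partial_elem_def using Lfm_arities[of M N] by metis

text \<open>The variables of the formula are renamed to even numbers and its parameters become odd
  variables, so the two never interfere and no freshness condition on \<open>\<phi>\<close> arises.\<close>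

lemma partial_elem_sat:
  fixes \<phi> :: "('f, 'r, 'a) fm"
  assumes h: "partial_elem M N A h" and \<phi>: "\<phi> \<in> Lfm M UNIV A" and v: "\<And>n. v n \<in> A"
  shows "sat M v \<phi> = sat N (\<lambda>n. h (v n)) (map_par h \<phi>)"
proof -
  obtain e :: "'a \<Rightarrow> nat" where e: "inj_on e (fm_pars \<phi>)"
    using finite_imp_inj_to_nat_seg[OF finite_fm_pars[of \<phi>]] by blast
  define \<pi> where "\<pi> = (\<lambda>n::nat. 2 * n)"
  define s :: "'a \<Rightarrow> ('f, 'a) tm" where "s = (\<lambda>a. Var (2 * e a + 1))"
  \<comment> \<open>Odd variables that do not code a parameter do not occur in the translated formula; \<open>v 0\<close>
    merely keeps the values of the assignment in \<open>A\<close>.\<close>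
  define u where "u = (\<lambda>n. if even n then v (n div 2) else
    if n div 2 \<in> e ` fm_pars \<phi> then inv_into (fm_pars \<phi>) e (n div 2) else v 0)"
  have inj: "inj \<pi>" by (auto simp: \<pi>_def inj_def)
  have u\<pi>: "u (\<pi> n) = v n" for n by (simp add: u_def \<pi>_def)
  have ue: "u (2 * e a + 1) = a" if "a \<in> fm_pars \<phi>" for a
    using that e by (simp add: u_def inv_into_f_f)
  have u: "u n \<in> A" for n
    using v \<phi> inv_into_into[of "n div 2" e "fm_pars \<phi>"] by (auto simp: u_def Lfm_def)
  have odd: "tm_fv (s a) \<inter> \<pi> ` X = {}" for a X
    by (auto simp: s_def \<pi>_def) presburger
  have "translate \<pi> s \<phi> \<in> Lfm M UNIV {}"
    using \<phi> by (auto simp: Lfm_def fm_pars_translate s_def intro!: fm_wf_translate)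
  then have "sat M u (translate \<pi> s \<phi>) = sat N (\<lambda>n. h (u n)) (translate \<pi> s \<phi>)"
    using h u by (auto simp: partial_elem_def)
  also have "sat M u (translate \<pi> s \<phi>) = sat M (\<lambda>n. u (\<pi> n)) (map_par (\<lambda>a. a) \<phi>)"
    using ue odd by (intro sat_translate[OF inj]) (auto simp: s_def)
  also have "sat N (\<lambda>n. h (u n)) (translate \<pi> s \<phi>) = sat N (\<lambda>n. h (u (\<pi> n))) (map_par h \<phi>)"
    using ue odd by (intro sat_translate[OF inj]) (auto simp: s_def)
  finally show ?thesis by (simp add: u\<pi> map_par_id)
qed

lemma partial_elem_sat_on:
  assumes h: "partial_elem M N A h" and \<phi>: "\<phi> \<in> Lfm M x A" and v: "\<And>n. n \<in> x \<Longrightarrow> v n \<in> A" and A: "A \<noteq> {}"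
    and w: "\<And>n. n \<in> x \<Longrightarrow> w n = h (v n)"
  shows "sat M v \<phi> = sat N w (map_par h \<phi>)"
proof -
  obtain a where a: "a \<in> A" using A by auto
  have fv: "fv \<phi> \<subseteq> x" using \<phi> by (auto simp: Lfm_def)
  have fv': "fv (map_par h \<phi>) \<subseteq> x"
    using fv_translate[of "\<lambda>n. n" "\<lambda>a. Par (h a)" \<phi>] fv by auto
  let ?v = "\<lambda>n. if n \<in> x then v n else a"
  have "sat M v \<phi> = sat M ?v \<phi>" by (rule sat_cong) (use fv in auto)
  also have "\<dots> = sat N (\<lambda>n. h (?v n)) (map_par h \<phi>)"
    using Lfm_mono[of x UNIV A A M] \<phi> a v by (intro partial_elem_sat[OF h]) auto
  also have "\<dots> = sat N w (map_par h \<phi>)" by (rule sat_cong) (use fv' w in auto)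
  finally show ?thesis .
qed

primrec Conjs :: "('f, 'r, 'a) fm list \<Rightarrow> ('f, 'r, 'a) fm" where
  "Conjs [] = true_fm"
| "Conjs (\<phi> # \<Phi>) = Conj \<phi> (Conjs \<Phi>)"

lemma sat_Conjs: "sat M v (Conjs \<Phi>) \<longleftrightarrow> univ M \<noteq> {} \<and> (\<forall>\<phi>\<in>set \<Phi>. sat M v \<phi>)"
  by (induction \<Phi>) (auto simp: sat_true_fm)

lemma Conjs_Lfm: "set \<Phi> \<subseteq> Lfm M x A \<Longrightarrow> Conjs \<Phi> \<in> Lfm M x A"
  by (induction \<Phi>) auto

lemma map_par_Conjs: "map_par h (Conjs \<Phi>) = Conjs (map (map_par h) \<Phi>)"
  by (induction \<Phi>) (auto simp: true_fm_def)

lemma map_par_Exs: "map_par h (foldr Exi xs \<phi>) = foldr Exi xs (map_par h \<phi>)"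
  by (induction xs) auto

lemma Exs_Lfm: "\<phi> \<in> Lfm M (x \<union> set xs) A \<Longrightarrow> foldr Exi xs \<phi> \<in> Lfm M x A"
proof (induction xs arbitrary: x)
  case (Cons n xs)
  then have "foldr Exi xs \<phi> \<in> Lfm M (insert n x) A" by (intro Cons.IH) auto
  then show ?case by (auto simp: Lfm_def)
qed auto

lemma sat_Exs:
  "distinct xs \<Longrightarrow> sat M v (foldr Exi xs \<phi>) \<longleftrightarrow> (\<exists>a\<in>set xs \<rightarrow> univ M. sat M (override_on v a (set xs)) \<phi>)"
proof (induction xs arbitrary: v)
  case Nil
  then show ?case by (simp add: override_on_def)
next
  case (Cons n xs)
  have "(\<exists>c\<in>univ M. \<exists>a\<in>set xs \<rightarrow> univ M. sat M (override_on (v(n := c)) a (set xs)) \<phi>) \<longleftrightarrow>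
    (\<exists>a\<in>set (n # xs) \<rightarrow> univ M. sat M (override_on v a (set (n # xs))) \<phi>)" (is "?L \<longleftrightarrow> ?R")
  proof
    assume ?L
    then obtain c a where ca: "c \<in> univ M" "a \<in> set xs \<rightarrow> univ M"
      "sat M (override_on (v(n := c)) a (set xs)) \<phi>" by auto
    have "override_on (v(n := c)) a (set xs) = override_on v (a(n := c)) (set (n # xs))"
      using Cons.prems by (auto simp: override_on_def fun_eq_iff)
    moreover have "a(n := c) \<in> set (n # xs) \<rightarrow> univ M" using ca by auto
    ultimately show ?R using ca(3) by metis
  next
    assume ?R
    then obtain a where a: "a \<in> set (n # xs) \<rightarrow> univ M" "sat M (override_on v a (set (n # xs))) \<phi>" by auto
    have "override_on v a (set (n # xs)) = override_on (v(n := a n)) a (set xs)"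
      by (auto simp: override_on_def fun_eq_iff)
    moreover have "a n \<in> univ M" "a \<in> set xs \<rightarrow> univ M" using a(1) by auto
    ultimately show ?L using a(2) by metis
  qed
  then show ?case using Cons by simp
qed

lemma sat_override_tuple:
  assumes "fv \<phi> \<subseteq> x" shows "sat M (override_on v a x) \<phi> = sat M a \<phi>"
  by (rule sat_cong) (use assms in auto)

lemma sat_restrict: "fv \<phi> \<subseteq> x \<Longrightarrow> sat M (restrict a x) \<phi> = sat M a \<phi>"
  by (rule sat_cong) auto

text \<open>The existence of a tuple that satisfies finitely many formulas is one sentence with
  parameters, and elementary maps preserve sentences in both directions.\<close>

lemma partial_elem_consistent:
  assumes h: "partial_elem M N A h" and ne: "A \<noteq> {}" "A \<subseteq> univ M" "h ` A \<subseteq> univ N"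
    and x: "finite x" and \<Phi>: "finite \<Phi>" "\<Phi> \<subseteq> Lfm M x A"
  shows "(\<exists>a\<in>tuples M x. \<forall>\<phi>\<in>\<Phi>. sat M a \<phi>) \<longleftrightarrow> (\<exists>a\<in>tuples N x. \<forall>\<phi>\<in>\<Phi>. sat N a (map_par h \<phi>))"
proof -
  obtain xs where xs: "set xs = x" "distinct xs" using finite_distinct_list[OF x] by auto
  obtain ps where ps: "set ps = \<Phi>" using finite_list[OF \<Phi>(1)] by auto
  obtain a0 where a0: "a0 \<in> A" using ne by auto
  have key: "sat K v (foldr Exi xs (Conjs qs)) \<longleftrightarrow> (\<exists>a\<in>tuples K x. \<forall>\<phi>\<in>set qs. sat K a \<phi>)"
    if "univ K \<noteq> {}" "\<And>\<phi>. \<phi> \<in> set qs \<Longrightarrow> fv \<phi> \<subseteq> x" for K :: "('a, 'b, 'c) struct" and v qs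
  proof -
    have "(\<exists>a\<in>x \<rightarrow> univ K. \<forall>\<phi>\<in>set qs. sat K a \<phi>) \<longleftrightarrow> (\<exists>a\<in>tuples K x. \<forall>\<phi>\<in>set qs. sat K a \<phi>)"
    proof
      assume "\<exists>a\<in>x \<rightarrow> univ K. \<forall>\<phi>\<in>set qs. sat K a \<phi>"
      then obtain a where a: "a \<in> x \<rightarrow> univ K" "\<forall>\<phi>\<in>set qs. sat K a \<phi>" by auto
      then have "restrict a x \<in> tuples K x" "\<forall>\<phi>\<in>set qs. sat K (restrict a x) \<phi>"
        using sat_restrict[OF that(2)] by (simp_all add: tuples_def)
      then show "\<exists>a\<in>tuples K x. \<forall>\<phi>\<in>set qs. sat K a \<phi>" by blast
    qed (auto simp: tuples_def)
    then show ?thesis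
      using that sat_override_tuple[of _ x K v] by (simp add: sat_Exs[OF xs(2)] xs(1) sat_Conjs)
  qed
  have fv': "fv (map_par h \<phi>) \<subseteq> x" if "\<phi> \<in> \<Phi>" for \<phi>
    using fv_translate[of "\<lambda>n. n" "\<lambda>a. Par (h a)" \<phi>] \<Phi> that by (auto simp: Lfm_def)
  have "foldr Exi xs (Conjs ps) \<in> Lfm M {} A" using xs ps \<Phi> by (intro Exs_Lfm Conjs_Lfm) auto
  then have "sat M (\<lambda>_. a0) (foldr Exi xs (Conjs ps))
      = sat N (\<lambda>_. h a0) (map_par h (foldr Exi xs (Conjs ps)))"
    using a0 by (intro partial_elem_sat_on[OF h]) auto
  then have "sat M (\<lambda>_. a0) (foldr Exi xs (Conjs ps))
      = sat N (\<lambda>_. h a0) (foldr Exi xs (Conjs (map (map_par h) ps)))"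
    by (simp only: map_par_Exs map_par_Conjs)
  moreover have "sat M (\<lambda>_. a0) (foldr Exi xs (Conjs ps)) \<longleftrightarrow> (\<exists>a\<in>tuples M x. \<forall>\<phi>\<in>set ps. sat M a \<phi>)"
    using ne \<Phi> ps by (intro key) (auto simp: Lfm_def)
  moreover have "sat N (\<lambda>_. h a0) (foldr Exi xs (Conjs (map (map_par h) ps))) \<longleftrightarrow>
      (\<exists>a\<in>tuples N x. \<forall>\<phi>\<in>set (map (map_par h) ps). sat N a \<phi>)"
    using ne fv' ps by (intro key) auto
  ultimately show ?thesis by (simp add: ps)
qed

section \<open>The space of complete types\<close>

definition fin_sat :: "('f, 'r, 'a) struct \<Rightarrow> nat set \<Rightarrow> ('f, 'r, 'a) fm set \<Rightarrow> bool" where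
  "fin_sat M x \<Gamma> \<longleftrightarrow> (\<forall>\<Phi>. finite \<Phi> \<and> \<Phi> \<subseteq> \<Gamma> \<longrightarrow> (\<exists>a\<in>tuples M x. \<forall>\<phi>\<in>\<Phi>. sat M a \<phi>))"

lemma ctypes_iff: "p \<in> ctypes M x A \<longleftrightarrow> p \<subseteq> Lfm M x A \<and> fin_sat M x p \<and>
    (\<forall>\<phi>\<in>Lfm M x A. \<phi> \<in> p \<or> Neg \<phi> \<in> p)"
  by (auto simp: ctypes_def fin_sat_def)

lemma ctypesD:
  assumes "p \<in> ctypes M x A"
  shows "p \<subseteq> Lfm M x A" "fin_sat M x p" "\<phi> \<in> Lfm M x A \<Longrightarrow> \<phi> \<in> p \<or> Neg \<phi> \<in> p"
  using assms by (auto simp: ctypes_iff)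

lemma fin_satD: "fin_sat M x \<Gamma> \<Longrightarrow> finite \<Phi> \<Longrightarrow> \<Phi> \<subseteq> \<Gamma> \<Longrightarrow> \<exists>a\<in>tuples M x. \<forall>\<phi>\<in>\<Phi>. sat M a \<phi>"
  by (auto simp: fin_sat_def)

lemma ctypes_consequence:
  assumes p: "p \<in> ctypes M x A" and "finite \<Phi>" "\<Phi> \<subseteq> p" "\<psi> \<in> Lfm M x A"
    and imp: "\<And>a. a \<in> tuples M x \<Longrightarrow> \<forall>\<phi>\<in>\<Phi>. sat M a \<phi> \<Longrightarrow> sat M a \<psi>"
  shows "\<psi> \<in> p"
proof (rule ccontr)
  assume "\<psi> \<notin> p"
  then have "Neg \<psi> \<in> p" using ctypesD(3)[OF p] assms by auto
  then obtain a where "a \<in> tuples M x" "\<forall>\<phi>\<in>insert (Neg \<psi>) \<Phi>. sat M a \<phi>"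
    using fin_satD[OF ctypesD(2)[OF p], of "insert (Neg \<psi>) \<Phi>"] assms by auto
  then show False using imp by auto
qed

lemma ctypes_Neg: "p \<in> ctypes M x A \<Longrightarrow> \<phi> \<in> Lfm M x A \<Longrightarrow> Neg \<phi> \<in> p \<longleftrightarrow> \<phi> \<notin> p"
proof -
  assume p: "p \<in> ctypes M x A" and \<phi>: "\<phi> \<in> Lfm M x A"
  have "\<not> {\<phi>, Neg \<phi>} \<subseteq> p"
  proof
    assume "{\<phi>, Neg \<phi>} \<subseteq> p"
    then have "\<exists>a\<in>tuples M x. \<forall>\<psi>\<in>{\<phi>, Neg \<phi>}. sat M a \<psi>"
      by (intro fin_satD[OF ctypesD(2)[OF p]]) auto
    then show False by auto
  qed
  then show ?thesis using ctypesD(3)[OF p \<phi>] by blast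
qed

lemma ctypes_Conj:
  assumes p: "p \<in> ctypes M x A" and "\<phi> \<in> Lfm M x A" "\<psi> \<in> Lfm M x A"
  shows "Conj \<phi> \<psi> \<in> p \<longleftrightarrow> \<phi> \<in> p \<and> \<psi> \<in> p"
proof (intro iffI conjI)
  assume "Conj \<phi> \<psi> \<in> p"
  then show "\<phi> \<in> p" "\<psi> \<in> p"
    using assms by (intro ctypes_consequence[OF p, of "{Conj \<phi> \<psi>}"]; simp)+
next
  assume "\<phi> \<in> p \<and> \<psi> \<in> p"
  then show "Conj \<phi> \<psi> \<in> p"
    using assms by (intro ctypes_consequence[OF p, of "{\<phi>, \<psi>}"]) simp_all
qed

lemma ctypes_Disj:
  assumes p: "p \<in> ctypes M x A" and "\<phi> \<in> Lfm M x A" "\<psi> \<in> Lfm M x A"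
  shows "Disj \<phi> \<psi> \<in> p \<longleftrightarrow> \<phi> \<in> p \<or> \<psi> \<in> p"
  using assms by (simp add: Disj_def ctypes_Neg[OF p] ctypes_Conj[OF p])

lemma ctypes_eqI:
  assumes "p \<in> ctypes M x A" "q \<in> ctypes M x A" "p \<subseteq> q" shows "p = q"
  using assms ctypes_Neg[of p M x A] ctypes_Neg[of q M x A] ctypesD(1)[of q M x A] by blast

lemma tp_ctypes: "a \<in> tuples M x \<Longrightarrow> tp M x A a \<in> ctypes M x A"
  by (auto simp: ctypes_iff fin_sat_def tp_def)

lemma tp_subset: "B \<subseteq> A \<Longrightarrow> tp M x B a = tp M x A a \<inter> Lfm M x B"
  using Lfm_mono[of x x B A M] by (auto simp: tp_def)

lemma ctypes_restrict:
  assumes "p \<in> ctypes M x A" "B \<subseteq> A" shows "p \<inter> Lfm M x B \<in> ctypes M x B"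
  using assms Lfm_mono[of x x B A M] by (auto simp: ctypes_iff fin_sat_def)

text \<open>A maximal finitely satisfiable set is complete: if neither \<open>\<phi>\<close> nor \<open>Neg \<phi>\<close> could be added,
  two finite subsets would witness this, and a tuple that satisfies their union would satisfy
  neither formula.\<close>

lemma lindenbaum:
  assumes \<Gamma>: "\<Gamma> \<subseteq> Lfm M x A" "fin_sat M x \<Gamma>"
  shows "\<exists>p\<in>ctypes M x A. \<Gamma> \<subseteq> p"
proof -
  let ?S = "{\<Delta>. \<Gamma> \<subseteq> \<Delta> \<and> \<Delta> \<subseteq> Lfm M x A \<and> fin_sat M x \<Delta>}"
  have "\<exists>p\<in>?S. \<forall>X\<in>?S. p \<subseteq> X \<longrightarrow> X = p"
  proof (rule subset_Zorn_nonempty)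
    show "?S \<noteq> {}" using \<Gamma> by auto
    fix \<C> assume \<C>: "\<C> \<noteq> {}" "subset.chain ?S \<C>"
    have "fin_sat M x (\<Union>\<C>)"
      unfolding fin_sat_def
    proof (intro allI impI, elim conjE)
      fix \<Phi> assume \<Phi>: "finite \<Phi>" "\<Phi> \<subseteq> \<Union>\<C>"
      obtain \<Delta> where "\<Delta> \<in> \<C>" "\<Phi> \<subseteq> \<Delta>"
        using finite_subset_Union_chain[OF \<Phi> \<C>] by blast
      then show "\<exists>a\<in>tuples M x. \<forall>\<phi>\<in>\<Phi>. sat M a \<phi>"
        using \<C>(2) \<Phi>(1) by (intro fin_satD[of M x \<Delta>]) (auto simp: subset.chain_def)
    qed
    then show "\<Union>\<C> \<in> ?S" using \<C> by (auto simp: subset.chain_def)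
  qed
  then obtain p where p: "\<Gamma> \<subseteq> p" "p \<subseteq> Lfm M x A" "fin_sat M x p"
    and max: "\<And>X. X \<in> ?S \<Longrightarrow> p \<subseteq> X \<Longrightarrow> X = p" by auto
  have "\<phi> \<in> p \<or> Neg \<phi> \<in> p" if \<phi>: "\<phi> \<in> Lfm M x A" for \<phi>
  proof (rule ccontr)
    assume no: "\<not> (\<phi> \<in> p \<or> Neg \<phi> \<in> p)"
    have "\<exists>\<Phi>. finite \<Phi> \<and> \<Phi> \<subseteq> p \<and> \<not> (\<exists>a\<in>tuples M x. sat M a \<psi> \<and> (\<forall>\<phi>\<in>\<Phi>. sat M a \<phi>))"
      if "\<psi> \<in> Lfm M x A" "\<psi> \<notin> p" for \<psi>
    proof -
      have "\<not> fin_sat M x (insert \<psi> p)"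
        using max[of "insert \<psi> p"] that p by auto
      then obtain \<Phi> where \<Phi>: "finite \<Phi>" "\<Phi> \<subseteq> insert \<psi> p" "\<not> (\<exists>a\<in>tuples M x. \<forall>\<phi>\<in>\<Phi>. sat M a \<phi>)"
        by (auto simp: fin_sat_def)
      then show ?thesis by (intro exI[of _ "\<Phi> - {\<psi>}"]) auto
    qed
    from this[of \<phi>] this[of "Neg \<phi>"] no \<phi> obtain \<Phi>1 \<Phi>2 where
      \<Phi>: "finite \<Phi>1" "\<Phi>1 \<subseteq> p" "\<not> (\<exists>a\<in>tuples M x. sat M a \<phi> \<and> (\<forall>\<phi>\<in>\<Phi>1. sat M a \<phi>))"
      "finite \<Phi>2" "\<Phi>2 \<subseteq> p" "\<not> (\<exists>a\<in>tuples M x. \<not> sat M a \<phi> \<and> (\<forall>\<phi>\<in>\<Phi>2. sat M a \<phi>))" by auto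
    then obtain a where "a \<in> tuples M x" "\<forall>\<phi>\<in>\<Phi>1 \<union> \<Phi>2. sat M a \<phi>"
      using fin_satD[OF p(3), of "\<Phi>1 \<union> \<Phi>2"] by auto
    then show False using \<Phi>(3,6) by (cases "sat M a \<phi>") auto
  qed
  then have "p \<in> ctypes M x A" using p by (auto simp: ctypes_iff)
  then show ?thesis using p(1) by auto
qed

lemma openin_type_space_clopen: "\<phi> \<in> Lfm M x A \<Longrightarrow> openin (type_space M x A) (clopen M x A \<phi>)"
  unfolding type_space_def by (intro topology_generated_by_Basis) auto

lemma topspace_type_space [simp]: "topspace (type_space M x A) = ctypes M x A"
proof -
  have "p \<in> (\<Union>\<phi>\<in>Lfm M x A. clopen M x A \<phi>)" if "p \<in> ctypes M x A" for p
    using ctypesD(3)[OF that true_fm_Lfm] that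
    by (auto simp: clopen_def intro: bexI[of _ true_fm] bexI[of _ "Neg true_fm"])
  then show ?thesis
    unfolding type_space_def topology_generated_by_topspace by (auto simp: clopen_def)
qed

lemma clopen_Neg: "\<phi> \<in> Lfm M x A \<Longrightarrow> clopen M x A (Neg \<phi>) = ctypes M x A - clopen M x A \<phi>"
  by (auto simp: clopen_def ctypes_Neg)

lemma clopen_Conj: "\<phi> \<in> Lfm M x A \<Longrightarrow> \<psi> \<in> Lfm M x A \<Longrightarrow>
    clopen M x A (Conj \<phi> \<psi>) = clopen M x A \<phi> \<inter> clopen M x A \<psi>"
  by (auto simp: clopen_def ctypes_Conj)

lemma clopen_Disj: "\<phi> \<in> Lfm M x A \<Longrightarrow> \<psi> \<in> Lfm M x A \<Longrightarrow>
    clopen M x A (Disj \<phi> \<psi>) = clopen M x A \<phi> \<union> clopen M x A \<psi>"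
  by (auto simp: clopen_def ctypes_Disj)

lemma type_space_base:
  assumes "openin (type_space M x A) V" "p \<in> V"
  shows "\<exists>\<phi>\<in>Lfm M x A. p \<in> clopen M x A \<phi> \<and> clopen M x A \<phi> \<subseteq> V"
proof -
  have "generate_topology_on (clopen M x A ` Lfm M x A) V"
    using assms(1) by (simp add: type_space_def openin_topology_generated_by_iff)
  then show ?thesis using assms(2)
  proof (induction arbitrary: p)
    case (Int a b)
    obtain \<phi> \<psi> where "\<phi> \<in> Lfm M x A" "p \<in> clopen M x A \<phi>" "clopen M x A \<phi> \<subseteq> a"
      "\<psi> \<in> Lfm M x A" "p \<in> clopen M x A \<psi>" "clopen M x A \<psi> \<subseteq> b"
      using Int.IH(1)[of p] Int.IH(2)[of p] Int.prems by auto
    then show ?case by (intro bexI[of _ "Conj \<phi> \<psi>"]) (auto simp: clopen_Conj)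
  next
    case (UN K)
    then obtain k where "k \<in> K" "p \<in> k" by auto
    then show ?case using UN.IH[of k p] by blast
  qed auto
qed

text \<open>For a cover without finite subcover, the negations of the formulas whose clopen set lies
  in some member of the cover are finitely satisfiable; a complete type that contains them would
  lie in no member.\<close>

lemma compact_type_space: "compact_space (type_space M x A)"
  unfolding compact_space_def compactin_def
proof (intro conjI allI impI, simp, elim conjE)
  fix \<U> assume op: "\<forall>V\<in>\<U>. openin (type_space M x A) V" and cov: "topspace (type_space M x A) \<subseteq> \<Union>\<U>"
  define \<Gamma> where "\<Gamma> = {\<phi> \<in> Lfm M x A. \<exists>V\<in>\<U>. clopen M x A \<phi> \<subseteq> V}"
  have "\<not> fin_sat M x (Neg ` \<Gamma>)"
  proof
    assume "fin_sat M x (Neg ` \<Gamma>)"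
    moreover have "Neg ` \<Gamma> \<subseteq> Lfm M x A" by (auto simp: \<Gamma>_def)
    ultimately obtain p where p: "p \<in> ctypes M x A" "Neg ` \<Gamma> \<subseteq> p"
      using lindenbaum by metis
    then obtain V where V: "V \<in> \<U>" "p \<in> V" using cov by auto
    then obtain \<phi> where \<phi>: "\<phi> \<in> Lfm M x A" "p \<in> clopen M x A \<phi>" "clopen M x A \<phi> \<subseteq> V"
      using type_space_base[of M x A V p] op by auto
    then have "Neg \<phi> \<in> p" using p V by (auto simp: \<Gamma>_def)
    then show False using \<phi> ctypes_Neg[OF p(1)] by (auto simp: clopen_def)
  qed
  then obtain \<Phi> where \<Phi>: "finite \<Phi>" "\<Phi> \<subseteq> Neg ` \<Gamma>" "\<not> (\<exists>a\<in>tuples M x. \<forall>\<phi>\<in>\<Phi>. sat M a \<phi>)"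
    by (auto simp: fin_sat_def)
  have "\<exists>V\<in>\<U>. ctypes M x A - clopen M x A \<psi> \<subseteq> V" if \<psi>: "\<psi> \<in> \<Phi>" for \<psi>
  proof -
    obtain \<phi> where "\<phi> \<in> \<Gamma>" "\<psi> = Neg \<phi>" using \<psi> \<Phi>(2) by auto
    moreover from this have "ctypes M x A - clopen M x A \<psi> \<subseteq> clopen M x A \<phi>"
      by (auto simp: \<Gamma>_def clopen_Neg)
    ultimately show ?thesis unfolding \<Gamma>_def by blast
  qed
  then obtain f where f: "\<And>\<psi>. \<psi> \<in> \<Phi> \<Longrightarrow> f \<psi> \<in> \<U> \<and> ctypes M x A - clopen M x A \<psi> \<subseteq> f \<psi>" by metis
  have "p \<in> \<Union>(f ` \<Phi>)" if p: "p \<in> ctypes M x A" for p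
  proof -
    have "\<not> \<Phi> \<subseteq> p" using fin_satD[OF ctypesD(2)[OF p] \<Phi>(1)] \<Phi>(3) by auto
    then obtain \<psi> where "\<psi> \<in> \<Phi>" "\<psi> \<notin> p" by auto
    then show ?thesis using f[of \<psi>] p by (auto simp: clopen_def)
  qed
  then show "\<exists>\<F>. finite \<F> \<and> \<F> \<subseteq> \<U> \<and> topspace (type_space M x A) \<subseteq> \<Union>\<F>"
    using f \<Phi>(1) by (intro exI[of _ "f ` \<Phi>"]) auto
qed

lemma Hausdorff_type_space: "Hausdorff_space (type_space M x A)"
  unfolding Hausdorff_space_def
proof (intro allI impI, elim conjE)
  fix p q assume p: "p \<in> topspace (type_space M x A)" and q: "q \<in> topspace (type_space M x A)" and ne: "p \<noteq> q"
  then obtain \<phi> where \<phi>: "\<phi> \<in> p" "\<phi> \<notin> q" using ctypes_eqI[of p M x A q] by auto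
  have L: "\<phi> \<in> Lfm M x A" using \<phi>(1) p ctypesD(1)[of p M x A] by auto
  show "\<exists>V W. openin (type_space M x A) V \<and> openin (type_space M x A) W \<and> p \<in> V \<and> q \<in> W \<and> disjnt V W"
  proof (intro exI conjI)
    show "openin (type_space M x A) (clopen M x A \<phi>)" "openin (type_space M x A) (clopen M x A (Neg \<phi>))"
      using L by (simp_all add: openin_type_space_clopen)
    show "p \<in> clopen M x A \<phi>" using p \<phi> by (simp add: clopen_def)
    show "q \<in> clopen M x A (Neg \<phi>)" using q \<phi> L by (simp add: clopen_def ctypes_Neg)
    show "disjnt (clopen M x A \<phi>) (clopen M x A (Neg \<phi>))"
      by (auto simp: clopen_Neg[OF L] disjnt_def)
  qed
qed

lemma type_space_clopen_base: "clopen_base (type_space M x A) (clopen M x A ` Lfm M x A)"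
proof (rule clopen_base.intro)
  show "compact_space (type_space M x A)" by (rule compact_type_space)
  show "Hausdorff_space (type_space M x A)" by (rule Hausdorff_type_space)
  show "algebra (topspace (type_space M x A)) (clopen M x A ` Lfm M x A)"
    unfolding algebra_iff_Int
  proof (intro conjI ballI)
    show "clopen M x A ` Lfm M x A \<subseteq> Pow (topspace (type_space M x A))" by (auto simp: clopen_def)
    have "clopen M x A (Conj true_fm (Neg true_fm)) = {}" by (simp add: clopen_Conj clopen_Neg)
    then show "{} \<in> clopen M x A ` Lfm M x A" by (metis Lfm_Conj Lfm_Neg image_eqI true_fm_Lfm)
    fix C assume "C \<in> clopen M x A ` Lfm M x A"
    then obtain \<phi> where \<phi>: "\<phi> \<in> Lfm M x A" "C = clopen M x A \<phi>" by auto
    then have "topspace (type_space M x A) - C = clopen M x A (Neg \<phi>)" by (simp add: clopen_Neg)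
    then show "topspace (type_space M x A) - C \<in> clopen M x A ` Lfm M x A" using \<phi> by auto
    fix D assume "D \<in> clopen M x A ` Lfm M x A"
    then obtain \<psi> where \<psi>: "\<psi> \<in> Lfm M x A" "D = clopen M x A \<psi>" by auto
    then have "C \<inter> D = clopen M x A (Conj \<phi> \<psi>)" using \<phi> by (simp add: clopen_Conj)
    then show "C \<inter> D \<in> clopen M x A ` Lfm M x A" using \<phi> \<psi> by auto
  qed
next
  fix C assume "C \<in> clopen M x A ` Lfm M x A"
  then show "openin (type_space M x A) C" by (auto simp: openin_type_space_clopen)
next
  fix V p assume "openin (type_space M x A) V" "p \<in> V"
  from type_space_base[OF this] obtain \<phi> where
    "\<phi> \<in> Lfm M x A" "p \<in> clopen M x A \<phi> \<and> clopen M x A \<phi> \<subseteq> V" ..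
  then show "\<exists>c\<in>clopen M x A ` Lfm M x A. p \<in> c \<and> c \<subseteq> V" by (intro bexI[of _ "clopen M x A \<phi>"] imageI)
qed

section \<open>Small models\<close>

lemma card_of_lists_infinite:
  assumes I: "infinite I" and S: "|S| \<le>o |I|"
  shows "|{xs. set xs \<subseteq> S}| \<le>o |I|"
proof -
  have "|{xs. set xs \<subseteq> S \<and> length xs = n}| \<le>o |I|" for n
  proof (induction n)
    case 0
    have "{xs. set xs \<subseteq> S \<and> length xs = 0} = {[]}" by auto
    moreover obtain i where "i \<in> I" using I by fastforce
    ultimately show ?case by (auto intro: card_of_ordLeqI[of "\<lambda>_. i"])
  next
    case (Suc n)
    let ?L = "{xs. set xs \<subseteq> S \<and> length xs = n}"
    have "{xs. set xs \<subseteq> S \<and> length xs = Suc n} = (\<lambda>(x, xs). x # xs) ` (S \<times> ?L)"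
      by (auto simp: length_Suc_conv)
    moreover have "|S \<times> ?L| \<le>o |I|"
      using card_of_Times_ordLeq_infinite_Field[of "|I|" S ?L] I S Suc by (simp add: Field_card_of card_of_card_order_on)
    ultimately show ?case by (simp only: ordLeq_transitive[OF card_of_image])
  qed
  moreover have "|UNIV :: nat set| \<le>o |I|" using I by (simp add: infinite_iff_card_of_nat)
  moreover have "{xs. set xs \<subseteq> S} = (\<Union>n. {xs. set xs \<subseteq> S \<and> length xs = n})" by auto
  ultimately show ?thesis using card_of_UNION_ordLeq_infinite[OF I, of UNIV "\<lambda>n. {xs. set xs \<subseteq> S \<and> length xs = n}"] by simp
qed

lemma card_of_image_ordLeq: "|A| \<le>o |I| \<Longrightarrow> |f ` A| \<le>o |I|"
  using card_of_image ordLeq_transitive by blast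

lemma card_of_Un_ordLeq: "infinite I \<Longrightarrow> |A| \<le>o |I| \<Longrightarrow> |B| \<le>o |I| \<Longrightarrow> |A \<union> B| \<le>o |I|"
  by (intro card_of_Un_ordLeq_infinite_Field) (auto simp: Field_card_of card_of_card_order_on)

lemma card_of_Times_ordLeq: "infinite I \<Longrightarrow> |A| \<le>o |I| \<Longrightarrow> |B| \<le>o |I| \<Longrightarrow> |A \<times> B| \<le>o |I|"
  by (intro card_of_Times_ordLeq_infinite_Field) (auto simp: Field_card_of card_of_card_order_on)

lemma card_of_subset_ordLeq: "A \<subseteq> B \<Longrightarrow> |B| \<le>o |I| \<Longrightarrow> |A| \<le>o |I|"
  using card_of_mono1 ordLeq_transitive by blast

lemma size_list_member: "t \<in> set ts \<Longrightarrow> size t < size_list size ts"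
  by (induction ts) auto

text \<open>Terms and formulas are counted by bounding their size, which turns the recursion of the
  datatypes into an induction on a natural number. Only symbols with an arity and parameters
  from \<open>B\<close> occur in the formulas counted, so the types \<open>'f\<close>, \<open>'r\<close> and \<open>'a\<close> themselves may be
  large.\<close>

lemma card_of_formulas:
  fixes M :: "('f, 'r, 'a) struct"
  assumes I: "infinite I" and f: "|dom (fun_ar M)| \<le>o |I|" and r: "|dom (rel_ar M)| \<le>o |I|" and B: "|B| \<le>o |I|"
  shows "|{\<phi>. fm_wf M \<phi> \<and> fm_pars \<phi> \<subseteq> B}| \<le>o |I|"
proof -
  let ?t = "\<lambda>n. {t. tm_wf M t \<and> tm_pars t \<subseteq> B \<and> size t < n}"
  let ?T = "{t. tm_wf M t \<and> tm_pars t \<subseteq> B}"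
  let ?f = "\<lambda>n. {\<phi>. fm_wf M \<phi> \<and> fm_pars \<phi> \<subseteq> B \<and> size \<phi> < n}"
  have N: "|UNIV :: nat set| \<le>o |I|" using I by (simp add: infinite_iff_card_of_nat)
  have t: "|?t n| \<le>o |I|" for n
  proof (induction n)
    case 0
    then show ?case using card_of_empty[of I] by simp
  next
    case (Suc n)
    have "?t (Suc n) \<subseteq> (range Var \<union> Par ` B) \<union> (\<lambda>(f, ts). Fn f ts) ` (dom (fun_ar M) \<times> {ts. set ts \<subseteq> ?t n})"
      (is "_ \<subseteq> ?R")
    proof
      fix t assume "t \<in> ?t (Suc n)"
      then show "t \<in> ?R"
      proof (cases t)
        case (Fn f ts)
        with \<open>t \<in> ?t (Suc n)\<close> have "f \<in> dom (fun_ar M)" "set ts \<subseteq> ?t n"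
          using size_list_member[of _ ts] by (fastforce simp: less_Suc_eq_le)+
        then show ?thesis unfolding Fn by (intro UnI2 image_eqI[of _ _ "(f, ts)"]) auto
      qed auto
    qed
    moreover have "|?R| \<le>o |I|"
      by (intro card_of_Un_ordLeq[OF I] card_of_image_ordLeq card_of_Times_ordLeq[OF I]
          card_of_lists_infinite[OF I] Suc N f B)
    ultimately show ?case by (rule card_of_subset_ordLeq)
  qed
  have "?T = (\<Union>n. ?t n)" by auto
  then have T: "|?T| \<le>o |I|" using card_of_UNION_ordLeq_infinite[OF I N, of ?t] t by simp
  have fm: "|?f n| \<le>o |I|" for n
  proof (induction n)
    case 0
    then show ?case using card_of_empty[of I] by simp
  next
    case (Suc n)
    have "?f (Suc n) \<subseteq> ((\<lambda>(s, t). Eq s t) ` (?T \<times> ?T)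
      \<union> (\<lambda>(r, ts). Rel r ts) ` (dom (rel_ar M) \<times> {ts. set ts \<subseteq> ?T}))
      \<union> ((Neg ` ?f n \<union> (\<lambda>(\<phi>, \<psi>). Conj \<phi> \<psi>) ` (?f n \<times> ?f n))
      \<union> (\<lambda>(k, \<phi>). Exi k \<phi>) ` (UNIV \<times> ?f n))" (is "_ \<subseteq> ?R")
    proof
      fix \<phi> assume "\<phi> \<in> ?f (Suc n)"
      then show "\<phi> \<in> ?R" by (cases \<phi>) (auto simp: image_iff)
    qed
    moreover have "|?R| \<le>o |I|"
      by (intro card_of_Un_ordLeq[OF I] card_of_image_ordLeq card_of_Times_ordLeq[OF I]
          card_of_lists_infinite[OF I] Suc N T r)
    ultimately show ?case by (rule card_of_subset_ordLeq)
  qed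
  have "{\<phi>. fm_wf M \<phi> \<and> fm_pars \<phi> \<subseteq> B} = (\<Union>n. ?f n)" by auto
  then show ?thesis using card_of_UNION_ordLeq_infinite[OF I N, of ?f] fm by simp
qed

lemma tm_val_univ_update [simp]: "tm_val (M\<lparr>univ := N\<rparr>) v t = tm_val M v t"
  by (rule tm_val_struct_cong) simp

lemma fm_wf_univ_update [simp]: "fm_wf (M\<lparr>univ := N\<rparr>) \<phi> = fm_wf M \<phi>"
  by (rule fm_wf_arities) auto

text \<open>Tarski-Vaught test. Witnesses are required for formulas in one variable with parameters in
  \<open>N\<close>, because there are few of those, while there are too many assignments of elements of \<open>N\<close>
  to all variables. The closure of \<open>N\<close> under function symbols follows from the test for
  \<open>v\<^sub>n = f(v\<^sub>0, \<dots>, v\<^sub>n\<^sub>-\<^sub>1)\<close>.\<close>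

lemma tarski_vaught:
  fixes U :: "('f, 'r, 'a) struct"
  assumes U: "is_structure U" and N: "N \<subseteq> univ U" "N \<noteq> {}"
    and wit: "\<And>n \<psi>. \<psi> \<in> Lfm U {n} N \<Longrightarrow> \<exists>a\<in>univ U. sat U (\<lambda>_. a) \<psi> \<Longrightarrow> \<exists>a\<in>N. sat U (\<lambda>_. a) \<psi>"
  shows "elem_sub (U\<lparr>univ := N\<rparr>) U"
proof -
  have tv: "\<exists>a\<in>N. sat U (v(n := a)) \<psi>"
    if \<psi>: "\<psi> \<in> Lfm U UNIV {}" and v: "v \<in> UNIV \<rightarrow> N" and ex: "\<exists>a\<in>univ U. sat U (v(n := a)) \<psi>"
    for \<psi> :: "('f, 'r, 'a) fm" and v n
  proof -
    have eq: "sat U (\<lambda>_. a) (inst (UNIV - {n}) v \<psi>) = sat U (v(n := a)) \<psi>" for a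
      unfolding sat_inst by (rule sat_cong) (auto simp: override_on_def)
    have "inst (UNIV - {n}) v \<psi> \<in> Lfm U {n} N" using v by (intro Lfm_inst[OF \<psi>]) auto
    then show ?thesis using wit[of "inst (UNIV - {n}) v \<psi>" n] ex unfolding eq by blast
  qed
  have "fun_int U f as \<in> N" if "fun_ar U f = Some (length as)" "set as \<subseteq> N" for f as
  proof -
    \<comment> \<open>The variable \<open>length as\<close> is the first that is not used for the arguments, and stands
      for the value.\<close>
    define v where "v = (\<lambda>n. if n < length as then as ! n else (SOME a. a \<in> N))"
    define \<psi> :: "('f, 'r, 'a) fm" where
      "\<psi> = Eq (Var (length as)) (Fn f (map Var [0..<length as]))"
    have "as ! n \<in> N" if "n < length as" for n using \<open>set as \<subseteq> N\<close> nth_mem[OF that] by blast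
    moreover have "(SOME a. a \<in> N) \<in> N" using N(2) by (simp add: some_in_eq)
    ultimately have v: "v \<in> UNIV \<rightarrow> N" by (simp add: v_def)
    have *: "map (\<lambda>i. (v(length as := a)) i) [0..<length as] = as" for a
      by (rule nth_equalityI) (auto simp: v_def)
    have sat: "sat U (v(length as := a)) \<psi> \<longleftrightarrow> a = fun_int U f as" for a
      using *[of a] by (simp add: \<psi>_def comp_def del: fun_upd_apply) (simp only: fun_upd_same)
    have "fun_int U f as \<in> univ U" using U that N by (auto simp: is_structure_def)
    moreover have "\<psi> \<in> Lfm U UNIV {}" using that by (auto simp: \<psi>_def Lfm_def)
    ultimately have "\<exists>a\<in>N. sat U (v(length as := a)) \<psi>"
      using tv[OF _ v, of \<psi> "length as"] sat by blast
    then show ?thesis using sat by auto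
  qed
  then have struct: "is_structure (U\<lparr>univ := N\<rparr>)" using N by (auto simp: is_structure_def)
  have "sat (U\<lparr>univ := N\<rparr>) v \<phi> = sat U v \<phi>"
    if "\<phi> \<in> Lfm U UNIV {}" "v \<in> UNIV \<rightarrow> N" for \<phi> :: "('f, 'r, 'a) fm" and v
    using that
  proof (induction \<phi> arbitrary: v)
    case (Exi n \<phi>)
    have \<phi>: "\<phi> \<in> Lfm U UNIV {}" using Exi.prems by (auto simp: Lfm_def)
    have "sat (U\<lparr>univ := N\<rparr>) (v(n := a)) \<phi> = sat U (v(n := a)) \<phi>" if "a \<in> N" for a
      using Exi.prems that by (intro Exi.IH \<phi>) auto
    then have "sat (U\<lparr>univ := N\<rparr>) v (Exi n \<phi>) \<longleftrightarrow> (\<exists>a\<in>N. sat U (v(n := a)) \<phi>)" by simp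
    also have "\<dots> \<longleftrightarrow> sat U v (Exi n \<phi>)" using tv[OF \<phi> Exi.prems(2), of n] N by auto
    finally show ?case .
  next
    case (Rel r ts)
    have "map (tm_val (U\<lparr>univ := N\<rparr>) v) ts = map (tm_val U v) ts" by simp
    then show ?case by (simp del: map_eq_conv)
  qed simp_all
  then show ?thesis using struct U N by (auto simp: elem_sub_def)
qed

lemma monster_modelD:
  assumes "monster_model \<kappa> T U"
  shows "is_structure U" "saturated \<kappa> U" "Card_order \<kappa>" "natLeq <o \<kappa>"
  using assms by (auto simp: monster_model_def)

lemma infinite_Field_monster:
  assumes "monster_model \<kappa> T U" shows "infinite (Field \<kappa>)"
  using monster_modelD(3,4)[OF assms]
  by (metis ordLess_imp_ordLeq infinite_iff_natLeq_ordLeq card_of_Field_ordIso ordIso_symmetric ordLeq_ordIso_trans)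

text \<open>Downward Loewenheim-Skolem: \<open>B\<close> is closed under witnesses in countably many steps. As \<open>\<kappa>\<close>
  may be singular, smallness is controlled by one infinite cardinal below \<open>\<kappa>\<close> that bounds \<open>B\<close>
  and the language.\<close>

lemma small_model_exists:
  fixes U :: "('f, 'r, 'a) struct"
  assumes mon: "monster_model \<kappa> T U" and B: "B \<subseteq> univ U" "small \<kappa> B"
  shows "\<exists>N. small_model \<kappa> U N \<and> B \<subseteq> N"
proof -
  have U: "is_structure U" and \<kappa>: "Card_order \<kappa>" "natLeq <o \<kappa>"
    and sm: "|dom (fun_ar U)| <o \<kappa>" "|dom (rel_ar U)| <o \<kappa>" "|B| <o \<kappa>"
    using mon B by (auto simp: monster_model_def small_def)
  obtain b where b: "b \<in> univ U" using U by (auto simp: is_structure_def)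
  note inf = infinite_Field_monster[OF mon]
  have N\<kappa>: "|UNIV :: nat set| <o \<kappa>" using \<kappa>(2) card_of_nat ordIso_ordLess_trans by blast
  \<comment> \<open>The cardinality of \<open>I\<close> bounds every stage of the construction.\<close>
  define I where "I = ((UNIV :: nat set) <+> B) <+> (dom (fun_ar U) <+> dom (rel_ar U))"
  have I\<kappa>: "|I| <o \<kappa>"
    unfolding I_def using sm N\<kappa> by (intro card_of_Plus_ordLess_infinite_Field[OF inf \<kappa>(1)])
  have I: "infinite I" unfolding I_def by (simp add: finite_Plus_iff)
  have leq: "|B| \<le>o |I|" "|dom (fun_ar U)| \<le>o |I|" "|dom (rel_ar U)| \<le>o |I|"
    unfolding I_def by (meson card_of_Plus1 card_of_Plus2 ordLeq_transitive)+
  define wit where "wit \<psi> = (SOME a. a \<in> univ U \<and> ((\<exists>a\<in>univ U. sat U (\<lambda>_. a) \<psi>) \<longrightarrow> sat U (\<lambda>_. a) \<psi>))"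
    for \<psi> :: "('f, 'r, 'a) fm"
  have wit: "wit \<psi> \<in> univ U" "\<exists>a\<in>univ U. sat U (\<lambda>_. a) \<psi> \<Longrightarrow> sat U (\<lambda>_. wit \<psi>) \<psi>" for \<psi> :: "('f, 'r, 'a) fm"
  proof -
    have "\<exists>a. a \<in> univ U \<and> ((\<exists>a\<in>univ U. sat U (\<lambda>_. a) \<psi>) \<longrightarrow> sat U (\<lambda>_. a) \<psi>)" using b by blast
    from someI_ex[OF this] show "wit \<psi> \<in> univ U" "\<exists>a\<in>univ U. sat U (\<lambda>_. a) \<psi> \<Longrightarrow> sat U (\<lambda>_. wit \<psi>) \<psi>"
      unfolding wit_def by blast+
  qed
  define step where "step A = A \<union> wit ` {\<phi>. fm_wf U \<phi> \<and> fm_pars \<phi> \<subseteq> A}" for A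
  define N where "N = (\<Union>k. (step ^^ k) B)"
  have stepU: "(step ^^ k) B \<subseteq> univ U" for k
    by (induction k) (use B wit(1) in \<open>auto simp: step_def\<close>)
  have mono: "(step ^^ k) B \<subseteq> (step ^^ l) B" if "k \<le> l" for k l
    using that by (rule lift_Suc_mono_le[rotated]) (auto simp: step_def)
  have card: "|(step ^^ k) B| \<le>o |I|" for k
  proof (induction k)
    case (Suc k)
    show ?case unfolding funpow.simps comp_def step_def[of "(step ^^ k) B"]
      by (intro card_of_Un_ordLeq[OF I] Suc card_of_image_ordLeq card_of_formulas[OF I leq(2,3)])
  qed (use leq in simp)
  have "|N| \<le>o |I|"
    unfolding N_def using card I
    by (intro card_of_UNION_ordLeq_infinite) (auto simp: infinite_iff_card_of_nat)
  then have small: "small \<kappa> N" unfolding small_def using I\<kappa> ordLeq_ordLess_trans by blast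
  have BN: "B \<subseteq> N" unfolding N_def using UN_upper[of 0 UNIV "\<lambda>k. (step ^^ k) B"] by simp
  have fin: "\<exists>k. F \<subseteq> (step ^^ k) B" if "finite F" "F \<subseteq> N" for F
    using that
  proof (induction F rule: finite_induct)
    case (insert a F)
    then obtain k l where "F \<subseteq> (step ^^ k) B" "a \<in> (step ^^ l) B" by (auto simp: N_def)
    then have "insert a F \<subseteq> (step ^^ max k l) B" using mono[of k "max k l"] mono[of l "max k l"] by auto
    then show ?case ..
  qed auto
  have witN: "wit \<psi> \<in> N" if \<psi>: "fm_wf U \<psi>" "fm_pars \<psi> \<subseteq> N" for \<psi>
  proof -
    obtain k where "fm_pars \<psi> \<subseteq> (step ^^ k) B" using fin[OF finite_fm_pars \<psi>(2)] by auto
    then have "wit \<psi> \<in> (step ^^ Suc k) B" using \<psi>(1) by (auto simp: step_def)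
    then show ?thesis unfolding N_def by blast
  qed
  have "elem_sub (U\<lparr>univ := N\<rparr>) U"
  proof (rule tarski_vaught[OF U])
    show "N \<subseteq> univ U" using stepU by (auto simp: N_def)
    show "N \<noteq> {}" using witN[of true_fm] true_fm_Lfm[of U "{}" "{}"] by (auto simp: Lfm_def)
    fix n \<psi> assume "\<psi> \<in> Lfm U {n} N" "\<exists>a\<in>univ U. sat U (\<lambda>_. a) \<psi>"
    then show "\<exists>a\<in>N. sat U (\<lambda>_. a) \<psi>" using witN[of \<psi>] wit(2)[of \<psi>] by (auto simp: Lfm_def)
  qed
  then show ?thesis using small BN by (auto simp: small_model_def)
qed

section \<open>Keisler measures as regular Borel measures\<close>

lemma tp_in_clopen:
  assumes "a \<in> defset U x \<phi>" "\<phi> \<in> Lfm U x A" shows "tp U x A a \<in> clopen U x A \<phi>"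
  using assms tp_ctypes[of a U x A] by (simp add: defset_def clopen_def) (simp add: tp_def)

lemma keislerD:
  assumes "\<mu> \<in> keisler U x A"
  shows "\<phi> \<in> Lfm U x A \<Longrightarrow> 0 \<le> \<mu> \<phi>"
    and "\<phi> \<in> Lfm U x A \<Longrightarrow> \<psi> \<in> Lfm U x A \<Longrightarrow> defset U x \<phi> = defset U x \<psi> \<Longrightarrow> \<mu> \<phi> = \<mu> \<psi>"
    and "\<phi> \<in> Lfm U x A \<Longrightarrow> defset U x \<phi> = tuples U x \<Longrightarrow> \<mu> \<phi> = 1"
    and "\<phi> \<in> Lfm U x A \<Longrightarrow> \<psi> \<in> Lfm U x A \<Longrightarrow> defset U x \<phi> \<inter> defset U x \<psi> = {} \<Longrightarrow>
      \<mu> (Disj \<phi> \<psi>) = \<mu> \<phi> + \<mu> \<psi>"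
  using assms unfolding keisler_def by blast+

lemma restr_keisler:
  assumes \<mu>: "\<mu> \<in> keisler U x B" and AB: "A \<subseteq> B"
  shows "restr U x \<mu> A \<in> keisler U x A"
proof -
  have L: "\<phi> \<in> Lfm U x B" if "\<phi> \<in> Lfm U x A" for \<phi>
    using that Lfm_mono[OF order_refl AB] by auto
  have eq: "restr U x \<mu> A \<phi> = \<mu> \<phi>" if "\<phi> \<in> Lfm U x A" for \<phi> using that by (simp add: restr_def)
  show ?thesis
    unfolding keisler_def mem_Collect_eq
  proof (intro conjI ballI impI)
    show "restr U x \<mu> A \<in> extensional (Lfm U x A)" by (simp add: restr_def)
    fix \<phi> assume \<phi>: "\<phi> \<in> Lfm U x A"
    show "0 \<le> restr U x \<mu> A \<phi>" using keislerD(1)[OF \<mu> L[OF \<phi>]] by (simp add: eq[OF \<phi>])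
    show "restr U x \<mu> A \<phi> = 1" if "defset U x \<phi> = tuples U x"
      using keislerD(3)[OF \<mu> L[OF \<phi>] that] by (simp add: eq[OF \<phi>])
    fix \<psi> assume \<psi>: "\<psi> \<in> Lfm U x A"
    show "restr U x \<mu> A \<phi> = restr U x \<mu> A \<psi>" if "defset U x \<phi> = defset U x \<psi>"
      using keislerD(2)[OF \<mu> L[OF \<phi>] L[OF \<psi>] that] by (simp add: eq[OF \<phi>] eq[OF \<psi>])
    have "Disj \<phi> \<psi> \<in> Lfm U x A" using \<phi> \<psi> by simp
    then show "restr U x \<mu> A (Disj \<phi> \<psi>) = restr U x \<mu> A \<phi> + restr U x \<mu> A \<psi>"
      if "defset U x \<phi> \<inter> defset U x \<psi> = {}"
      using keislerD(4)[OF \<mu> L[OF \<phi>] L[OF \<psi>] that] by (simp only: eq \<phi> \<psi>)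
  qed
qed

text \<open>The types of tuples are dense in the space of types, so formulas define the same clopen
  set exactly when they define the same set of tuples. Hence a Keisler measure is a content on
  clopen sets.\<close>

lemma clopen_subset_iff:
  assumes "\<phi> \<in> Lfm U x A" "\<psi> \<in> Lfm U x A"
  shows "clopen U x A \<phi> \<subseteq> clopen U x A \<psi> \<longleftrightarrow> defset U x \<phi> \<subseteq> defset U x \<psi>"
proof
  assume sub: "clopen U x A \<phi> \<subseteq> clopen U x A \<psi>"
  show "defset U x \<phi> \<subseteq> defset U x \<psi>"
  proof
    fix a assume "a \<in> defset U x \<phi>"
    then have a: "a \<in> tuples U x" and "tp U x A a \<in> clopen U x A \<phi>"
      using assms by (auto simp: tp_in_clopen defset_def)
    then have "tp U x A a \<in> clopen U x A \<psi>" using sub by blast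
    then show "a \<in> defset U x \<psi>" using a by (auto simp: defset_def clopen_def tp_def)
  qed
next
  assume sub: "defset U x \<phi> \<subseteq> defset U x \<psi>"
  show "clopen U x A \<phi> \<subseteq> clopen U x A \<psi>"
  proof
    fix p assume "p \<in> clopen U x A \<phi>"
    then have p: "p \<in> ctypes U x A" "\<phi> \<in> p" by (auto simp: clopen_def)
    have "\<psi> \<in> p"
      by (rule ctypes_consequence[OF p(1), of "{\<phi>}"]) (use sub p assms in \<open>auto simp: defset_def\<close>)
    then show "p \<in> clopen U x A \<psi>" using p by (simp add: clopen_def)
  qed
qed

lemma clopen_eq_iff:
  "\<phi> \<in> Lfm U x A \<Longrightarrow> \<psi> \<in> Lfm U x A \<Longrightarrow>
    clopen U x A \<phi> = clopen U x A \<psi> \<longleftrightarrow> defset U x \<phi> = defset U x \<psi>"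
  by (simp add: set_eq_subset clopen_subset_iff)

lemma defset_disjoint:
  assumes "\<phi> \<in> Lfm U x A" "\<psi> \<in> Lfm U x A" "clopen U x A \<phi> \<inter> clopen U x A \<psi> = {}"
  shows "defset U x \<phi> \<inter> defset U x \<psi> = {}"
proof -
  have "tp U x A a \<in> clopen U x A \<phi> \<inter> clopen U x A \<psi>" if "a \<in> defset U x \<phi> \<inter> defset U x \<psi>" for a
    using that assms(1,2) by (auto intro!: tp_in_clopen)
  then show ?thesis using assms(3) by blast
qed

lemma borel_measure_of_eqI:
  assumes m: "regular_borel_prob (type_space U x A) m"
    and eq: "\<And>\<phi>. \<phi> \<in> Lfm U x A \<Longrightarrow> measure m (clopen U x A \<phi>) = \<mu> \<phi>"
  shows "borel_measure_of U x A \<mu> = m"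
  unfolding borel_measure_of_def
proof (rule the_equality)
  show "regular_borel_prob (type_space U x A) m \<and> (\<forall>\<phi>\<in>Lfm U x A. measure m (clopen U x A \<phi>) = \<mu> \<phi>)"
    using assms by blast
  fix n assume n: "regular_borel_prob (type_space U x A) n \<and>
    (\<forall>\<phi>\<in>Lfm U x A. measure n (clopen U x A \<phi>) = \<mu> \<phi>)"
  show "n = m"
  proof (rule clopen_base.regular_borel_prob_unique[OF type_space_clopen_base])
    interpret m: prob_space m using m by (rule regular_borel_probD)
    interpret n: prob_space n using n regular_borel_probD by blast
    fix c assume "c \<in> clopen U x A ` Lfm U x A"
    then show "emeasure n c = emeasure m c"
      using n eq by (auto simp: m.emeasure_eq_measure n.emeasure_eq_measure)
  qed (use n m in auto)
qed

text \<open>The values of \<open>\<mu>\<close> on formulas form a content on the clopen sets they define, and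
  \<open>regular_extension\<close> applies.\<close>

lemma borel_measure_of_exists:
  fixes U :: "('f, 'r, 'a) struct"
  assumes U: "is_structure U" and \<mu>: "\<mu> \<in> keisler U x A"
  shows "\<exists>m. regular_borel_prob (type_space U x A) m \<and>
    (\<forall>\<phi>\<in>Lfm U x A. measure m (clopen U x A \<phi>) = \<mu> \<phi>)"
proof -
  define m0 where "m0 = (\<lambda>C. ennreal (\<mu> (SOME \<phi>. \<phi> \<in> Lfm U x A \<and> clopen U x A \<phi> = C)))"
  have m0: "m0 (clopen U x A \<phi>) = ennreal (\<mu> \<phi>)" if \<phi>: "\<phi> \<in> Lfm U x A" for \<phi>
  proof -
    let ?\<psi> = "SOME \<psi>. \<psi> \<in> Lfm U x A \<and> clopen U x A \<psi> = clopen U x A \<phi>"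
    have "?\<psi> \<in> Lfm U x A \<and> clopen U x A ?\<psi> = clopen U x A \<phi>"
      by (rule someI[of _ \<phi>]) (use \<phi> in auto)
    then have "\<mu> ?\<psi> = \<mu> \<phi>" using clopen_eq_iff[of ?\<psi> U x A \<phi>] \<phi> by (intro keislerD(2)[OF \<mu>]) auto
    then show ?thesis by (simp add: m0_def)
  qed
  have true: "defset U x true_fm = tuples U x"
    using U by (auto simp: defset_def sat_true_fm is_structure_def)
  have add: "m0 (clopen U x A \<phi> \<union> clopen U x A \<psi>) = m0 (clopen U x A \<phi>) + m0 (clopen U x A \<psi>)"
    if "\<phi> \<in> Lfm U x A" "\<psi> \<in> Lfm U x A" "clopen U x A \<phi> \<inter> clopen U x A \<psi> = {}" for \<phi> \<psi>
    using that keislerD(4)[OF \<mu> that(1,2) defset_disjoint[OF that]] keislerD(1)[OF \<mu>]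
    by (simp add: clopen_Disj[symmetric] m0)
  have top: "m0 (ctypes U x A) = 1"
  proof -
    have "clopen U x A true_fm = ctypes U x A"
    proof -
      have "true_fm \<in> p" if "p \<in> ctypes U x A" for p
        by (rule ctypes_consequence[OF that, of "{}"]) (use U in \<open>auto simp: sat_true_fm is_structure_def\<close>)
      then show ?thesis by (auto simp: clopen_def)
    qed
    then show ?thesis using m0[OF true_fm_Lfm] keislerD(3)[OF \<mu> true_fm_Lfm true] by simp
  qed
  \<comment> \<open>A contradictory formula \<open>F\<close> is disjoint from itself, so \<open>\<mu> F = \<mu> F + \<mu> F\<close>.\<close>
  have emp: "m0 {} = 0"
  proof -
    let ?F = "Conj true_fm (Neg true_fm) :: ('f, 'r, 'a) fm"
    have e: "clopen U x A ?F = {}" by (simp add: clopen_Conj clopen_Neg)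
    have L: "?F \<in> Lfm U x A" by simp
    have "defset U x (Disj ?F ?F) = defset U x ?F" by (auto simp: defset_def)
    then have "\<mu> (Disj ?F ?F) = \<mu> ?F" by (intro keislerD(2)[OF \<mu>]) auto
    moreover have "\<mu> (Disj ?F ?F) = \<mu> ?F + \<mu> ?F"
      by (rule keislerD(4)[OF \<mu> L L]) (auto simp: defset_def)
    ultimately show ?thesis using m0[OF L] e by simp
  qed
  interpret clopen_content "type_space U x A" "clopen U x A ` Lfm U x A" m0
  proof (intro clopen_content.intro type_space_clopen_base clopen_content_axioms.intro)
    show "positive (clopen U x A ` Lfm U x A) m0" by (simp add: positive_def emp)
    show "additive (clopen U x A ` Lfm U x A) m0" using add by (auto simp: additive_def)
    show "m0 (topspace (type_space U x A)) = 1" by (simp add: top)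
  qed
  obtain m where m: "regular_borel_prob (type_space U x A) m"
    "\<forall>c\<in>clopen U x A ` Lfm U x A. emeasure m c = m0 c" using regular_extension by blast
  interpret m: prob_space m using m(1) by (rule regular_borel_probD)
  have "measure m (clopen U x A \<phi>) = \<mu> \<phi>" if "\<phi> \<in> Lfm U x A" for \<phi>
    using m(2) m0[OF that] that keislerD(1)[OF \<mu> that] by (auto simp: measure_def)
  then show ?thesis using m(1) by blast
qed

lemma borel_measure_of:
  assumes U: "is_structure U" and \<mu>: "\<mu> \<in> keisler U x A"
  shows "regular_borel_prob (type_space U x A) (borel_measure_of U x A \<mu>)"
    and "\<phi> \<in> Lfm U x A \<Longrightarrow> measure (borel_measure_of U x A \<mu>) (clopen U x A \<phi>) = \<mu> \<phi>"
proof -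
  obtain m where m: "regular_borel_prob (type_space U x A) m"
    "\<And>\<phi>. \<phi> \<in> Lfm U x A \<Longrightarrow> measure m (clopen U x A \<phi>) = \<mu> \<phi>"
    using borel_measure_of_exists[OF assms] by blast
  then have "borel_measure_of U x A \<mu> = m" by (rule borel_measure_of_eqI)
  then show "regular_borel_prob (type_space U x A) (borel_measure_of U x A \<mu>)"
    "\<phi> \<in> Lfm U x A \<Longrightarrow> measure (borel_measure_of U x A \<mu>) (clopen U x A \<phi>) = \<mu> \<phi>"
    using m by auto
qed

lemma supp_complement:
  assumes \<mu>: "\<mu> \<in> keisler U x A"
  shows "ctypes U x A - supp U x A \<mu> = \<Union>(clopen U x A ` {\<phi> \<in> Lfm U x A. \<mu> \<phi> = 0})"
proof -
  have "\<not> \<mu> \<phi> > 0 \<longleftrightarrow> \<mu> \<phi> = 0" if "\<phi> \<in> Lfm U x A" for \<phi>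
    using keislerD(1)[OF \<mu> that] by linarith
  then have "q \<notin> supp U x A \<mu> \<longleftrightarrow> (\<exists>\<phi>\<in>Lfm U x A. \<phi> \<in> q \<and> \<mu> \<phi> = 0)" if "q \<in> ctypes U x A" for q
    using ctypesD(1)[OF that] that unfolding supp_def by blast
  then show ?thesis by (auto simp: clopen_def)
qed

lemma closedin_supp:
  assumes "\<mu> \<in> keisler U x A" shows "closedin (type_space U x A) (supp U x A \<mu>)"
proof -
  have "openin (type_space U x A) (ctypes U x A - supp U x A \<mu>)"
    unfolding supp_complement[OF assms] by (intro openin_Union) (auto simp: openin_type_space_clopen)
  then show ?thesis by (auto simp: closedin_def supp_def)
qed

text \<open>The complement of the support is a union of possibly uncountably many null clopen sets.
  Inner regularity reduces the claim to compact sets, for which finitely many of them suffice.\<close>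

lemma AE_supp:
  assumes U: "is_structure U" and \<mu>: "\<mu> \<in> keisler U x A"
  shows "AE q in borel_measure_of U x A \<mu>. q \<in> supp U x A \<mu>"
proof -
  let ?m = "borel_measure_of U x A \<mu>" and ?V = "ctypes U x A - supp U x A \<mu>"
  note m = borel_measure_of(1)[OF assms]
  interpret prob_space ?m using m by (rule regular_borel_probD)
  have V: "openin (type_space U x A) ?V" using closedin_supp[OF \<mu>] by (auto simp: closedin_def)
  have "emeasure ?m K = 0" if K: "compactin (type_space U x A) K" "K \<subseteq> ?V" for K
  proof -
    have "\<exists>F. finite F \<and> F \<subseteq> clopen U x A ` {\<phi> \<in> Lfm U x A. \<mu> \<phi> = 0} \<and> K \<subseteq> \<Union>F"
      using K(2) unfolding supp_complement[OF \<mu>]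
      by (intro compactinD[OF K(1)]) (auto simp: openin_type_space_clopen)
    then obtain F where F: "finite F" "F \<subseteq> clopen U x A ` {\<phi> \<in> Lfm U x A. \<mu> \<phi> = 0}" "K \<subseteq> \<Union>F"
      by blast
    have null: "c \<in> null_sets ?m" if "c \<in> F" for c
    proof -
      obtain \<phi> where \<phi>: "\<phi> \<in> Lfm U x A" "\<mu> \<phi> = 0" "c = clopen U x A \<phi>" using F(2) \<open>c \<in> F\<close> by auto
      have "c \<in> sets ?m"
        using regular_borel_probD(2)[OF m] \<phi> by (simp add: openin_borel_algebra openin_type_space_clopen)
      then show ?thesis
        using borel_measure_of(2)[OF assms \<phi>(1)] \<phi> by (intro null_setsI) (auto simp: emeasure_eq_measure)
    qed
    have "\<Union>F \<in> null_sets ?m" using F(1) null by (intro null_sets.finite_Union) auto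
    then have "emeasure ?m (\<Union>F) = 0" "\<Union>F \<in> sets ?m" by auto
    then show ?thesis using emeasure_mono[OF F(3)] by (metis le_zero_eq)
  qed
  then have "emeasure ?m ?V = 0"
    unfolding regular_borel_probD(5)[OF m openin_borel_algebra[OF V]]
    by (intro antisym SUP_least) auto
  then have "?V \<in> null_sets ?m"
    using regular_borel_probD(2)[OF m] openin_borel_algebra[OF V] by (intro null_setsI) auto
  then have "AE q in ?m. q \<notin> ?V" by (rule AE_not_in)
  moreover have "AE q in ?m. q \<in> space ?m" by (rule AE_space)
  ultimately show ?thesis
    by eventually_elim (use regular_borel_probD(3)[OF m] in auto)
qed

lemma continuous_map_type_space:
  assumes g: "\<And>q. q \<in> ctypes U x A \<Longrightarrow> g q \<in> ctypes U y B"
    and f: "\<And>\<phi>. \<phi> \<in> Lfm U y B \<Longrightarrow> f \<phi> \<in> Lfm U x A"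
    and gf: "\<And>\<phi> q. \<phi> \<in> Lfm U y B \<Longrightarrow> q \<in> ctypes U x A \<Longrightarrow> \<phi> \<in> g q \<longleftrightarrow> f \<phi> \<in> q"
  shows "continuous_map (type_space U x A) (type_space U y B) g"
  unfolding type_space_def[of U y B]
proof (rule continuous_on_generated_topo)
  fix C assume "C \<in> clopen U y B ` Lfm U y B"
  then obtain \<phi> where \<phi>: "\<phi> \<in> Lfm U y B" "C = clopen U y B \<phi>" by auto
  then have "g -` C \<inter> topspace (type_space U x A) = clopen U x A (f \<phi>)"
    using g gf by (auto simp: clopen_def)
  then show "openin (type_space U x A) (g -` C \<inter> topspace (type_space U x A))"
    using f[OF \<phi>(1)] by (simp add: openin_type_space_clopen)
next
  show "g ` topspace (type_space U x A) \<subseteq> \<Union>(clopen U y B ` Lfm U y B)"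
    using g topspace_type_space[of U y B, unfolded type_space_def topology_generated_by_topspace]
    by auto
qed

lemma continuous_restriction:
  assumes "B \<subseteq> A"
  shows "continuous_map (type_space U x A) (type_space U x B) (\<lambda>q. q \<inter> Lfm U x B)"
proof (rule continuous_map_type_space)
  show "q \<inter> Lfm U x B \<in> ctypes U x B" if "q \<in> ctypes U x A" for q
    using ctypes_restrict[OF that assms] .
  show "\<phi> \<in> Lfm U x A" if "\<phi> \<in> Lfm U x B" for \<phi> using that Lfm_mono[OF order_refl assms] by auto
qed auto

text \<open>The image measure is regular and has the prescribed values on clopen sets, which
  identifies it.\<close>

lemma borel_measure_of_restriction:
  assumes U: "is_structure U" and \<nu>: "\<nu> \<in> keisler U x C" and BA: "B \<subseteq> A" "A \<subseteq> C"
  shows "borel_measure_of U x B (restr U x \<nu> B) =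
    distr (borel_measure_of U x A (restr U x \<nu> A)) (borel_algebra (type_space U x B)) (\<lambda>q. q \<inter> Lfm U x B)"
proof (rule borel_measure_of_eqI)
  let ?m = "borel_measure_of U x A (restr U x \<nu> A)"
  let ?r = "\<lambda>q. q \<inter> Lfm U x B"
  note \<nu>A = restr_keisler[OF \<nu> BA(2)]
  note m = borel_measure_of(1)[OF U \<nu>A]
  note cont = continuous_restriction[OF BA(1), of U x]
  show "regular_borel_prob (type_space U x B) (distr ?m (borel_algebra (type_space U x B)) ?r)"
    by (rule regular_borel_prob_distr[OF compact_type_space compact_type_space Hausdorff_type_space cont m])
  have meas: "?r \<in> measurable ?m (borel_algebra (type_space U x B))"
    using continuous_map_borel_measurable[OF cont] regular_borel_probD(2)[OF m] measurable_cong_sets by blast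
  fix \<phi> assume \<phi>: "\<phi> \<in> Lfm U x B"
  then have \<phi>A: "\<phi> \<in> Lfm U x A" using Lfm_mono[OF order_refl BA(1)] by auto
  have "clopen U x B \<phi> \<in> sets (borel_algebra (type_space U x B))"
    using \<phi> by (simp add: openin_borel_algebra openin_type_space_clopen)
  then have "measure (distr ?m (borel_algebra (type_space U x B)) ?r) (clopen U x B \<phi>) =
      measure ?m (?r -` clopen U x B \<phi> \<inter> space ?m)" by (rule measure_distr[OF meas])
  also have "?r -` clopen U x B \<phi> \<inter> space ?m = clopen U x A \<phi>"
    using \<phi> ctypes_restrict[OF _ BA(1), of _ U x] by (auto simp: clopen_def regular_borel_probD(3)[OF m])
  also have "measure ?m (clopen U x A \<phi>) = restr U x \<nu> A \<phi>" by (rule borel_measure_of(2)[OF U \<nu>A \<phi>A])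
  also have "restr U x \<nu> A \<phi> = restr U x \<nu> B \<phi>" using \<phi> \<phi>A by (simp add: restr_def)
  finally show "measure (distr ?m (borel_algebra (type_space U x B)) ?r) (clopen U x B \<phi>) = restr U x \<nu> B \<phi>" .
qed

section \<open>Invariance and change of base\<close>

text \<open>Equality of types over \<open>A\<close> survives the addition of a tuple from \<open>A\<close>. Invariance over a
  set therefore passes to larger sets.\<close>

lemma tp_join_eq:
  assumes eq: "tp U z A b = tp U z A b'" and c: "c \<in> w \<rightarrow> A" and BA: "B \<subseteq> A" and zw: "z \<inter> w = {}"
  shows "tp U (z \<union> w) B (join z w b c) = tp U (z \<union> w) B (join z w b' c)"
proof -
  have "sat U (join z w b c) \<phi> = sat U (join z w b' c) \<phi>" if \<phi>: "\<phi> \<in> Lfm U (z \<union> w) B" for \<phi>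
  proof -
    have "inst w c \<phi> \<in> Lfm U z A" using \<phi> c BA by (intro Lfm_inst) auto
    then have "sat U b (inst w c \<phi>) = sat U b' (inst w c \<phi>)" using eq by (auto simp: tp_def)
    moreover have "fv \<phi> \<subseteq> z \<union> w" using \<phi> by (simp add: Lfm_def)
    ultimately show ?thesis by (simp add: sat_inst_join[OF _ zw])
  qed
  then show ?thesis by (auto simp: tp_def)
qed

lemma invariant_overD:
  assumes "invariant_over U x M \<mu>" "finite z" "x \<inter> z = {}" "\<phi> \<in> Lfm U (x \<union> z) M"
    "b \<in> tuples U z" "b' \<in> tuples U z" "tp U z M b = tp U z M b'"
  shows "\<mu> (inst z b \<phi>) = \<mu> (inst z b' \<phi>)"
  using assms unfolding invariant_over_def by blast

lemma invariant_over_mono: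
  assumes inv: "invariant_over U x M \<mu>" and MA: "M \<subseteq> A" "A \<subseteq> univ U" and x: "finite x"
  shows "invariant_over U x A \<mu>"
  unfolding invariant_over_def
proof (intro allI impI ballI)
  fix z \<phi> b b'
  assume "finite z \<and> x \<inter> z = {}" and \<phi>: "\<phi> \<in> Lfm U (x \<union> z) A"
    and b: "b \<in> tuples U z" "b' \<in> tuples U z" and tp: "tp U z A b = tp U z A b'"
  then have z: "finite z" "x \<inter> z = {}" by auto
  obtain w c \<phi>0 where w: "finite w" "w \<inter> (x \<union> z) = {}" and c: "c \<in> w \<rightarrow>\<^sub>E A"
    and \<phi>0: "\<phi>0 \<in> Lfm U (x \<union> z \<union> w) {}" and eq: "\<phi> = inst w c \<phi>0"
    using obtain_instance[OF \<phi>, of "x \<union> z"] x z by auto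
  have zw: "z \<inter> w = {}" using w by auto
  have ct: "c \<in> tuples U w" using c MA by (auto simp: tuples_def)
  show "\<mu> (inst z b \<phi>) = \<mu> (inst z b' \<phi>)"
    unfolding eq inst_inst_join[OF zw]
  proof (rule invariant_overD[OF inv])
    show "\<phi>0 \<in> Lfm U (x \<union> (z \<union> w)) M" using \<phi>0 Lfm_mono[of "x \<union> z \<union> w" "x \<union> (z \<union> w)" "{}" M U] by auto
    show "tp U (z \<union> w) M (join z w b c) = tp U (z \<union> w) M (join z w b' c)"
      using c MA by (intro tp_join_eq[OF tp _ _ zw]) auto
  qed (use z w b ct join_tuples in auto)
qed

lemma small_modelD: "small_model \<kappa> U N \<Longrightarrow> small \<kappa> N" "small_model \<kappa> U N \<Longrightarrow> N \<subseteq> univ U"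
  "small_model \<kappa> U N \<Longrightarrow> N \<noteq> {}"
  by (auto simp: small_model_def elem_sub_def is_structure_def)

lemma small_Un:
  assumes "monster_model \<kappa> T U" "small \<kappa> A" "small \<kappa> B" shows "small \<kappa> (A \<union> B)"
  using assms(2,3) card_of_Un_ordLess_infinite_Field[OF infinite_Field_monster monster_modelD(3)]
    assms(1) unfolding small_def by blast

lemma small_finite:
  assumes "monster_model \<kappa> T U" "finite A" shows "small \<kappa> A"
  unfolding small_def
  using finite_ordLess_infinite[OF card_of_Well_order card_order_on_well_order_on[OF monster_modelD(3)[OF assms(1)]]]
    infinite_Field_monster[OF assms(1)] assms(2) by (simp add: Field_card_of)

lemma realize_type:
  assumes "monster_model \<kappa> T U" "A \<subseteq> univ U" "small \<kappa> A" "finite x" "p \<in> ctypes U x A"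
  obtains a where "a \<in> tuples U x" "tp U x A a = p"
  using assms monster_modelD(2)[OF assms(1)] unfolding saturated_def by blast

lemma Fmap_realization:
  assumes "b \<in> tuples U z" "tp U z A b = q"
  obtains d where "d \<in> tuples U z" "tp U z A d = q" "Fmap U z A \<mu> \<phi> q = \<mu> (inst z d \<phi>)"
proof -
  have "\<exists>d. d \<in> tuples U z \<and> tp U z A d = q" using assms by auto
  from someI_ex[OF this] show thesis by (intro that) (auto simp: Fmap_def)
qed

text \<open>The map \<open>tp(b/A) \<mapsto> tp(bc/B)\<close> from \<open>S\<^sub>z(A)\<close> to \<open>S\<^sub>z\<^sub>w(B)\<close>, for a tuple \<open>c\<close> from \<open>A\<close> and
  \<open>B \<subseteq> A\<close>, written without reference to a realization.\<close>

definition inst_type ::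
  "('f, 'r, 'a) struct \<Rightarrow> nat set \<Rightarrow> 'a set \<Rightarrow> nat set \<Rightarrow> (nat \<Rightarrow> 'a) \<Rightarrow> ('f, 'r, 'a) fm set \<Rightarrow> ('f, 'r, 'a) fm set"
  where "inst_type U y B w c q = {\<phi> \<in> Lfm U y B. inst w c \<phi> \<in> q}"

lemma inst_type_tp:
  assumes c: "c \<in> w \<rightarrow> A" and BA: "B \<subseteq> A" and zw: "z \<inter> w = {}"
  shows "inst_type U (z \<union> w) B w c (tp U z A b) = tp U (z \<union> w) B (join z w b c)"
proof -
  have "inst w c \<phi> \<in> tp U z A b \<longleftrightarrow> sat U (join z w b c) \<phi>" if "\<phi> \<in> Lfm U (z \<union> w) B" for \<phi>
  proof -
    have "inst w c \<phi> \<in> Lfm U z A" using that c BA by (intro Lfm_inst) auto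
    moreover have "fv \<phi> \<subseteq> z \<union> w" using that by (simp add: Lfm_def)
    ultimately show ?thesis by (simp add: tp_def sat_inst_join[OF _ zw])
  qed
  then show ?thesis by (auto simp: inst_type_def tp_def)
qed

lemma continuous_inst_type:
  assumes c: "c \<in> w \<rightarrow> A" and BA: "B \<subseteq> A" "A \<subseteq> univ U" and zw: "z \<inter> w = {}" "finite w"
  shows "continuous_map (type_space U z A) (type_space U (z \<union> w) B) (inst_type U (z \<union> w) B w c)"
proof (rule continuous_map_type_space)
  show L: "inst w c \<phi> \<in> Lfm U z A" if "\<phi> \<in> Lfm U (z \<union> w) B" for \<phi>
    using that c BA by (intro Lfm_inst) auto
  show "\<phi> \<in> inst_type U (z \<union> w) B w c q \<longleftrightarrow> inst w c \<phi> \<in> q" if "\<phi> \<in> Lfm U (z \<union> w) B" for \<phi> q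
    using that by (simp add: inst_type_def)
  fix q assume q: "q \<in> ctypes U z A"
  have ct: "restrict c w \<in> tuples U w" using c BA by (auto simp: tuples_def)
  show "inst_type U (z \<union> w) B w c q \<in> ctypes U (z \<union> w) B"
    unfolding ctypes_iff fin_sat_def
  proof (intro conjI allI impI ballI)
    show "inst_type U (z \<union> w) B w c q \<subseteq> Lfm U (z \<union> w) B" by (auto simp: inst_type_def)
    fix \<Phi> assume \<Phi>: "finite \<Phi> \<and> \<Phi> \<subseteq> inst_type U (z \<union> w) B w c q"
    then have "finite (inst w c ` \<Phi>)" "inst w c ` \<Phi> \<subseteq> q" by (auto simp: inst_type_def)
    from fin_satD[OF ctypesD(2)[OF q] this]
    obtain a where a: "a \<in> tuples U z" "\<forall>\<phi>\<in>\<Phi>. sat U a (inst w c \<phi>)" by auto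
    have "sat U (join z w a (restrict c w)) \<phi>" if "\<phi> \<in> \<Phi>" for \<phi>
    proof -
      have "fv \<phi> \<subseteq> z \<union> w" using that \<Phi> by (auto simp: inst_type_def Lfm_def)
      moreover have "inst w (restrict c w) \<phi> = inst w c \<phi>" by (rule inst_cong) simp
      ultimately show ?thesis using sat_inst_join[OF _ zw(1), of \<phi> U a "restrict c w"] a that by simp
    qed
    then show "\<exists>a\<in>tuples U (z \<union> w). \<forall>\<phi>\<in>\<Phi>. sat U a \<phi>" using join_tuples[OF a(1) ct] by blast
  next
    fix \<phi> assume \<phi>: "\<phi> \<in> Lfm U (z \<union> w) B"
    then show "\<phi> \<in> inst_type U (z \<union> w) B w c q \<or> Neg \<phi> \<in> inst_type U (z \<union> w) B w c q"
      using ctypesD(3)[OF q L[OF \<phi>]] by (simp add: inst_type_def)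
  qed
qed

text \<open>A formula over \<open>N\<close> is \<open>\<phi>(x, z, c)\<close> for some \<open>\<phi>\<close> over \<open>M\<close> and \<open>c\<close> in \<open>N\<close>. Its fibre
  function on \<open>S\<^sub>z(N)\<close> is the fibre function of \<open>\<phi>\<close> on \<open>S\<^sub>z\<^sub>w(M)\<close> composed with the continuous
  map \<open>tp(b/N) \<mapsto> tp(bc/M)\<close>.\<close>

lemma borel_definable_over_mono:
  assumes mon: "monster_model \<kappa> T U" and x: "finite x"
    and def: "borel_definable_over \<kappa> U x M \<mu>" and N: "small_model \<kappa> U N" "M \<subseteq> N"
  shows "borel_definable_over \<kappa> U x N \<mu>"
proof -
  note NU = small_modelD(1,2)[OF N(1)]
  have M: "small_model \<kappa> U M" and inv: "invariant_over U x M \<mu>" using def by (auto simp: borel_definable_over_def)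
  have "Fmap U z N \<mu> \<phi> \<in> borel_measurable (borel_algebra (type_space U z N))"
    if z: "finite z" "x \<inter> z = {}" and \<phi>: "\<phi> \<in> Lfm U (x \<union> z) N" for z \<phi>
  proof -
    obtain w c \<phi>0 where w: "finite w" "w \<inter> (x \<union> z) = {}" and c: "c \<in> w \<rightarrow>\<^sub>E N"
      and \<phi>0: "\<phi>0 \<in> Lfm U (x \<union> z \<union> w) {}" and eq: "\<phi> = inst w c \<phi>0"
      using obtain_instance[OF \<phi>, of "x \<union> z"] x z by auto
    have zw: "z \<inter> w = {}" and cN: "c \<in> w \<rightarrow> N" using w c by auto
    have ct: "c \<in> tuples U w" using c NU by (auto simp: tuples_def)
    have \<phi>0': "\<phi>0 \<in> Lfm U (x \<union> (z \<union> w)) M"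
      using \<phi>0 Lfm_mono[of "x \<union> z \<union> w" "x \<union> (z \<union> w)" "{}" M U] by auto
    have zw': "finite (z \<union> w)" "x \<inter> (z \<union> w) = {}" using z w by auto
    let ?g = "inst_type U (z \<union> w) M w c"
    have g: "?g \<in> measurable (borel_algebra (type_space U z N)) (borel_algebra (type_space U (z \<union> w) M))"
      using cN N NU zw w by (intro continuous_map_borel_measurable continuous_inst_type) auto
    have F: "Fmap U (z \<union> w) M \<mu> \<phi>0 \<in> borel_measurable (borel_algebra (type_space U (z \<union> w) M))"
      using def zw' \<phi>0' unfolding borel_definable_over_def by blast
    have "Fmap U z N \<mu> \<phi> q = Fmap U (z \<union> w) M \<mu> \<phi>0 (?g q)" if "q \<in> ctypes U z N" for q
    proof -
      obtain b0 where "b0 \<in> tuples U z" "tp U z N b0 = q"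
        using realize_type[OF mon NU(2,1) z(1) \<open>q \<in> ctypes U z N\<close>] .
      then obtain b where b: "b \<in> tuples U z" "tp U z N b = q" "Fmap U z N \<mu> \<phi> q = \<mu> (inst z b \<phi>)"
        by (rule Fmap_realization)
      have gq: "tp U (z \<union> w) M (join z w b c) = ?g q"
        using inst_type_tp[OF cN N(2) zw, of U b] b(2) by simp
      have jt: "join z w b c \<in> tuples U (z \<union> w)" by (rule join_tuples[OF b(1) ct])
      from jt gq obtain d where d: "d \<in> tuples U (z \<union> w)" "tp U (z \<union> w) M d = ?g q"
        "Fmap U (z \<union> w) M \<mu> \<phi>0 (?g q) = \<mu> (inst (z \<union> w) d \<phi>0)" by (rule Fmap_realization)
      have "\<mu> (inst (z \<union> w) (join z w b c) \<phi>0) = \<mu> (inst (z \<union> w) d \<phi>0)"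
        using gq d by (intro invariant_overD[OF inv zw' \<phi>0' jt]) auto
      then show ?thesis using b(3) d(3) by (simp add: eq inst_inst_join[OF zw])
    qed
    then have "Fmap U z N \<mu> \<phi> \<in> borel_measurable (borel_algebra (type_space U z N)) \<longleftrightarrow>
        (\<lambda>q. Fmap U (z \<union> w) M \<mu> \<phi>0 (?g q)) \<in> borel_measurable (borel_algebra (type_space U z N))"
      by (intro measurable_cong) simp
    also have "\<dots>" using measurable_compose[OF g F] .
    finally show ?thesis .
  qed
  then show ?thesis
    unfolding borel_definable_over_def
    using N(1) invariant_over_mono[OF inv N(2) NU(2) x] by blast
qed

section \<open>The extended integral\<close>

lemma supp_restriction:
  assumes "q \<in> supp U y A (restr U y \<nu> A)" "N \<subseteq> A"
  shows "q \<inter> Lfm U y N \<in> supp U y N (restr U y \<nu> N)"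
proof -
  have q: "q \<in> ctypes U y A" using assms by (simp add: supp_def)
  have "0 < restr U y \<nu> N \<phi>" if "\<phi> \<in> q \<inter> Lfm U y N" for \<phi>
  proof -
    have "\<phi> \<in> Lfm U y A" using that ctypesD(1)[OF q] by auto
    moreover have "0 < restr U y \<nu> A \<phi>" using that assms(1) by (auto simp: supp_def)
    ultimately show ?thesis using that by (simp add: restr_def)
  qed
  then show ?thesis using ctypes_restrict[OF q assms(2)] by (simp add: supp_def)
qed

lemma supp_in_borel:
  assumes "\<nu> \<in> keisler U y (univ U)" "A \<subseteq> univ U"
  shows "supp U y A (restr U y \<nu> A) \<in> sets (borel_algebra (type_space U y A))"
  by (rule closedin_borel_algebra[OF closedin_supp[OF restr_keisler[OF assms]]])

text \<open>The support is a Borel set, so Borel functions on it are those whose extension by \<open>0\<close> is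
  Borel. This form is convenient since integrals over the whole space of types can be compared
  by image measures.\<close>

lemma borel_measurable_on_supp_iff:
  assumes "\<nu> \<in> keisler U y (univ U)" "A \<subseteq> univ U"
  shows "f \<in> borel_measurable (borel_algebra (subtopology (type_space U y A) (supp U y A (restr U y \<nu> A))))
    \<longleftrightarrow> (\<lambda>q. indicator (supp U y A (restr U y \<nu> A)) q * f q :: real)
      \<in> borel_measurable (borel_algebra (type_space U y A))"
proof -
  let ?S = "supp U y A (restr U y \<nu> A)" and ?X = "type_space U y A"
  note S = supp_in_borel[OF assms]
  have "f \<in> borel_measurable (borel_algebra (subtopology ?X ?S))
      \<longleftrightarrow> f \<in> borel_measurable (restrict_space (borel_algebra ?X) ?S)"
    using measurable_cong_sets[OF sets_borel_algebra_subtopology[OF S] refl] by auto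
  also have "\<dots> \<longleftrightarrow> (\<lambda>q. indicator ?S q *\<^sub>R f q) \<in> borel_measurable (borel_algebra ?X)"
    using S sets.top[of "borel_algebra ?X"] by (intro borel_measurable_restrict_space_iff sets.Int)
  finally show ?thesis by simp
qed

lemma ext_integral_indicator:
  assumes U: "is_structure U" and \<nu>: "\<nu> \<in> keisler U y (univ U)" and A: "A \<subseteq> univ U"
  shows "ext_integral U y \<mu> \<nu> \<phi> A = (\<integral>q. indicator (supp U y A (restr U y \<nu> A)) q * Fmap U y A \<mu> \<phi> q
      \<partial>borel_measure_of U y A (restr U y \<nu> A))"
proof -
  let ?m = "borel_measure_of U y A (restr U y \<nu> A)" and ?S = "supp U y A (restr U y \<nu> A)"
  have sets: "sets ?m = sets (borel_algebra (type_space U y A))"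
    using borel_measure_of(1)[OF U restr_keisler[OF \<nu> A]] by (rule regular_borel_probD)
  have "?S \<inter> space ?m \<in> sets ?m" using supp_in_borel[OF \<nu> A] unfolding sets[symmetric] by auto
  from integral_restrict_space[OF this, of "Fmap U y A \<mu> \<phi>"] show ?thesis
    by (simp add: ext_integral_def)
qed

lemma borel_witnessD:
  assumes "borel_witness \<kappa> U x y \<mu> \<nu> \<phi> N"
  shows "small_model \<kappa> U N" "fm_pars \<phi> \<subseteq> N"
    and "q \<in> supp U y N (restr U y \<nu> N) \<Longrightarrow> d \<in> tuples U y \<Longrightarrow> d' \<in> tuples U y \<Longrightarrow>
      tp U y N d = q \<Longrightarrow> tp U y N d' = q \<Longrightarrow> \<mu> (inst y d \<phi>) = \<mu> (inst y d' \<phi>)"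
    and "Fmap U y N \<mu> \<phi> \<in> borel_measurable
      (borel_algebra (subtopology (type_space U y N) (supp U y N (restr U y \<nu> N))))"
  using assms unfolding borel_witness_def by blast+

lemma Fmap_restriction:
  assumes w: "borel_witness \<kappa> U x y \<mu> \<nu> \<phi> N" and NA: "N \<subseteq> A"
    and q: "q \<in> supp U y A (restr U y \<nu> A)" and d: "d \<in> tuples U y" "tp U y A d = q"
  shows "Fmap U y N \<mu> \<phi> (q \<inter> Lfm U y N) = \<mu> (inst y d \<phi>)"
proof -
  have dN: "tp U y N d = q \<inter> Lfm U y N" using d(2) tp_subset[OF NA] by auto
  from d(1) this obtain e where e: "e \<in> tuples U y" "tp U y N e = q \<inter> Lfm U y N"
    "Fmap U y N \<mu> \<phi> (q \<inter> Lfm U y N) = \<mu> (inst y e \<phi>)" by (rule Fmap_realization)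
  then show ?thesis
    using borel_witnessD(3)[OF w supp_restriction[OF q NA] e(1) d(1) e(2) dN] by simp
qed

text \<open>Almost every type over \<open>A\<close> lies in the support, and there the fibre function over \<open>A\<close> is
  the fibre function over \<open>N\<close> of the restricted type. So it inherits measurability, and the
  integrals agree by transport along the restriction of types.\<close>

lemma ext_integral_larger:
  assumes mon: "monster_model \<kappa> T U" and y: "finite y" and \<nu>: "\<nu> \<in> keisler U y (univ U)"
    and w: "borel_witness \<kappa> U x y \<mu> \<nu> \<phi> N" and A: "N \<subseteq> A" "A \<subseteq> univ U" "small \<kappa> A"
  shows "ext_integral U y \<mu> \<nu> \<phi> N = ext_integral U y \<mu> \<nu> \<phi> A"
proof -
  note U = monster_modelD(1)[OF mon]
  note NU = small_modelD(2)[OF borel_witnessD(1)[OF w]]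
  let ?m = "borel_measure_of U y A (restr U y \<nu> A)" and ?S = "\<lambda>A. supp U y A (restr U y \<nu> A)"
  let ?r = "\<lambda>q. q \<inter> Lfm U y N" and ?X = "\<lambda>A. type_space U y A"
  note m = borel_measure_of(1)[OF U restr_keisler[OF \<nu> A(2)]]
  have sm: "sets ?m = sets (borel_algebra (?X A))" using m by (rule regular_borel_probD)
  define G where "G = (\<lambda>q. indicator (?S N) q * Fmap U y N \<mu> \<phi> q)"
  have G: "G \<in> borel_measurable (borel_algebra (?X N))"
    unfolding G_def using borel_witnessD(4)[OF w] by (simp add: borel_measurable_on_supp_iff[OF \<nu> NU])
  have r: "?r \<in> measurable ?m (borel_algebra (?X N))"
    using continuous_map_borel_measurable[OF continuous_restriction[OF A(1)]] sm measurable_cong_sets by blast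
  have Gr: "(\<lambda>q. G (?r q)) \<in> borel_measurable ?m" by (rule measurable_compose[OF r G])
  have Sm: "?S A \<in> sets ?m" using supp_in_borel[OF \<nu> A(2)] sm by simp
  have eq: "indicator (?S A) q * Fmap U y A \<mu> \<phi> q = indicator (?S A) q * G (?r q)" for q
  proof (cases "q \<in> ?S A")
    case True
    then have "q \<in> ctypes U y A" by (simp add: supp_def)
    then obtain d0 where "d0 \<in> tuples U y" "tp U y A d0 = q" by (rule realize_type[OF mon A(2,3) y])
    then obtain d where d: "d \<in> tuples U y" "tp U y A d = q" "Fmap U y A \<mu> \<phi> q = \<mu> (inst y d \<phi>)"
      by (rule Fmap_realization)
    then show ?thesis
      using Fmap_restriction[OF w A(1) True d(1,2)] supp_restriction[OF True A(1)] by (simp add: G_def)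
  qed simp
  have "ext_integral U y \<mu> \<nu> \<phi> N = (\<integral>q. G q \<partial>distr ?m (borel_algebra (?X N)) ?r)"
    unfolding ext_integral_indicator[OF U \<nu> NU] borel_measure_of_restriction[OF U \<nu> A(1,2)] G_def ..
  also have "\<dots> = (\<integral>q. G (?r q) \<partial>?m)" by (rule integral_distr[OF r G])
  also have "\<dots> = (\<integral>q. indicator (?S A) q * G (?r q) \<partial>?m)"
  proof (rule integral_cong_AE)
    show "(\<lambda>q. indicator (?S A) q * G (?r q)) \<in> borel_measurable ?m"
      using Sm Gr by (intro borel_measurable_times) auto
    show "AE q in ?m. G (?r q) = indicator (?S A) q * G (?r q)"
      using AE_supp[OF U restr_keisler[OF \<nu> A(2)]] by eventually_elim simp
  qed (rule Gr)
  also have "\<dots> = ext_integral U y \<mu> \<nu> \<phi> A"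
    unfolding ext_integral_indicator[OF U \<nu> A(2)] by (simp add: eq)
  finally show ?thesis .
qed

lemma ext_integral_unique:
  assumes mon: "monster_model \<kappa> T U" and y: "finite y" and \<nu>: "\<nu> \<in> keisler U y (univ U)"
    and w: "borel_witness \<kappa> U x y \<mu> \<nu> \<phi> N" "borel_witness \<kappa> U x y \<mu> \<nu> \<phi> N'"
  shows "ext_integral U y \<mu> \<nu> \<phi> N = ext_integral U y \<mu> \<nu> \<phi> N'"
proof -
  have N: "N \<union> N' \<subseteq> univ U" "small \<kappa> (N \<union> N')"
    using small_modelD[OF borel_witnessD(1)[OF w(1)]] small_modelD[OF borel_witnessD(1)[OF w(2)]]
      small_Un[OF mon] by auto
  show ?thesis
    using ext_integral_larger[OF mon y \<nu> w(1) _ N] ext_integral_larger[OF mon y \<nu> w(2) _ N] by simp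
qed

lemma ext_product_eq:
  assumes mon: "monster_model \<kappa> T U" and y: "finite y" and \<nu>: "\<nu> \<in> keisler U y (univ U)"
    and \<phi>: "\<phi> \<in> Lfm U (x \<union> y) (univ U)" and w: "borel_witness \<kappa> U x y \<mu> \<nu> \<phi> N"
  shows "ext_product \<kappa> U x y \<mu> \<nu> \<phi> = ext_integral U y \<mu> \<nu> \<phi> N"
proof -
  have "borel_witness \<kappa> U x y \<mu> \<nu> \<phi> (SOME N. borel_witness \<kappa> U x y \<mu> \<nu> \<phi> N)"
    using w by (rule someI)
  from ext_integral_unique[OF mon y \<nu> this w] show ?thesis using \<phi> by (simp add: ext_product_def)
qed

section \<open>Borel-definable measures\<close>

lemma small_model_over:
  assumes mon: "monster_model \<kappa> T U" and M: "small_model \<kappa> U M" and \<phi>: "\<phi> \<in> Lfm U z (univ U)"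
  obtains N where "small_model \<kappa> U N" "M \<subseteq> N" "fm_pars \<phi> \<subseteq> N"
proof -
  have "M \<union> fm_pars \<phi> \<subseteq> univ U" using small_modelD(2)[OF M] \<phi> by (auto simp: Lfm_def)
  moreover have "small \<kappa> (M \<union> fm_pars \<phi>)"
    using small_Un[OF mon small_modelD(1)[OF M] small_finite[OF mon finite_fm_pars]] .
  ultimately show thesis using small_model_exists[OF mon, of "M \<union> fm_pars \<phi>"] that by auto
qed

lemma borel_definable_witness:
  assumes y: "finite y" "x \<inter> y = {}" and \<nu>: "\<nu> \<in> keisler U y (univ U)"
    and def: "borel_definable_over \<kappa> U x N \<mu>" and \<phi>: "\<phi> \<in> Lfm U (x \<union> y) (univ U)" "fm_pars \<phi> \<subseteq> N"
  shows "borel_witness \<kappa> U x y \<mu> \<nu> \<phi> N"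
proof -
  have N: "small_model \<kappa> U N" and inv: "invariant_over U x N \<mu>"
    using def by (auto simp: borel_definable_over_def)
  note NU = small_modelD(2)[OF N]
  have \<phi>N: "\<phi> \<in> Lfm U (x \<union> y) N" using \<phi> by (simp add: Lfm_def)
  have F: "Fmap U y N \<mu> \<phi> \<in> borel_measurable (borel_algebra (type_space U y N))"
    using def y \<phi>N unfolding borel_definable_over_def by blast
  have "(\<lambda>q. indicator (supp U y N (restr U y \<nu> N)) q * Fmap U y N \<mu> \<phi> q)
      \<in> borel_measurable (borel_algebra (type_space U y N))"
    using F supp_in_borel[OF \<nu> NU] by (intro borel_measurable_times) auto
  then show ?thesis
    unfolding borel_witness_def borel_measurable_on_supp_iff[OF \<nu> NU]
    using N \<phi>(2) invariant_overD[OF inv y \<phi>N] by blast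
qed

lemma borel_definable_ext_integral:
  assumes U: "is_structure U" and y: "finite y" "x \<inter> y = {}" and \<nu>: "\<nu> \<in> keisler U y (univ U)"
    and def: "borel_definable_over \<kappa> U x N \<mu>" and \<phi>: "\<phi> \<in> Lfm U (x \<union> y) N"
  shows "ext_integral U y \<mu> \<nu> \<phi> N = integral\<^sup>L (borel_measure_of U y N (restr U y \<nu> N)) (Fmap U y N \<mu> \<phi>)"
proof -
  let ?m = "borel_measure_of U y N (restr U y \<nu> N)" and ?S = "supp U y N (restr U y \<nu> N)"
  have N: "N \<subseteq> univ U" using def by (auto simp: borel_definable_over_def dest: small_modelD)
  note \<nu>N = restr_keisler[OF \<nu> N]
  have sm: "sets ?m = sets (borel_algebra (type_space U y N))"
    using borel_measure_of(1)[OF U \<nu>N] by (rule regular_borel_probD)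
  have "Fmap U y N \<mu> \<phi> \<in> borel_measurable (borel_algebra (type_space U y N))"
    using def y \<phi> unfolding borel_definable_over_def by blast
  then have F: "Fmap U y N \<mu> \<phi> \<in> borel_measurable ?m" using measurable_cong_sets[OF sm refl] by blast
  show ?thesis
    unfolding ext_integral_indicator[OF U \<nu> N]
  proof (rule integral_cong_AE)
    have "?S \<in> sets ?m" using supp_in_borel[OF \<nu> N] sm by simp
    then show "(\<lambda>q. indicator ?S q * Fmap U y N \<mu> \<phi> q) \<in> borel_measurable ?m"
      using F by (intro borel_measurable_times) auto
    show "AE q in ?m. indicator ?S q * Fmap U y N \<mu> \<phi> q = Fmap U y N \<mu> \<phi> q"
      using AE_supp[OF U \<nu>N] by eventually_elim simp
  qed (rule F)
qed

text \<open>A model over which \<open>\<mu>\<close> is Borel-definable and which contains the parameters of the formula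
  is a witness for the extended product; there the two integrals agree since the support has
  full measure.\<close>

theorem std_product_eq_ext_product:
  assumes mon: "monster_model \<kappa> T U" and x: "finite x" and y: "finite y" "x \<inter> y = {}"
    and \<nu>: "\<nu> \<in> keisler U y (univ U)" and def: "borel_definable \<kappa> U x \<mu>"
  shows "borel_pair \<kappa> U x y \<mu> \<nu>" and "std_product \<kappa> U x y \<mu> \<nu> = ext_product \<kappa> U x y \<mu> \<nu>"
proof -
  obtain M where M: "borel_definable_over \<kappa> U x M \<mu>" using def by (auto simp: borel_definable_def)
  have ex: "\<exists>N. borel_definable_over \<kappa> U x N \<mu> \<and> fm_pars \<phi> \<subseteq> N" if \<phi>: "\<phi> \<in> Lfm U (x \<union> y) (univ U)" for \<phi>
  proof -
    have "small_model \<kappa> U M" using M by (simp add: borel_definable_over_def)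
    from small_model_over[OF mon this \<phi>] obtain N where "small_model \<kappa> U N" "M \<subseteq> N" "fm_pars \<phi> \<subseteq> N" .
    then show ?thesis using borel_definable_over_mono[OF mon x M] by blast
  qed
  show "borel_pair \<kappa> U x y \<mu> \<nu>"
    unfolding borel_pair_def borel_triple_def
    using ex borel_definable_witness[OF y \<nu>] by blast
  have "std_product \<kappa> U x y \<mu> \<nu> \<phi> = ext_product \<kappa> U x y \<mu> \<nu> \<phi>" for \<phi>
  proof (cases "\<phi> \<in> Lfm U (x \<union> y) (univ U)")
    case True
    let ?N = "SOME N. borel_definable_over \<kappa> U x N \<mu> \<and> fm_pars \<phi> \<subseteq> N"
    have N: "borel_definable_over \<kappa> U x ?N \<mu>" "fm_pars \<phi> \<subseteq> ?N" using someI_ex[OF ex[OF True]] by auto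
    have "\<phi> \<in> Lfm U (x \<union> y) ?N" using True N(2) by (simp add: Lfm_def)
    then show ?thesis
      using ext_product_eq[OF mon y(1) \<nu> True borel_definable_witness[OF y \<nu> N(1) True N(2)]]
        borel_definable_ext_integral[OF monster_modelD(1)[OF mon] y \<nu> N(1)] True
      by (simp add: std_product_def Let_def)
  next
    case False
    then show ?thesis by (simp add: std_product_def ext_product_def)
  qed
  then show "std_product \<kappa> U x y \<mu> \<nu> = ext_product \<kappa> U x y \<mu> \<nu>" by blast
qed

section \<open>Products with a Dirac measure\<close>

lemma dirac_apply: "\<phi> \<in> Lfm U x (univ U) \<Longrightarrow> dirac U x p \<phi> = (if \<phi> \<in> p then 1 else 0)"
  by (simp add: dirac_def)

lemma dirac_keisler:
  assumes p: "p \<in> ctypes U x (univ U)"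
  shows "dirac U x p \<in> keisler U x (univ U)"
  unfolding keisler_def mem_Collect_eq
proof (intro conjI ballI impI)
  show "dirac U x p \<in> extensional (Lfm U x (univ U))" by (simp add: dirac_def)
  fix \<phi> assume \<phi>: "\<phi> \<in> Lfm U x (univ U)"
  show "0 \<le> dirac U x p \<phi>" by (simp add: dirac_apply[OF \<phi>])
  show "dirac U x p \<phi> = 1" if "defset U x \<phi> = tuples U x"
  proof -
    have "\<phi> \<in> p"
      by (rule ctypes_consequence[OF p, of "{}"]) (use that \<phi> in \<open>auto simp: defset_def\<close>)
    then show ?thesis by (simp add: dirac_apply[OF \<phi>])
  qed
  fix \<psi> assume \<psi>: "\<psi> \<in> Lfm U x (univ U)"
  show "dirac U x p \<phi> = dirac U x p \<psi>" if "defset U x \<phi> = defset U x \<psi>"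
  proof -
    have "clopen U x (univ U) \<phi> = clopen U x (univ U) \<psi>" using clopen_eq_iff[OF \<phi> \<psi>] that by simp
    then have "\<phi> \<in> p \<longleftrightarrow> \<psi> \<in> p" using p unfolding clopen_def by blast
    then show ?thesis by (simp add: dirac_apply[OF \<phi>] dirac_apply[OF \<psi>])
  qed
  have D: "Disj \<phi> \<psi> \<in> Lfm U x (univ U)" using \<phi> \<psi> by simp
  show "dirac U x p (Disj \<phi> \<psi>) = dirac U x p \<phi> + dirac U x p \<psi>" if "defset U x \<phi> \<inter> defset U x \<psi> = {}"
  proof -
    have "\<not> (\<phi> \<in> p \<and> \<psi> \<in> p)"
      using fin_satD[OF ctypesD(2)[OF p], of "{\<phi>, \<psi>}"] that by (auto simp: defset_def)
    then show ?thesis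
      by (auto simp: dirac_apply[OF \<phi>] dirac_apply[OF \<psi>] dirac_apply[OF D] ctypes_Disj[OF p \<phi> \<psi>])
  qed
qed

text \<open>A type in the support contains only formulas of \<open>q\<close>, and complete types are maximal.\<close>

lemma supp_dirac:
  assumes q: "q \<in> ctypes U y (univ U)" and A: "A \<subseteq> univ U"
  shows "supp U y A (restr U y (dirac U y q) A) = {q \<inter> Lfm U y A}"
proof -
  have pos: "0 < restr U y (dirac U y q) A \<phi> \<longleftrightarrow> \<phi> \<in> q" if "\<phi> \<in> Lfm U y A" for \<phi>
  proof -
    have "\<phi> \<in> Lfm U y (univ U)" using that Lfm_mono[OF order_refl A] by auto
    then show ?thesis using that by (simp add: restr_def dirac_apply)
  qed
  have qA: "q \<inter> Lfm U y A \<in> ctypes U y A" by (rule ctypes_restrict[OF q A])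
  have "p = q \<inter> Lfm U y A" if "p \<in> supp U y A (restr U y (dirac U y q) A)" for p
  proof (rule ctypes_eqI[OF _ qA])
    show p: "p \<in> ctypes U y A" using that by (simp add: supp_def)
    show "p \<subseteq> q \<inter> Lfm U y A"
    proof
      fix \<phi> assume "\<phi> \<in> p"
      moreover from this have "\<phi> \<in> Lfm U y A" using ctypesD(1)[OF p] by auto
      ultimately show "\<phi> \<in> q \<inter> Lfm U y A" using that pos by (auto simp: supp_def)
    qed
  qed
  moreover have "q \<inter> Lfm U y A \<in> supp U y A (restr U y (dirac U y q) A)"
    using qA pos by (simp add: supp_def)
  ultimately show ?thesis by blast
qed

lemma ext_integral_dirac:
  assumes U: "is_structure U" and q: "q \<in> ctypes U y (univ U)" and A: "A \<subseteq> univ U"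
  shows "ext_integral U y \<mu> (dirac U y q) \<phi> A = Fmap U y A \<mu> \<phi> (q \<inter> Lfm U y A)"
proof -
  let ?m = "borel_measure_of U y A (restr U y (dirac U y q) A)" and ?q = "q \<inter> Lfm U y A"
  note \<nu> = dirac_keisler[OF q]
  note m = borel_measure_of(1)[OF U restr_keisler[OF \<nu> A]]
  interpret prob_space ?m using m by (rule regular_borel_probD)
  have S: "{?q} \<in> sets ?m" using supp_in_borel[OF \<nu> A] regular_borel_probD(2)[OF m] supp_dirac[OF q A] by simp
  have "ext_integral U y \<mu> (dirac U y q) \<phi> A = (\<integral>t. indicator {?q} t * Fmap U y A \<mu> \<phi> t \<partial>?m)"
    unfolding ext_integral_indicator[OF U \<nu> A] supp_dirac[OF q A] ..
  also have "(\<lambda>t. indicator {?q} t * Fmap U y A \<mu> \<phi> t) = (\<lambda>t. indicator {?q} t * Fmap U y A \<mu> \<phi> ?q)"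
    by (auto simp: indicator_def)
  also have "(\<integral>t. indicator {?q} t * Fmap U y A \<mu> \<phi> ?q \<partial>?m) = (\<integral>t. Fmap U y A \<mu> \<phi> ?q \<partial>?m)"
  proof (rule integral_cong_AE)
    show "(\<lambda>t. indicator {?q} t * Fmap U y A \<mu> \<phi> ?q) \<in> borel_measurable ?m"
      using S by (intro borel_measurable_times) auto
    show "AE t in ?m. indicator {?q} t * Fmap U y A \<mu> \<phi> ?q = Fmap U y A \<mu> \<phi> ?q"
      using AE_supp[OF U restr_keisler[OF \<nu> A]] unfolding supp_dirac[OF q A] by eventually_elim simp
  qed simp
  also have "\<dots> = Fmap U y A \<mu> \<phi> ?q" by (simp add: prob_space)
  finally show ?thesis .
qed

lemma dirac_witness:
  assumes x: "finite x" and y: "finite y" "x \<inter> y = {}" and q: "q \<in> ctypes U y (univ U)"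
    and inv: "invariant_over U x M \<mu>" and N: "small_model \<kappa> U N" "M \<subseteq> N"
    and \<phi>: "\<phi> \<in> Lfm U (x \<union> y) (univ U)" "fm_pars \<phi> \<subseteq> N"
  shows "borel_witness \<kappa> U x y \<mu> (dirac U y q) \<phi> N"
proof -
  note NU = small_modelD(2)[OF N(1)]
  note \<nu> = dirac_keisler[OF q]
  let ?q = "q \<inter> Lfm U y N"
  have "(\<lambda>t. indicator {?q} t * Fmap U y N \<mu> \<phi> t) = (\<lambda>t. indicator {?q} t * Fmap U y N \<mu> \<phi> ?q)"
    by (auto simp: indicator_def)
  moreover have "(\<lambda>t. indicator {?q} t * Fmap U y N \<mu> \<phi> ?q) \<in> borel_measurable (borel_algebra (type_space U y N))"
    using supp_in_borel[OF \<nu> NU] unfolding supp_dirac[OF q NU]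
    by (intro borel_measurable_times) auto
  ultimately have "Fmap U y N \<mu> \<phi> \<in> borel_measurable
      (borel_algebra (subtopology (type_space U y N) (supp U y N (restr U y (dirac U y q) N))))"
    unfolding borel_measurable_on_supp_iff[OF \<nu> NU] unfolding supp_dirac[OF q NU] by simp
  moreover have "\<phi> \<in> Lfm U (x \<union> y) N" using \<phi> by (simp add: Lfm_def)
  ultimately show ?thesis
    using N(1) \<phi>(2) invariant_overD[OF invariant_over_mono[OF inv N(2) NU x] y]
    unfolding borel_witness_def by blast
qed

lemma realize_restriction:
  assumes mon: "monster_model \<kappa> T U" and y: "finite y" and q: "q \<in> ctypes U y (univ U)"
    and A: "A \<subseteq> univ U" "small \<kappa> A"
  obtains d where "d \<in> tuples U y" "tp U y A d = q \<inter> Lfm U y A"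
  using realize_type[OF mon A y ctypes_restrict[OF q A(1)]] .

text \<open>Over the base of invariance and the parameters of \<open>\<phi>\<close>, the tuple \<open>d\<close> has the same type as
  a realization over a witness of the product. Leaving \<open>A\<close> free allows a common \<open>d\<close> for several
  formulas and makes the value comparable with \<open>p \<otimes> q\<close>.\<close>

lemma ext_product_dirac:
  assumes mon: "monster_model \<kappa> T U" and x: "finite x" and y: "finite y" "x \<inter> y = {}"
    and q: "q \<in> ctypes U y (univ U)" and M: "small_model \<kappa> U M" and inv: "invariant_over U x M \<mu>"
    and \<phi>: "\<phi> \<in> Lfm U (x \<union> y) (univ U)" and A: "M \<union> fm_pars \<phi> \<subseteq> A"
    and d: "d \<in> tuples U y" "tp U y A d = q \<inter> Lfm U y A"
  shows "ext_product \<kappa> U x y \<mu> (dirac U y q) \<phi> = \<mu> (inst y d \<phi>)"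
proof -
  note U = monster_modelD(1)[OF mon]
  obtain N where N: "small_model \<kappa> U N" "M \<subseteq> N" "fm_pars \<phi> \<subseteq> N" by (rule small_model_over[OF mon M \<phi>])
  note NU = small_modelD[OF N(1)]
  obtain e0 where "e0 \<in> tuples U y" "tp U y N e0 = q \<inter> Lfm U y N"
    by (rule realize_restriction[OF mon y(1) q NU(2,1)])
  then obtain e where e: "e \<in> tuples U y" "tp U y N e = q \<inter> Lfm U y N"
    "Fmap U y N \<mu> \<phi> (q \<inter> Lfm U y N) = \<mu> (inst y e \<phi>)" by (rule Fmap_realization)
  have "ext_product \<kappa> U x y \<mu> (dirac U y q) \<phi> = \<mu> (inst y e \<phi>)"
    using ext_product_eq[OF mon y(1) dirac_keisler[OF q] \<phi> dirac_witness[OF x y q inv N(1,2) \<phi> N(3)]]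
      ext_integral_dirac[OF U q NU(2)] e(3) by simp
  also have "\<dots> = \<mu> (inst y d \<phi>)"
  proof (rule invariant_overD[OF invariant_over_mono[OF inv _ _ x] y _ e(1) d(1)])
    let ?B = "M \<union> fm_pars \<phi>"
    show "M \<subseteq> ?B" by simp
    show "?B \<subseteq> univ U" using N NU by auto
    show "\<phi> \<in> Lfm U (x \<union> y) ?B" using \<phi> by (simp add: Lfm_def)
    have BN: "?B \<subseteq> N" using N by simp
    have "Lfm U y ?B \<subseteq> Lfm U y A" "Lfm U y ?B \<subseteq> Lfm U y N" using A BN by (intro Lfm_mono; simp)+
    then show "tp U y ?B e = tp U y ?B d"
      using tp_subset[OF A, of U y d] tp_subset[OF BN, of U y e] d(2) e(2) by auto
  qed
  finally show ?thesis .
qed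

lemma inst_Disj: "inst z b (Disj \<phi> \<psi>) = Disj (inst z b \<phi>) (inst z b \<psi>)"
  by (simp add: Disj_def)

lemma defset_inst:
  assumes "\<phi> \<in> Lfm U (x \<union> y) A" "x \<inter> y = {}"
  shows "defset U x (inst y d \<phi>) = {a \<in> tuples U x. sat U (join x y a d) \<phi>}"
proof -
  have "fv \<phi> \<subseteq> x \<union> y" using assms(1) by (simp add: Lfm_def)
  then show ?thesis by (simp add: defset_def sat_inst_join[OF _ assms(2)])
qed

text \<open>The product sends \<open>\<phi>\<close> to \<open>\<mu>(\<phi>(x, d))\<close>, where \<open>d\<close> depends on the parameters involved but
  can be chosen in common for two formulas and their disjunction. Each axiom of a Keisler
  measure concerns at most these.\<close>

theorem ext_product_dirac_keisler:
  fixes U :: "('f, 'r, 'a) struct"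
  assumes mon: "monster_model \<kappa> T U" and x: "finite x" and y: "finite y" "x \<inter> y = {}"
    and \<mu>: "\<mu> \<in> keisler U x (univ U)" and q: "q \<in> ctypes U y (univ U)" and inv: "invariant \<kappa> U x \<mu>"
  shows "borel_pair \<kappa> U x y \<mu> (dirac U y q)"
    and "ext_product \<kappa> U x y \<mu> (dirac U y q) \<in> keisler U (x \<union> y) (univ U)"
proof -
  let ?\<rho> = "ext_product \<kappa> U x y \<mu> (dirac U y q)" and ?L = "Lfm U (x \<union> y) (univ U)"
  obtain M where M: "small_model \<kappa> U M" "invariant_over U x M \<mu>" using inv by (auto simp: invariant_def)
  note MU = small_modelD[OF M(1)]
  have "borel_triple \<kappa> U x y \<mu> (dirac U y q) \<phi>" if \<phi>: "\<phi> \<in> ?L" for \<phi>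
  proof -
    obtain N where "small_model \<kappa> U N" "M \<subseteq> N" "fm_pars \<phi> \<subseteq> N" by (rule small_model_over[OF mon M(1) \<phi>])
    then show ?thesis
      unfolding borel_triple_def using dirac_witness[OF x y q M(2) _ _ \<phi>] by blast
  qed
  then show "borel_pair \<kappa> U x y \<mu> (dirac U y q)" by (simp add: borel_pair_def)
  have common: "\<exists>d\<in>tuples U y. ?\<rho> \<phi> = \<mu> (inst y d \<phi>) \<and> ?\<rho> \<psi> = \<mu> (inst y d \<psi>) \<and>
      ?\<rho> (Disj \<phi> \<psi>) = \<mu> (Disj (inst y d \<phi>) (inst y d \<psi>)) \<and>
      inst y d \<phi> \<in> Lfm U x (univ U) \<and> inst y d \<psi> \<in> Lfm U x (univ U)"
    if \<phi>: "\<phi> \<in> ?L" and \<psi>: "\<psi> \<in> ?L" for \<phi> \<psi>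
  proof -
    let ?A = "M \<union> fm_pars (Disj \<phi> \<psi>)"
    have D: "Disj \<phi> \<psi> \<in> ?L" using \<phi> \<psi> by simp
    have A: "?A \<subseteq> univ U" using MU D by (auto simp: Lfm_def)
    have sA: "small \<kappa> ?A" by (intro small_Un[OF mon] MU(1) small_finite[OF mon] finite_fm_pars)
    obtain d where d: "d \<in> tuples U y" "tp U y ?A d = q \<inter> Lfm U y ?A"
      by (rule realize_restriction[OF mon y(1) q A sA])
    have dU: "d \<in> y \<rightarrow> univ U" using d(1) by (auto simp: tuples_def)
    have "fm_pars \<phi> \<subseteq> fm_pars (Disj \<phi> \<psi>)" "fm_pars \<psi> \<subseteq> fm_pars (Disj \<phi> \<psi>)" by (auto simp: Disj_def)
    then have sub: "M \<union> fm_pars \<phi> \<subseteq> ?A" "M \<union> fm_pars \<psi> \<subseteq> ?A" by auto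
    note val = ext_product_dirac[OF mon x y q M _ _ d]
    have "?\<rho> \<phi> = \<mu> (inst y d \<phi>)" "?\<rho> \<psi> = \<mu> (inst y d \<psi>)" by (rule val[OF \<phi> sub(1)], rule val[OF \<psi> sub(2)])
    moreover have "?\<rho> (Disj \<phi> \<psi>) = \<mu> (Disj (inst y d \<phi>) (inst y d \<psi>))"
      using val[OF D order_refl] by (simp only: inst_Disj)
    moreover have "inst y d \<phi> \<in> Lfm U x (univ U)" "inst y d \<psi> \<in> Lfm U x (univ U)"
      using Lfm_inst[OF \<phi> order_refl order_refl dU] Lfm_inst[OF \<psi> order_refl order_refl dU] by auto
    ultimately show ?thesis using d(1) by blast
  qed
  have tup: "join x y a d \<in> tuples U (x \<union> y)" if "a \<in> tuples U x" "d \<in> tuples U y" for a d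
    using that by (rule join_tuples)
  show "?\<rho> \<in> keisler U (x \<union> y) (univ U)"
    unfolding keisler_def mem_Collect_eq
  proof (intro conjI ballI impI)
    show "?\<rho> \<in> extensional ?L" by (simp add: ext_product_def)
    fix \<phi> assume \<phi>: "\<phi> \<in> ?L"
    obtain d where d: "d \<in> tuples U y" "?\<rho> \<phi> = \<mu> (inst y d \<phi>)" "inst y d \<phi> \<in> Lfm U x (univ U)"
      using common[OF \<phi> \<phi>] by blast
    show "0 \<le> ?\<rho> \<phi>" using keislerD(1)[OF \<mu> d(3)] d(2) by simp
    show "?\<rho> \<phi> = 1" if top: "defset U (x \<union> y) \<phi> = tuples U (x \<union> y)"
    proof -
      have "sat U (join x y a d) \<phi>" if "a \<in> tuples U x" for a
        using tup[OF that d(1)] top by (auto simp: defset_def)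
      then have "defset U x (inst y d \<phi>) = tuples U x" by (auto simp: defset_inst[OF \<phi> y(2)])
      then show ?thesis using keislerD(3)[OF \<mu> d(3)] d(2) by simp
    qed
    fix \<psi> assume \<psi>: "\<psi> \<in> ?L"
    obtain d where d: "d \<in> tuples U y" "?\<rho> \<phi> = \<mu> (inst y d \<phi>)" "?\<rho> \<psi> = \<mu> (inst y d \<psi>)"
      "?\<rho> (Disj \<phi> \<psi>) = \<mu> (Disj (inst y d \<phi>) (inst y d \<psi>))"
      "inst y d \<phi> \<in> Lfm U x (univ U)" "inst y d \<psi> \<in> Lfm U x (univ U)"
      using common[OF \<phi> \<psi>] by blast
    note ds = defset_inst[OF \<phi> y(2), of d] defset_inst[OF \<psi> y(2), of d]
    show "?\<rho> \<phi> = ?\<rho> \<psi>" if eq: "defset U (x \<union> y) \<phi> = defset U (x \<union> y) \<psi>"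
    proof -
      have "sat U (join x y a d) \<phi> \<longleftrightarrow> sat U (join x y a d) \<psi>" if "a \<in> tuples U x" for a
        using tup[OF that d(1)] eq by (auto simp: defset_def)
      then have "defset U x (inst y d \<phi>) = defset U x (inst y d \<psi>)" unfolding ds by auto
      then show ?thesis using keislerD(2)[OF \<mu> d(5,6)] d by simp
    qed
    show "?\<rho> (Disj \<phi> \<psi>) = ?\<rho> \<phi> + ?\<rho> \<psi>" if dis: "defset U (x \<union> y) \<phi> \<inter> defset U (x \<union> y) \<psi> = {}"
    proof -
      have "\<not> (sat U (join x y a d) \<phi> \<and> sat U (join x y a d) \<psi>)" if "a \<in> tuples U x" for a
        using tup[OF that d(1)] dis by (auto simp: defset_def)
      then have "defset U x (inst y d \<phi>) \<inter> defset U x (inst y d \<psi>) = {}" unfolding ds by auto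
      then show ?thesis using keislerD(4)[OF \<mu> d(5,6)] d by simp
    qed
  qed
qed

section \<open>The invariant extension of a type\<close>

lemma elem_subD:
  assumes "elem_sub U U'"
  shows "univ U \<subseteq> univ U'" "Lfm U' x A = Lfm U x A" "univ U \<noteq> {}"
  using assms Lfm_arities[of U' U] by (auto simp: elem_sub_def is_structure_def)

lemma elem_sub_tuples: "elem_sub U U' \<Longrightarrow> a \<in> tuples U x \<Longrightarrow> a \<in> tuples U' x"
  using elem_subD(1)[of U U'] by (fastforce simp: tuples_def)

lemma elem_sub_sat:
  assumes "elem_sub U U'" "\<phi> \<in> Lfm U x (univ U)" "a \<in> tuples U x"
  shows "sat U' a \<phi> = sat U a \<phi>"
proof -
  have "sat U a \<phi> = sat U' a (map_par (\<lambda>a. a) \<phi>)"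
    by (rule partial_elem_sat_on[OF elem_sub_partial_elem[OF assms(1)] assms(2)])
      (use assms elem_subD(3)[OF assms(1)] in \<open>auto simp: tuples_def\<close>)
  then show ?thesis by (simp add: map_par_id)
qed

lemma elem_sub_tp:
  assumes "elem_sub U U'" "A \<subseteq> univ U" "a \<in> tuples U x"
  shows "tp U' x A a = tp U x A a"
  using elem_sub_sat[OF assms(1) _ assms(3)] Lfm_mono[OF order_refl assms(2), of U x]
  unfolding tp_def elem_subD(2)[OF assms(1)] by blast

text \<open>Such a map moves parameters from the larger model into the smaller one without changing
  their type over \<open>M\<close>.\<close>

definition elem_over :: "('f, 'r, 'a) struct \<Rightarrow> ('f, 'r, 'a) struct \<Rightarrow> 'a set \<Rightarrow> 'a set \<Rightarrow> ('a \<Rightarrow> 'a) \<Rightarrow> bool" where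
  "elem_over U' U M A h \<longleftrightarrow> M \<subseteq> A \<and> A \<subseteq> univ U' \<and> h ` A \<subseteq> univ U \<and> (\<forall>a\<in>M. h a = a) \<and> partial_elem U' U A h"

lemma elem_overD:
  assumes "elem_over U' U M A h"
  shows "M \<subseteq> A" "A \<subseteq> univ U'" "h ` A \<subseteq> univ U" "a \<in> M \<Longrightarrow> h a = a" "partial_elem U' U A h"
  using assms by (auto simp: elem_over_def)

lemma elem_over_tp:
  assumes h: "elem_over U' U M A h" and A: "A \<noteq> {}" and c: "c \<in> w \<rightarrow> A"
  shows "tp U w M (\<lambda>n\<in>w. h (c n)) = tp U' w M c"
proof -
  have L: "Lfm U' x B = Lfm U x B" for x B using elem_overD(5)[OF h] by (intro Lfm_arities) (auto simp: partial_elem_def)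
  have "sat U' c \<phi> = sat U (\<lambda>n\<in>w. h (c n)) \<phi>" if \<phi>: "\<phi> \<in> Lfm U' w M" for \<phi>
  proof -
    have "sat U' c \<phi> = sat U (\<lambda>n\<in>w. h (c n)) (map_par h \<phi>)"
      by (rule partial_elem_sat_on[OF elem_overD(5)[OF h], of \<phi> w])
        (use \<phi> c A Lfm_mono[OF order_refl elem_overD(1)[OF h]] in auto)
    moreover have "map_par h \<phi> = \<phi>"
      by (rule map_par_id) (use \<phi> elem_overD(4)[OF h] in \<open>auto simp: Lfm_def\<close>)
    ultimately show ?thesis by simp
  qed
  then show ?thesis unfolding tp_def L by (auto simp: L)
qed

text \<open>The type over \<open>M\<close> of an enumeration of \<open>C\<close> is realized in \<open>U\<close> by saturation, and \<open>h\<close> sends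
  \<open>C\<close> to the realization. The enumeration uses the variables below \<open>k\<close>. To check elementarity
  for an arbitrary formula, its own variables are shifted by \<open>k\<close>, which keeps bound variables
  away from those of the enumeration.\<close>

lemma elem_over_exists:
  fixes U U' :: "('f, 'r, 'a) struct"
  assumes mon: "monster_model \<kappa> T U" and UU': "elem_sub U U'" and M: "small_model \<kappa> U M"
    and C: "finite C" "C \<subseteq> univ U'"
  shows "\<exists>h. elem_over U' U M (M \<union> C) h"
proof -
  note MU = small_modelD[OF M]
  note L = elem_subD(2)[OF UU']
  have pe: "partial_elem U U' M (\<lambda>a. a)"
    using partial_elem_subset[OF elem_sub_partial_elem[OF UU'] MU(2)] .
  define k where "k = card C"
  define w where "w = {0..<k}"
  obtain e where e: "bij_betw e C w" unfolding w_def k_def using ex_bij_betw_finite_nat[OF C(1)] by blast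
  have ew: "e a \<in> w" if "a \<in> C" for a using e that by (auto simp: bij_betw_def)
  define c' where "c' = restrict (inv_into C e) w"
  have c'e: "c' (e a) = a" if "a \<in> C" for a
    using that e ew[OF that] by (simp add: c'_def bij_betw_def inv_into_f_f)
  have c'C: "c' \<in> w \<rightarrow> C" using bij_betw_inv_into[OF e] by (auto simp: c'_def bij_betw_def)
  have c't: "c' \<in> tuples U' w" using c'C C(2) by (auto simp: tuples_def c'_def)
  have fin: "fin_sat U w (tp U' w M c')"
    unfolding fin_sat_def
  proof (intro allI impI, elim conjE)
    fix \<Phi> assume \<Phi>: "finite \<Phi>" "\<Phi> \<subseteq> tp U' w M c'"
    have "(\<exists>a\<in>tuples U w. \<forall>\<phi>\<in>\<Phi>. sat U a \<phi>) \<longleftrightarrow> (\<exists>a\<in>tuples U' w. \<forall>\<phi>\<in>\<Phi>. sat U' a (map_par (\<lambda>a. a) \<phi>))"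
      using \<Phi> MU elem_subD(1)[OF UU']
      by (intro partial_elem_consistent[OF pe]) (auto simp: w_def tp_def L)
    moreover have "\<forall>\<phi>\<in>\<Phi>. sat U' c' (map_par (\<lambda>a. a) \<phi>)" using \<Phi>(2) by (auto simp: tp_def map_par_id)
    ultimately show "\<exists>a\<in>tuples U w. \<forall>\<phi>\<in>\<Phi>. sat U a \<phi>" using c't by blast
  qed
  have "tp U' w M c' \<in> ctypes U w M"
    unfolding ctypes_iff using fin by (auto simp: tp_def L)
  moreover have "finite w" by (simp add: w_def)
  ultimately obtain c where c: "c \<in> tuples U w" "tp U w M c = tp U' w M c'"
    using realize_type[OF mon MU(2,1)] by blast
  have same: "sat U c \<phi> = sat U' c' \<phi>" if "\<phi> \<in> Lfm U w M" for \<phi>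
    using c(2) that by (auto simp: tp_def L)
  define h where "h a = (if a \<in> M then a else c (e a))" for a
  have hU: "h a \<in> univ U" if "a \<in> M \<union> C" for a
    using that MU c(1) ew by (auto simp: h_def tuples_def PiE_def)
  have "partial_elem U' U (M \<union> C) h"
    unfolding partial_elem_def
  proof (intro conjI ballI)
    show "fun_ar U' = fun_ar U" "rel_ar U' = rel_ar U" using UU' by (auto simp: elem_sub_def)
    fix \<phi> :: "('f, 'r, 'a) fm" and v :: "nat \<Rightarrow> 'a"
    assume \<phi>: "\<phi> \<in> Lfm U' UNIV {}" and v: "v \<in> UNIV \<rightarrow> M \<union> C"
    define \<pi> where "\<pi> = (\<lambda>n. n + k)"
    define s :: "'a \<Rightarrow> ('f, 'a) tm" where "s a = (if a \<in> M then Par a else Var (e a))" for a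
    let ?\<phi> = "inst UNIV v \<phi>"
    have pars: "fm_pars ?\<phi> \<subseteq> M \<union> C"
    proof -
      have "v ` (UNIV \<inter> fv \<phi>) \<subseteq> M \<union> C" using v by blast
      moreover have "fm_pars \<phi> = {}" using \<phi> by (simp add: Lfm_def)
      ultimately show ?thesis using fm_pars_inst[of UNIV v \<phi>] by blast
    qed
    have inj: "inj \<pi>" by (simp add: \<pi>_def)
    have sC: "tm_fv (s a) \<subseteq> w" "tm_pars (s a) \<subseteq> M" "tm_val U' c' (s a) = a" "tm_val U c (s a) = h a"
      if "a \<in> M \<union> C" for a
      using that ew c'e by (auto simp: s_def h_def)
    have sfr: "tm_fv (s a) \<inter> \<pi> ` X = {}" if "a \<in> M \<union> C" for a X
      using sC(1)[OF that] by (auto simp: w_def \<pi>_def)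
    have "fv (translate \<pi> s ?\<phi>) \<subseteq> \<pi> ` fv ?\<phi> \<union> (\<Union>a\<in>fm_pars ?\<phi>. tm_fv (s a))" by (rule fv_translate)
    moreover have "fv ?\<phi> = {}" by (simp add: fv_inst)
    moreover have "(\<Union>a\<in>fm_pars ?\<phi>. tm_fv (s a)) \<subseteq> w" using pars sC(1) by blast
    ultimately have "fv (translate \<pi> s ?\<phi>) \<subseteq> w" by simp
    moreover have "fm_pars (translate \<pi> s ?\<phi>) \<subseteq> M" unfolding fm_pars_translate using pars sC(2) by blast
    moreover have "fm_wf U (translate \<pi> s ?\<phi>)"
      using \<phi>[unfolded L] by (intro fm_wf_translate) (auto simp: Lfm_def fm_wf_inst s_def)
    ultimately have "translate \<pi> s ?\<phi> \<in> Lfm U w M" by (simp add: Lfm_def)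
    from same[OF this] have "sat U' c' (translate \<pi> s ?\<phi>) = sat U c (translate \<pi> s ?\<phi>)" ..
    also have "sat U' c' (translate \<pi> s ?\<phi>) = sat U' (\<lambda>m. c' (\<pi> m)) (map_par (\<lambda>a. a) ?\<phi>)"
      using pars sC(3) sfr by (intro sat_translate[OF inj]) blast
    also have "sat U c (translate \<pi> s ?\<phi>) = sat U (\<lambda>m. c (\<pi> m)) (map_par h ?\<phi>)"
      using pars sC(4) sfr by (intro sat_translate[OF inj]) blast
    finally have "sat U' (override_on (\<lambda>m. c' (\<pi> m)) ((\<lambda>a. a) \<circ> v) UNIV) \<phi> = sat U (override_on (\<lambda>m. c (\<pi> m)) (h \<circ> v) UNIV) \<phi>"
      by (simp only: map_par_inst_pure[OF \<phi>] sat_inst)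
    then show "sat U' v \<phi> = sat U (\<lambda>n. h (v n)) \<phi>"
      by (simp add: override_on_def comp_def)
  qed
  moreover have "h ` (M \<union> C) \<subseteq> univ U" using hU by blast
  moreover have "M \<union> C \<subseteq> univ U'" using MU(2) C(2) elem_subD(1)[OF UU'] by blast
  moreover have "\<forall>a\<in>M. h a = a" by (simp add: h_def)
  ultimately show ?thesis unfolding elem_over_def by blast
qed

text \<open>Transfers facts about invariant functions to types.\<close>

lemma invariant_type_over_iff:
  "invariant_type_over U x M p \<longleftrightarrow> invariant_over U x M (\<lambda>\<phi>. if \<phi> \<in> p then 1 else 0)"
proof -
  have "(if P then 1 else 0 :: real) = (if Q then 1 else 0) \<longleftrightarrow> P = Q" for P Q by simp
  then show ?thesis unfolding invariant_type_over_def invariant_over_def by (simp only:)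
qed

lemma invariant_type_overD:
  assumes "invariant_type_over U x M p" "finite z" "x \<inter> z = {}" "\<phi> \<in> Lfm U (x \<union> z) M"
    "b \<in> tuples U z" "b' \<in> tuples U z" "tp U z M b = tp U z M b'"
  shows "inst z b \<phi> \<in> p \<longleftrightarrow> inst z b' \<phi> \<in> p"
  using assms unfolding invariant_type_over_def by blast

lemma invariant_type_over_mono:
  assumes "invariant_type_over U x M p" "M \<subseteq> A" "A \<subseteq> univ U" "finite x"
  shows "invariant_type_over U x A p"
  using invariant_over_mono[OF _ assms(2-4)] assms(1) unfolding invariant_type_over_iff by blast

lemma Lfm_map_par:
  assumes "\<phi> \<in> Lfm M x A" "h ` A \<subseteq> B" shows "map_par h \<phi> \<in> Lfm M x B"
proof -
  have "fm_pars \<phi> \<subseteq> A" "fv \<phi> \<subseteq> x" "fm_wf M \<phi>" using assms(1) by (auto simp: Lfm_def)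
  then have "h ` fm_pars \<phi> \<subseteq> B" "fv (map_par h \<phi>) \<subseteq> x" "fm_wf M (map_par h \<phi>)"
    using assms(2) fv_translate[of "\<lambda>n. n" "\<lambda>a. Par (h a)" \<phi>] by (auto intro!: fm_wf_translate)
  then show ?thesis by (auto simp: Lfm_def fm_pars_translate)
qed

text \<open>Two such maps send the parameters of \<open>\<psi>\<close> to tuples with the same type over \<open>M\<close>, so an
  \<open>M\<close>-invariant type does not distinguish the images of \<open>\<psi>\<close>.\<close>

lemma elem_over_independent:
  assumes p: "invariant_type_over U x M p" and x: "finite x"
    and h: "elem_over U' U M A h" and g: "elem_over U' U M B g" and ne: "M \<noteq> {}"
    and \<psi>: "\<psi> \<in> Lfm U' x A" "\<psi> \<in> Lfm U' x B"
  shows "map_par h \<psi> \<in> p \<longleftrightarrow> map_par g \<psi> \<in> p"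
proof -
  have L: "Lfm U' x B = Lfm U x B" for x B using elem_overD(5)[OF h] by (intro Lfm_arities) (auto simp: partial_elem_def)
  have "\<psi> \<in> Lfm U' x (A \<inter> B)" using \<psi> by (simp add: Lfm_def)
  then obtain w c \<psi>0 where w: "finite w" "w \<inter> x = {}" "c \<in> w \<rightarrow>\<^sub>E A \<inter> B"
    "\<psi>0 \<in> Lfm U' (x \<union> w) {}" "\<psi> = inst w c \<psi>0" by (rule obtain_instance[OF _ x])
  have c: "c \<in> w \<rightarrow> A" "c \<in> w \<rightarrow> B" using w(3) by auto
  have m: "map_par f \<psi> = inst w (\<lambda>n\<in>w. f (c n)) \<psi>0" for f
    unfolding w(5) map_par_inst_pure[OF w(4)] by (rule inst_cong) simp
  show ?thesis
    unfolding m
  proof (rule invariant_type_overD[OF p w(1)])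
    show "x \<inter> w = {}" using w by auto
    show "\<psi>0 \<in> Lfm U (x \<union> w) M" using w(4) Lfm_mono[of "x \<union> w" "x \<union> w" "{}" M U] by (auto simp: L)
    show "(\<lambda>n\<in>w. h (c n)) \<in> tuples U w" using c elem_overD(3)[OF h] by (auto simp: tuples_def)
    show "(\<lambda>n\<in>w. g (c n)) \<in> tuples U w" using c elem_overD(3)[OF g] by (auto simp: tuples_def)
    have "A \<noteq> {}" "B \<noteq> {}" using ne elem_overD(1)[OF h] elem_overD(1)[OF g] by auto
    then show "tp U w M (\<lambda>n\<in>w. h (c n)) = tp U w M (\<lambda>n\<in>w. g (c n))"
      using elem_over_tp[OF h _ c(1)] elem_over_tp[OF g _ c(2)] by simp
  qed
qed

text \<open>A formula over \<open>U'\<close> belongs to the extension if \<open>p\<close> contains its image under some,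
  equivalently any, elementary map over \<open>M\<close> that moves its parameters into \<open>U\<close>. Consistency,
  completeness and invariance each involve finitely many parameters, so a single map reduces
  them to the corresponding property of \<open>p\<close>.\<close>

lemma invariant_extension:
  fixes U U' :: "('f, 'r, 'a) struct"
  assumes mon: "monster_model \<kappa> T U" and UU': "elem_sub U U'" and x: "finite x"
    and M: "small_model \<kappa> U M" and p: "p \<in> ctypes U x (univ U)" and inv: "invariant_type_over U x M p"
  shows "\<exists>p'\<in>ctypes U' x (univ U'). p \<subseteq> p' \<and> invariant_type_over U' x M p'"
proof -
  note MU = small_modelD[OF M]
  note L = elem_subD(2)[OF UU']
  define p' where "p' = {\<psi> \<in> Lfm U' x (univ U'). \<exists>A h. elem_over U' U M A h \<and> fm_pars \<psi> \<subseteq> A \<and> map_par h \<psi> \<in> p}"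
  have p'_iff: "\<psi> \<in> p' \<longleftrightarrow> map_par h \<psi> \<in> p"
    if "elem_over U' U M A h" "\<psi> \<in> Lfm U' x A" for A h \<psi>
  proof
    assume "map_par h \<psi> \<in> p"
    moreover have "\<psi> \<in> Lfm U' x (univ U')" using that(2) Lfm_mono[OF order_refl elem_overD(2)[OF that(1)]] by auto
    ultimately show "\<psi> \<in> p'" using that by (auto simp: p'_def Lfm_def)
  next
    assume "\<psi> \<in> p'"
    then obtain B g where g: "elem_over U' U M B g" "\<psi> \<in> Lfm U' x B" "map_par g \<psi> \<in> p"
      by (auto simp: p'_def Lfm_def)
    then show "map_par h \<psi> \<in> p" using elem_over_independent[OF inv x that(1) g(1) MU(3) that(2) g(2)] by simp
  qed
  \<comment> \<open>For parameters in \<open>U\<close> the identity is such a map, so nothing changes for formulas over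
    \<open>U\<close>.\<close>
  have "elem_over U' U M (univ U) (\<lambda>a. a)"
    using MU(2) elem_subD(1)[OF UU'] elem_sub_partial_elem[OF UU'] L
    by (auto simp: elem_over_def partial_elem_def)
  then have "p \<subseteq> p'"
    using p'_iff[of "univ U" "\<lambda>a. a"] ctypesD(1)[OF p] by (auto simp: map_par_id L)
  moreover have "p' \<in> ctypes U' x (univ U')"
    unfolding ctypes_iff fin_sat_def
  proof (intro conjI allI impI ballI)
    show "p' \<subseteq> Lfm U' x (univ U')" by (auto simp: p'_def)
    fix \<Phi> assume \<Phi>: "finite \<Phi> \<and> \<Phi> \<subseteq> p'"
    let ?C = "\<Union>\<phi>\<in>\<Phi>. fm_pars \<phi>"
    have C: "finite ?C" "?C \<subseteq> univ U'" using \<Phi> finite_fm_pars by (auto simp: p'_def Lfm_def)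
    obtain h where h: "elem_over U' U M (M \<union> ?C) h" using elem_over_exists[OF mon UU' M C] by blast
    have \<Phi>L: "\<Phi> \<subseteq> Lfm U' x (M \<union> ?C)" using \<Phi> by (auto simp: p'_def Lfm_def)
    have "map_par h ` \<Phi> \<subseteq> p" using p'_iff[OF h] \<Phi> \<Phi>L by blast
    then obtain a where "a \<in> tuples U x" "\<forall>\<phi>\<in>\<Phi>. sat U a (map_par h \<phi>)"
      using fin_satD[OF ctypesD(2)[OF p], of "map_par h ` \<Phi>"] \<Phi> by auto
    then show "\<exists>a\<in>tuples U' x. \<forall>\<phi>\<in>\<Phi>. sat U' a \<phi>"
      using partial_elem_consistent[OF elem_overD(5)[OF h] _ elem_overD(2,3)[OF h] x _ \<Phi>L] \<Phi> MU(3) by blast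
  next
    fix \<psi> assume \<psi>: "\<psi> \<in> Lfm U' x (univ U')"
    then have C: "finite (fm_pars \<psi>)" "fm_pars \<psi> \<subseteq> univ U'" using finite_fm_pars by (auto simp: Lfm_def)
    obtain h where h: "elem_over U' U M (M \<union> fm_pars \<psi>) h" using elem_over_exists[OF mon UU' M C] by blast
    have \<psi>L: "\<psi> \<in> Lfm U' x (M \<union> fm_pars \<psi>)" using \<psi> by (simp add: Lfm_def)
    have "map_par h \<psi> \<in> Lfm U x (univ U)" using \<psi>L elem_overD(3)[OF h] unfolding L by (rule Lfm_map_par)
    then show "\<psi> \<in> p' \<or> Neg \<psi> \<in> p'"
      using p'_iff[OF h \<psi>L] p'_iff[OF h, of "Neg \<psi>"] \<psi>L ctypesD(3)[OF p] by simp
  qed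
  moreover have "invariant_type_over U' x M p'"
    unfolding invariant_type_over_def
  proof (intro allI impI ballI)
    fix z \<phi> b b'
    assume z: "finite z \<and> x \<inter> z = {}" and \<phi>: "\<phi> \<in> Lfm U' (x \<union> z) M"
      and b: "b \<in> tuples U' z" "b' \<in> tuples U' z" and tp: "tp U' z M b = tp U' z M b'"
    let ?C = "b ` z \<union> b' ` z"
    have C: "finite ?C" "?C \<subseteq> univ U'" using z b by (auto simp: tuples_def)
    obtain h where h: "elem_over U' U M (M \<union> ?C) h" using elem_over_exists[OF mon UU' M C] by blast
    have bC: "b \<in> z \<rightarrow> M \<union> ?C" "b' \<in> z \<rightarrow> M \<union> ?C" by auto
    have "map_par h \<phi> = \<phi>"
      by (rule map_par_id) (use \<phi> elem_overD(4)[OF h] in \<open>auto simp: Lfm_def\<close>)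
    then have m: "map_par h (inst z d \<phi>) = inst z (\<lambda>n\<in>z. h (d n)) \<phi>" for d
      unfolding map_par_inst by simp (rule inst_cong, simp)
    have L1: "inst z b \<phi> \<in> Lfm U' x (M \<union> ?C)" "inst z b' \<phi> \<in> Lfm U' x (M \<union> ?C)"
      using bC by (intro Lfm_inst[OF \<phi>]; auto)+
    have ne: "M \<union> ?C \<noteq> {}" using MU(3) by simp
    have "map_par h (inst z b \<phi>) \<in> p \<longleftrightarrow> map_par h (inst z b' \<phi>) \<in> p"
      unfolding m
    proof (rule invariant_type_overD[OF inv])
      show "finite z" "x \<inter> z = {}" using z by auto
      show "\<phi> \<in> Lfm U (x \<union> z) M" using \<phi> by (simp add: L)
      show "(\<lambda>n\<in>z. h (b n)) \<in> tuples U z" "(\<lambda>n\<in>z. h (b' n)) \<in> tuples U z"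
        using elem_overD(3)[OF h] by (auto simp: tuples_def)
      show "tp U z M (\<lambda>n\<in>z. h (b n)) = tp U z M (\<lambda>n\<in>z. h (b' n))"
        using elem_over_tp[OF h ne bC(1)] elem_over_tp[OF h ne bC(2)] tp by simp
    qed
    then show "inst z b \<phi> \<in> p' \<longleftrightarrow> inst z b' \<phi> \<in> p'" using p'_iff[OF h] L1 by blast
  qed
  ultimately show ?thesis by blast
qed

section \<open>Products of types\<close>

text \<open>The condition on \<open>r\<close> in the definition of \<open>p \<otimes> q\<close>, with the model \<open>M\<close> made explicit, since
  uniqueness has to be shown across different \<open>M\<close>.\<close>

definition realizes_product ::
  "'k rel \<Rightarrow> ('f, 'r, 'a) struct \<Rightarrow> ('f, 'r, 'a) struct \<Rightarrow> nat set \<Rightarrow> nat set \<Rightarrow>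
   ('f, 'r, 'a) fm set \<Rightarrow> ('f, 'r, 'a) fm set \<Rightarrow> ('f, 'r, 'a) fm set \<Rightarrow> 'a set \<Rightarrow> bool" where
  "realizes_product \<kappa> U U' x y p q r M \<longleftrightarrow> (\<exists>p' a b.
     small_model \<kappa> U M \<and> invariant_type_over U x M p \<and>
     p' \<in> ctypes U' x (univ U') \<and> p \<subseteq> p' \<and> invariant_type_over U' x M p' \<and>
     b \<in> tuples U' y \<and> tp U' y (univ U) b = q \<and>
     a \<in> tuples U' x \<and> tp U' x (univ U \<union> b ` y) a = p' \<inter> Lfm U' x (univ U \<union> b ` y) \<and>
     r = tp U' (x \<union> y) (univ U) (join x y a b))"

lemma type_product_realizes:
  "type_product \<kappa> U U' x y p q = (THE r. \<exists>M. realizes_product \<kappa> U U' x y p q r M)"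
  unfolding type_product_def realizes_product_def ..

text \<open>Membership of \<open>\<phi>\<close> in \<open>r\<close> says \<open>\<phi>(x, b) \<in> p'\<close>. Over \<open>A\<close> the tuples \<open>b\<close> and \<open>d\<close> have the
  same type, namely that given by \<open>q\<close>, so invariance of \<open>p'\<close> replaces \<open>b\<close> by \<open>d\<close>, and \<open>p'\<close>
  agrees with \<open>p\<close> on formulas over \<open>U\<close>.\<close>

lemma realizes_product_iff:
  assumes UU': "elem_sub U U'" and x: "finite x" and y: "finite y" "x \<inter> y = {}"
    and p: "p \<in> ctypes U x (univ U)" and r: "realizes_product \<kappa> U U' x y p q r M"
    and \<phi>: "\<phi> \<in> Lfm U (x \<union> y) (univ U)" and A: "M \<union> fm_pars \<phi> \<subseteq> A" "A \<subseteq> univ U"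
    and d: "d \<in> tuples U y" "tp U y A d = q \<inter> Lfm U y A"
  shows "\<phi> \<in> r \<longleftrightarrow> inst y d \<phi> \<in> p"
proof -
  note L = elem_subD(2)[OF UU'] and sub = elem_subD(1)[OF UU']
  obtain p' a b where p': "p' \<in> ctypes U' x (univ U')" "p \<subseteq> p'" "invariant_type_over U' x M p'"
    and b: "b \<in> tuples U' y" "tp U' y (univ U) b = q"
    and a: "a \<in> tuples U' x" "tp U' x (univ U \<union> b ` y) a = p' \<inter> Lfm U' x (univ U \<union> b ` y)"
    and r: "r = tp U' (x \<union> y) (univ U) (join x y a b)"
    using r unfolding realizes_product_def by blast
  have fv: "fv \<phi> \<subseteq> x \<union> y" using \<phi> by (simp add: Lfm_def)
  have ib: "inst y b \<phi> \<in> Lfm U' x (univ U \<union> b ` y)"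
    using \<phi> unfolding L by (intro Lfm_inst[of \<phi> U "x \<union> y" "univ U"]) auto
  have id: "inst y d \<phi> \<in> Lfm U x (univ U)"
    using d(1) by (intro Lfm_inst[OF \<phi>]) (auto simp: tuples_def)
  have id': "inst y d \<phi> \<in> Lfm U' x (univ U')"
    using id Lfm_mono[OF order_refl sub, of U x] by (auto simp: L)
  have "\<phi> \<in> r \<longleftrightarrow> sat U' (join x y a b) \<phi>" using \<phi> by (simp add: r tp_def L)
  also have "\<dots> \<longleftrightarrow> sat U' a (inst y b \<phi>)" by (simp add: sat_inst_join[OF fv y(2)])
  also have "\<dots> \<longleftrightarrow> inst y b \<phi> \<in> tp U' x (univ U \<union> b ` y) a" using ib by (simp add: tp_def)
  also have "\<dots> \<longleftrightarrow> inst y b \<phi> \<in> p'" using ib a(2) by simp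
  also have "\<dots> \<longleftrightarrow> inst y d \<phi> \<in> p'"
  proof (rule invariant_type_overD[OF invariant_type_over_mono[OF p'(3) _ _ x] y])
    show "M \<subseteq> A" "A \<subseteq> univ U'" using A sub by auto
    show "\<phi> \<in> Lfm U' (x \<union> y) A" using \<phi> A unfolding L by (simp add: Lfm_def)
    show "b \<in> tuples U' y" by fact
    show "d \<in> tuples U' y" by (rule elem_sub_tuples[OF UU' d(1)])
    have "tp U' y A b = q \<inter> Lfm U y A" using tp_subset[OF A(2), of U' y b] b(2) by (simp add: L)
    then show "tp U' y A b = tp U' y A d" using elem_sub_tp[OF UU' A(2) d(1)] d(2) by simp
  qed
  also have "\<dots> \<longleftrightarrow> inst y d \<phi> \<in> p"
    using p'(2) ctypesD(3)[OF p id] ctypes_Neg[OF p'(1) id'] by blast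
  finally show ?thesis .
qed

lemma realizes_product_exists:
  fixes U U' :: "('f, 'r, 'a) struct" and \<kappa>' :: "'l rel"
  assumes mon: "monster_model \<kappa> T U" and x: "finite x" and y: "finite y"
    and big: "larger_monster \<kappa>' T U U'" and M: "small_model \<kappa> U M"
    and p: "p \<in> ctypes U x (univ U)" "invariant_type_over U x M p" and q: "q \<in> ctypes U y (univ U)"
  shows "\<exists>r. realizes_product \<kappa> U U' x y p q r M"
proof -
  have mon': "monster_model \<kappa>' T U'" and UU': "elem_sub U U'" and sm: "small \<kappa>' (univ U)"
    using big by (auto simp: larger_monster_def)
  note L = elem_subD(2)[OF UU'] and sub = elem_subD(1)[OF UU']
  obtain p' where p': "p' \<in> ctypes U' x (univ U')" "p \<subseteq> p'" "invariant_type_over U' x M p'"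
    using invariant_extension[OF mon UU' x M p] by blast
  have "fin_sat U' y q"
    unfolding fin_sat_def
  proof (intro allI impI, elim conjE)
    fix \<Phi> assume \<Phi>: "finite \<Phi>" "\<Phi> \<subseteq> q"
    obtain a where a: "a \<in> tuples U y" "\<forall>\<phi>\<in>\<Phi>. sat U a \<phi>"
      using fin_satD[OF ctypesD(2)[OF q] \<Phi>] by blast
    have "sat U' a \<phi>" if "\<phi> \<in> \<Phi>" for \<phi>
    proof -
      have "\<phi> \<in> Lfm U y (univ U)" using that \<Phi>(2) ctypesD(1)[OF q] by auto
      then show ?thesis using elem_sub_sat[OF UU' _ a(1)] a(2) that by simp
    qed
    then show "\<exists>a\<in>tuples U' y. \<forall>\<phi>\<in>\<Phi>. sat U' a \<phi>" using elem_sub_tuples[OF UU' a(1)] by blast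
  qed
  then have "q \<in> ctypes U' y (univ U)" using ctypesD[OF q] by (simp add: ctypes_iff L)
  then obtain b where b: "b \<in> tuples U' y" "tp U' y (univ U) b = q"
    by (rule realize_type[OF mon' sub sm y])
  let ?B = "univ U \<union> b ` y"
  have B: "?B \<subseteq> univ U'" using sub b(1) by (auto simp: tuples_def)
  have sB: "small \<kappa>' ?B" using y by (intro small_Un[OF mon' sm] small_finite[OF mon']) simp
  obtain a where "a \<in> tuples U' x" "tp U' x ?B a = p' \<inter> Lfm U' x ?B"
    by (rule realize_restriction[OF mon' x p'(1) B sB])
  then show ?thesis unfolding realizes_product_def using M p(2) p' b by blast
qed

text \<open>Two candidates for \<open>p \<otimes> q\<close> with bases \<open>M\<close> and \<open>N\<close> are compared by a realization of \<open>q\<close>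
  over \<open>M \<union> N\<close> and the parameters of the formula. The same criterion computes the product of the
  Dirac measures.\<close>

theorem dirac_type_product:
  fixes U U' :: "('f, 'r, 'a) struct" and \<kappa>' :: "'l rel"
  assumes mon: "monster_model \<kappa> T U" and x: "finite x" and y: "finite y" "x \<inter> y = {}"
    and p: "p \<in> ctypes U x (univ U)" and q: "q \<in> ctypes U y (univ U)"
    and inv: "invariant_type \<kappa> U x p" and big: "larger_monster \<kappa>' T U U'"
  shows "borel_pair \<kappa> U x y (dirac U x p) (dirac U y q)"
    and "dirac U (x \<union> y) (type_product \<kappa> U U' x y p q) = ext_product \<kappa> U x y (dirac U x p) (dirac U y q)"
proof -
  have UU': "elem_sub U U'" using big by (simp add: larger_monster_def)
  note L = elem_subD(2)[OF UU']
  have inv_dirac: "invariant_over U x M (dirac U x p)"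
    if M: "small_model \<kappa> U M" "invariant_type_over U x M p" for M
    unfolding invariant_over_def
  proof (intro allI impI ballI)
    fix z \<phi> b b'
    assume z: "finite z \<and> x \<inter> z = {}" and \<phi>: "\<phi> \<in> Lfm U (x \<union> z) M"
      and b: "b \<in> tuples U z" "b' \<in> tuples U z" and tp: "tp U z M b = tp U z M b'"
    have "inst z b \<phi> \<in> Lfm U x (univ U)" "inst z b' \<phi> \<in> Lfm U x (univ U)"
      using b small_modelD(2)[OF M(1)] by (intro Lfm_inst[OF \<phi>]; auto simp: tuples_def)+
    then show "dirac U x p (inst z b \<phi>) = dirac U x p (inst z b' \<phi>)"
      using invariant_type_overD[OF M(2) _ _ \<phi> b tp] z by (simp add: dirac_apply)
  qed
  obtain M where M: "small_model \<kappa> U M" "invariant_type_over U x M p"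
    using inv by (auto simp: invariant_type_def)
  have "invariant \<kappa> U x (dirac U x p)" using inv_dirac[OF M] M(1) by (auto simp: invariant_def)
  then show "borel_pair \<kappa> U x y (dirac U x p) (dirac U y q)"
    by (rule ext_product_dirac_keisler(1)[OF mon x y dirac_keisler[OF p] q])
  obtain r where r: "realizes_product \<kappa> U U' x y p q r M"
    using realizes_product_exists[OF mon x y(1) big M(1) p M(2) q] by blast
  have rL: "s \<subseteq> Lfm U (x \<union> y) (univ U)" "small_model \<kappa> U N" if "realizes_product \<kappa> U U' x y p q s N" for s N
    using that by (auto simp: realizes_product_def tp_def L)
  have real: "\<exists>d\<in>tuples U y. tp U y (M \<union> N \<union> fm_pars \<phi>) d = q \<inter> Lfm U y (M \<union> N \<union> fm_pars \<phi>)"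
    and sub: "M \<union> N \<union> fm_pars \<phi> \<subseteq> univ U"
    if N: "small_model \<kappa> U N" and \<phi>: "\<phi> \<in> Lfm U (x \<union> y) (univ U)" for N \<phi>
  proof -
    show A: "M \<union> N \<union> fm_pars \<phi> \<subseteq> univ U"
      using small_modelD(2)[OF M(1)] small_modelD(2)[OF N] \<phi> by (simp add: Lfm_def)
    have sA: "small \<kappa> (M \<union> N \<union> fm_pars \<phi>)"
      by (intro small_Un[OF mon] small_modelD(1)[OF M(1)] small_modelD(1)[OF N] small_finite[OF mon] finite_fm_pars)
    show "\<exists>d\<in>tuples U y. tp U y (M \<union> N \<union> fm_pars \<phi>) d = q \<inter> Lfm U y (M \<union> N \<union> fm_pars \<phi>)"
      by (rule realize_restriction[OF mon y(1) q A sA]) blast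
  qed
  note char = realizes_product_iff[OF UU' x y p]
  have "type_product \<kappa> U U' x y p q = r"
    unfolding type_product_realizes
  proof (rule the_equality)
    show "\<exists>M. realizes_product \<kappa> U U' x y p q r M" using r by blast
    fix s assume "\<exists>N. realizes_product \<kappa> U U' x y p q s N"
    then obtain N where s: "realizes_product \<kappa> U U' x y p q s N" by blast
    have "\<phi> \<in> s \<longleftrightarrow> \<phi> \<in> r" if \<phi>: "\<phi> \<in> Lfm U (x \<union> y) (univ U)" for \<phi>
    proof -
      obtain d where d: "d \<in> tuples U y" "tp U y (M \<union> N \<union> fm_pars \<phi>) d = q \<inter> Lfm U y (M \<union> N \<union> fm_pars \<phi>)"
        using real[OF rL(2)[OF s] \<phi>] by blast
      show ?thesis
        using char[OF s \<phi> _ sub[OF rL(2)[OF s] \<phi>] d] char[OF r \<phi> _ sub[OF rL(2)[OF s] \<phi>] d] by blast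
    qed
    then show "s = r" using rL(1)[OF s] rL(1)[OF r] by blast
  qed
  moreover have "dirac U (x \<union> y) r \<phi> = ext_product \<kappa> U x y (dirac U x p) (dirac U y q) \<phi>" for \<phi>
  proof (cases "\<phi> \<in> Lfm U (x \<union> y) (univ U)")
    case \<phi>: True
    obtain d where d: "d \<in> tuples U y" "tp U y (M \<union> M \<union> fm_pars \<phi>) d = q \<inter> Lfm U y (M \<union> M \<union> fm_pars \<phi>)"
      using real[OF M(1) \<phi>] by blast
    have "inst y d \<phi> \<in> Lfm U x (univ U)"
      using d(1) by (intro Lfm_inst[OF \<phi>]) (auto simp: tuples_def)
    moreover have "\<phi> \<in> r \<longleftrightarrow> inst y d \<phi> \<in> p" using char[OF r \<phi> _ sub[OF M(1) \<phi>] d] by blast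
    moreover have "ext_product \<kappa> U x y (dirac U x p) (dirac U y q) \<phi> = dirac U x p (inst y d \<phi>)"
      by (rule ext_product_dirac[OF mon x y q M(1) inv_dirac[OF M] \<phi> _ d]) blast
    ultimately show ?thesis using \<phi> by (simp add: dirac_apply)
  next
    case False
    then show ?thesis by (simp add: dirac_def ext_product_def)
  qed
  ultimately show "dirac U (x \<union> y) (type_product \<kappa> U U' x y p q) = ext_product \<kappa> U x y (dirac U x p) (dirac U y q)"
    by blast
qed

theorem proposition3p5:
  fixes \<kappa> :: "'k rel" and \<kappa>' :: "'l rel"
    and T :: "('f, 'r, 'a) fm set"
    and U :: "('f, 'r, 'a) struct"
    and x y :: "nat set"
  assumes "monster_model \<kappa> T U"
    and "finite x" and "finite y" and "x \<inter> y = {}"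
  shows
    "(\<forall>\<mu> \<nu>. \<mu> \<in> keisler U x (univ U) \<and> \<nu> \<in> keisler U y (univ U) \<and> borel_definable \<kappa> U x \<mu> \<longrightarrow>
        borel_pair \<kappa> U x y \<mu> \<nu> \<and>
        std_product \<kappa> U x y \<mu> \<nu> = ext_product \<kappa> U x y \<mu> \<nu>) \<and>
     (\<forall>\<mu> q. \<mu> \<in> keisler U x (univ U) \<and> invariant \<kappa> U x \<mu> \<and> q \<in> ctypes U y (univ U) \<longrightarrow>
        borel_pair \<kappa> U x y \<mu> (dirac U y q) \<and>
        ext_product \<kappa> U x y \<mu> (dirac U y q) \<in> keisler U (x \<union> y) (univ U) \<and>
        (\<forall>\<phi>\<in>Lfm U (x \<union> y) (univ U). \<forall>N. borel_witness \<kappa> U x y \<mu> (dirac U y q) \<phi> N \<longrightarrow>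
           ext_product \<kappa> U x y \<mu> (dirac U y q) \<phi> = ext_integral U y \<mu> (dirac U y q) \<phi> N)) \<and>
     (\<forall>p q U'. p \<in> ctypes U x (univ U) \<and> q \<in> ctypes U y (univ U) \<and> invariant_type \<kappa> U x p \<and>
        larger_monster \<kappa>' T U U' \<longrightarrow>
        borel_pair \<kappa> U x y (dirac U x p) (dirac U y q) \<and>
        dirac U (x \<union> y) (type_product \<kappa> U U' x y p q) =
          ext_product \<kappa> U x y (dirac U x p) (dirac U y q))"
proof (intro conjI allI impI ballI; elim conjE)
  note mon = assms(1) and x = assms(2) and y = assms(3,4)
  fix \<mu> \<nu>
  assume "\<nu> \<in> keisler U y (univ U)" "borel_definable \<kappa> U x \<mu>"
  then show "borel_pair \<kappa> U x y \<mu> \<nu>" "std_product \<kappa> U x y \<mu> \<nu> = ext_product \<kappa> U x y \<mu> \<nu>"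
    by (rule std_product_eq_ext_product[OF mon x y])+
next
  note mon = assms(1) and x = assms(2) and y = assms(3,4)
  fix \<mu> q
  assume \<mu>: "\<mu> \<in> keisler U x (univ U)" and inv: "invariant \<kappa> U x \<mu>" and q: "q \<in> ctypes U y (univ U)"
  show "borel_pair \<kappa> U x y \<mu> (dirac U y q)"
    "ext_product \<kappa> U x y \<mu> (dirac U y q) \<in> keisler U (x \<union> y) (univ U)"
    by (rule ext_product_dirac_keisler[OF mon x y \<mu> q inv])+
  show "ext_product \<kappa> U x y \<mu> (dirac U y q) \<phi> = ext_integral U y \<mu> (dirac U y q) \<phi> N"
    if "\<phi> \<in> Lfm U (x \<union> y) (univ U)" "borel_witness \<kappa> U x y \<mu> (dirac U y q) \<phi> N" for \<phi> N
    by (rule ext_product_eq[OF mon y(1) dirac_keisler[OF q] that])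
next
  note mon = assms(1) and x = assms(2) and y = assms(3,4)
  fix p q and U' :: "('f, 'r, 'a) struct"
  assume pq: "p \<in> ctypes U x (univ U)" "q \<in> ctypes U y (univ U)"
    "invariant_type \<kappa> U x p" "larger_monster \<kappa>' T U U'"
  show "borel_pair \<kappa> U x y (dirac U x p) (dirac U y q)"
    "dirac U (x \<union> y) (type_product \<kappa> U U' x y p q) = ext_product \<kappa> U x y (dirac U x p) (dirac U y q)"
    by (rule dirac_type_product[OF mon x y pq])+
qed

end
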